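(* Let $1<\alpha<2$, $T>0$, $s\ge0$, $u_0\in H_s$ and $u_1\in H_{s-\frac1\alpha}$. There exists a unique weak solution $u\in C([0,T];H_s)$ to $$\mathrm{i}^\alpha\partial_t^\alpha u(t)+Au(t)=0,\quad t\in(0,T),\qquad u(0)=u_0,\quad \partial_tu(0)=u_1, \tag{P}$$ such that, for a constant $C>0$ independent of $u_0,u_1$, $$\|u\|_{C([0,T];H_s)}\le C\left(\|u_0\|_s+\|u_1\|_{s-\frac1\alpha}\right).$$ Moreover, the unique weak solution to (P) is given by $$u(t)=\sum_{n=1}^\infty\langle u_0,\varphi_n\rangle E_{\alpha,1}(\mathrm{i}^{-\alpha}\lambda_nt^\alpha)\varphi_n+\sum_{n=1}^\infty\langle u_1,\varphi_n\rangle\,tE_{\alpha,2}(\mathrm{i}^{-\alpha}\lambda_nt^\alpha)\varphi_n,$$ where the bracket is taken as a duality bracket depending on the regularity of $u_0$ and $u_1$.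
   Context: $(H,\langle\cdot,\cdot\rangle)$ is a (complex) Hilbert space with norm $\|\cdot\|$; $A:D(A)\subset H\to H$ is a negative-definite self-adjoint operator with compact resolvent. The eigenvalues of $-A$ are $0<\lambda_1\le\lambda_2\le\cdots\to\infty$, with a corresponding Hilbert (orthonormal) basis of eigenvectors $\{\varphi_n\}_{n\ge1}\subset D(A)$. For $s\ge0$, $H_s=\{u\in H:\sum_n\lambda_n^{2s}|\langle u,\varphi_n\rangle|^2<\infty\}$ with $\|u\|_s^2=\sum_n\lambda_n^{2s}|\langle u,\varphi_n\rangle|^2$; $H_{-s}=H_s'$ is its dual (identifying $H=H'$) with norm $\|u\|_{-s}^2=\sum_n\lambda_n^{-2s}|\langle u,\varphi_n\rangle_{-s,s}|^2$, where $\langle\cdot,\cdot\rangle_{-s,s}$ is the duality bracket between $H_{-s}$ and $H_s$, with $\langle u,v\rangle_{-s,s}=\langle u,v\rangle$ if $u\in H$ and $v\in H_s$. For $u=\sum_nu_n\varphi_n\in H$, $Au=-\sum_n\lambda_nu_n\varphi_n$ (as an element of a space $H_{-s}$). Powers: $\mathrm{i}^{\alpha}=e^{\mathrm{i}\pi\alpha/2}$, $\mathrm{i}^{-\alpha}=e^{-\mathrm{i}\pi\alpha/2}$. Mittag-Leffler function: $E_{\alpha,\beta}(z)=\sum_{k\ge0}z^k/\Gamma(\alpha k+\beta)$, $z\in\mathbb{C}$. Caputo derivative for $1<\alpha<2$: $\partial_t^\alpha u(t)=\frac{1}{\Gamma(2-\alpha)}\int_0^t(t-s)^{1-\alpha}\partial_s^2u(s)\,\mathrm{d}s$,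 whenever the right-hand side is well-defined. Weak solution of (P) for $u_0\in H$, $u_1\in H_{-1/\alpha}$: a function $u$ such that (1) $u\in C([0,T];H)$; (2) $\partial_t^\alpha u(t),Au(t)\in H_{-2/\alpha}$ for almost all $t\in(0,T)$ and the equation holds in $H_{-2/\alpha}$ for almost all $t\in(0,T)$; (3) $\lim_{t\to0^+}\|u(t)-u_0\|=0$ and $\lim_{t\to0^+}\|\partial_tu(t)-u_1\|_{-1/\alpha}=0$. *)

theory Defs
  imports "HOL-Analysis.Analysis"
begin

text \<open>Complex Hilbert spaces. The inner product is linear in its \<^emph>\<open>first\<close> argument, so that
  \<open>cinner u (\<phi> n)\<close> is the n-th coefficient of \<open>u\<close> in an orthonormal basis \<open>\<phi>\<close>.\<close>

class complex_hilbert_space = banach +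
  fixes scaleC :: "complex \<Rightarrow> 'a \<Rightarrow> 'a"  (infixr "*\<^sub>C" 75)
    and cinner :: "'a \<Rightarrow> 'a \<Rightarrow> complex"
  assumes scaleR_scaleC: "scaleR r x = complex_of_real r *\<^sub>C x"
    and scaleC_add_right: "c *\<^sub>C (x + y) = c *\<^sub>C x + c *\<^sub>C y"
    and scaleC_add_left: "(c + d) *\<^sub>C x = c *\<^sub>C x + d *\<^sub>C x"
    and scaleC_scaleC: "c *\<^sub>C d *\<^sub>C x = (c * d) *\<^sub>C x"
    and cinner_commute: "cinner x y = cnj (cinner y x)"
    and cinner_add_left: "cinner (x + y) z = cinner x z + cinner y z"
    and cinner_scaleC_left: "cinner (c *\<^sub>C x) y = c * cinner x y"
    and cinner_ge_zero: "0 \<le> Re (cinner x x)"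
    and norm_eq_sqrt_cinner: "norm x = sqrt (Re (cinner x x))"


subsection \<open>The operator\<close>

text \<open>An unbounded operator is a function \<open>A\<close> together with its domain \<open>D\<close>; the values of \<open>A\<close>
  outside \<open>D\<close> are irrelevant.\<close>

definition clinear_on :: "'h::complex_hilbert_space set \<Rightarrow> ('h \<Rightarrow> 'h) \<Rightarrow> bool" where
  "clinear_on D A \<longleftrightarrow> 0 \<in> D \<and>
     (\<forall>x\<in>D. \<forall>y\<in>D. x + y \<in> D \<and> A (x + y) = A x + A y) \<and>
     (\<forall>c. \<forall>x\<in>D. c *\<^sub>C x \<in> D \<and> A (c *\<^sub>C x) = c *\<^sub>C A x)"

text \<open>The last conjunct says that the graph of the adjoint of \<open>A\<close> is the graph of \<open>A\<close>; in
  particular the two domains agree.\<close>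

definition self_adjoint :: "'h::complex_hilbert_space set \<Rightarrow> ('h \<Rightarrow> 'h) \<Rightarrow> bool" where
  "self_adjoint D A \<longleftrightarrow> clinear_on D A \<and> closure D = UNIV \<and>
     (\<forall>y z. (\<forall>x\<in>D. cinner (A x) y = cinner x z) \<longleftrightarrow> y \<in> D \<and> A y = z)"

definition negative_definite :: "'h::complex_hilbert_space set \<Rightarrow> ('h \<Rightarrow> 'h) \<Rightarrow> bool" where
  "negative_definite D A \<longleftrightarrow> (\<forall>x\<in>D. x \<noteq> 0 \<longrightarrow> Re (cinner (A x) x) < 0)"

definition compact_resolvent :: "'h::complex_hilbert_space set \<Rightarrow> ('h \<Rightarrow> 'h) \<Rightarrow> bool" where
  "compact_resolvent D A \<longleftrightarrow> (\<exists>\<mu> R.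
     (\<forall>x. R x \<in> D \<and> \<mu> *\<^sub>C R x - A (R x) = x) \<and>
     (\<forall>x\<in>D. R (\<mu> *\<^sub>C x - A x) = x) \<and>
     compact (closure (R ` cball 0 1)))"

text \<open>The eigenvalues \<open>lam n\<close> of \<open>-A\<close> and a Hilbert basis \<open>\<phi>\<close> of eigenvectors, indexed from 0.\<close>

definition eigenbasis ::
  "'h::complex_hilbert_space set \<Rightarrow> ('h \<Rightarrow> 'h) \<Rightarrow> (nat \<Rightarrow> real) \<Rightarrow> (nat \<Rightarrow> 'h) \<Rightarrow> bool" where
  "eigenbasis D A lam \<phi> \<longleftrightarrow>
     0 < lam 0 \<and> mono lam \<and> filterlim lam at_top sequentially \<and>
     (\<forall>n. \<phi> n \<in> D \<and> A (\<phi> n) = - (complex_of_real (lam n) *\<^sub>C \<phi> n)) \<and>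
     (\<forall>m n. cinner (\<phi> m) (\<phi> n) = (if m = n then 1 else 0)) \<and>
     (\<forall>u. (\<lambda>n. cinner u (\<phi> n) *\<^sub>C \<phi> n) sums u)"


subsection \<open>The scale of spaces\<close>

text \<open>\<open>hspace lam \<phi> s\<close> is \<open>H\<^sub>s\<close> for \<open>s \<ge> 0\<close>.\<close>

definition hspace ::
  "(nat \<Rightarrow> real) \<Rightarrow> (nat \<Rightarrow> 'h::complex_hilbert_space) \<Rightarrow> real \<Rightarrow> 'h set" where
  "hspace lam \<phi> s = {u. summable (\<lambda>n. lam n powr (2 * s) * (cmod (cinner u (\<phi> n)))\<^sup>2)}"

text \<open>Elements of dual spaces are functionals \<open>f :: 'h \<Rightarrow> complex\<close>, where \<open>f v\<close> is the duality bracket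
  of \<open>f\<close> with \<open>v\<close>. Identifying \<open>H\<close> with its dual means that \<open>u\<close> is the functional \<open>cinner u\<close>, which
  is antilinear. \<open>hnorm lam \<phi> r f\<close> is the norm of \<open>f\<close> in \<open>H\<^sub>r\<close>, for \<open>r\<close> of either sign; it depends
  on the brackets \<open>f (\<phi> n)\<close> only.\<close>

definition hnorm ::
  "(nat \<Rightarrow> real) \<Rightarrow> (nat \<Rightarrow> 'h::complex_hilbert_space) \<Rightarrow> real \<Rightarrow> ('h \<Rightarrow> complex) \<Rightarrow> real" where
  "hnorm lam \<phi> r f = sqrt (\<Sum>n. lam n powr (2 * r) * (cmod (f (\<phi> n)))\<^sup>2)"

text \<open>\<open>hdual lam \<phi> s\<close> is \<open>H\<^sub>-\<^sub>s\<close>, the bounded antilinear functionals on \<open>H\<^sub>s\<close>, for \<open>s \<ge> 0\<close>. The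
  values of \<open>f\<close> outside \<open>H\<^sub>s\<close> are irrelevant: two functions that agree on \<open>H\<^sub>s\<close> represent the same
  element. With this convention the embedding of \<open>H\<^sub>-\<^sub>s\<close> into \<open>H\<^sub>-\<^sub>r\<close> for \<open>s \<le> r\<close>, that is, the
  restriction of functionals to \<open>H\<^sub>r\<close>, leaves \<open>f\<close> unchanged.\<close>

definition hdual ::
  "(nat \<Rightarrow> real) \<Rightarrow> (nat \<Rightarrow> 'h::complex_hilbert_space) \<Rightarrow> real \<Rightarrow> ('h \<Rightarrow> complex) set" where
  "hdual lam \<phi> s = {f.
     (\<forall>x\<in>hspace lam \<phi> s. \<forall>y\<in>hspace lam \<phi> s. f (x + y) = f x + f y) \<and>
     (\<forall>c. \<forall>x\<in>hspace lam \<phi> s. f (c *\<^sub>C x) = cnj c * f x) \<and>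
     (\<exists>K. \<forall>x\<in>hspace lam \<phi> s. cmod (f x) \<le> K * hnorm lam \<phi> s (cinner x))}"

text \<open>\<open>H\<^sub>r\<close> for \<open>r\<close> of either sign, with \<open>H\<close> identified with its dual.\<close>

definition hscale ::
  "(nat \<Rightarrow> real) \<Rightarrow> (nat \<Rightarrow> 'h::complex_hilbert_space) \<Rightarrow> real \<Rightarrow> ('h \<Rightarrow> complex) set" where
  "hscale lam \<phi> r = (if 0 \<le> r then cinner ` hspace lam \<phi> r else hdual lam \<phi> (- r))"

text \<open>\<open>A u\<close> as an element of a dual space, for \<open>u\<close> in \<open>H\<close>:
  the series of the functionals \<open>- lam n * cinner u (\<phi> n)\<close> times \<open>\<phi> n\<close>.\<close>

definition op_ext ::
  "(nat \<Rightarrow> real) \<Rightarrow> (nat \<Rightarrow> 'h::complex_hilbert_space) \<Rightarrow> 'h \<Rightarrow> 'h \<Rightarrow> complex" where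
  "op_ext lam \<phi> u v =
     - (\<Sum>n. complex_of_real (lam n) * cinner u (\<phi> n) * cinner (\<phi> n) v)"

text \<open>\<open>u \<in> C([0,T];H\<^sub>s)\<close> and the norm of that space.\<close>

definition continuous_hspace ::
  "(nat \<Rightarrow> real) \<Rightarrow> (nat \<Rightarrow> 'h::complex_hilbert_space) \<Rightarrow> real \<Rightarrow> real \<Rightarrow> (real \<Rightarrow> 'h) \<Rightarrow> bool" where
  "continuous_hspace lam \<phi> s T u \<longleftrightarrow>
     (\<forall>t\<in>{0..T}. u t \<in> hspace lam \<phi> s) \<and>
     (\<forall>t\<in>{0..T}. ((\<lambda>r. hnorm lam \<phi> s (cinner (u r - u t))) \<longlongrightarrow> 0) (at t within {0..T}))"

definition sup_hnorm ::
  "(nat \<Rightarrow> real) \<Rightarrow> (nat \<Rightarrow> 'h::complex_hilbert_space) \<Rightarrow> real \<Rightarrow> real \<Rightarrow> (real \<Rightarrow> 'h) \<Rightarrow> real" where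
  "sup_hnorm lam \<phi> s T u = (SUP t\<in>{0..T}. hnorm lam \<phi> s (cinner (u t)))"


subsection \<open>Calculus in the dual spaces\<close>

text \<open>\<open>w\<close> is the Bochner integral in \<open>H\<^sub>-\<^sub>\<sigma>\<close> of \<open>f\<close> over the interval \<open>S\<close>. This follows
  \<^const>\<open>has_bochner_integral\<close>, which is not applicable because \<open>H\<^sub>-\<^sub>\<sigma>\<close> is not a type.\<close>

definition has_bochner_hdual ::
  "(nat \<Rightarrow> real) \<Rightarrow> (nat \<Rightarrow> 'h::complex_hilbert_space) \<Rightarrow> real \<Rightarrow> real set
    \<Rightarrow> (real \<Rightarrow> 'h \<Rightarrow> complex) \<Rightarrow> ('h \<Rightarrow> complex) \<Rightarrow> bool" where
  "has_bochner_hdual lam \<phi> \<sigma> S f w \<longleftrightarrow>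
     (\<forall>t\<in>S. f t \<in> hdual lam \<phi> \<sigma>) \<and> w \<in> hdual lam \<phi> \<sigma> \<and>
     (\<exists>g :: nat \<Rightarrow> real \<Rightarrow> 'h \<Rightarrow> complex.
        (\<forall>k. simple_function (lebesgue_on S) (g k)) \<and>
        (\<forall>k. \<forall>t\<in>S. g k t \<in> hdual lam \<phi> \<sigma>) \<and>
        (\<forall>k. (\<lambda>t. hnorm lam \<phi> (- \<sigma>) (\<lambda>v. f t v - g k t v)) \<in> borel_measurable (lebesgue_on S)) \<and>
        (\<lambda>k. \<integral>\<^sup>+ t. ennreal (hnorm lam \<phi> (- \<sigma>) (\<lambda>v. f t v - g k t v)) \<partial>lebesgue_on S)
          \<longlonglongrightarrow> 0 \<and>
        (\<lambda>k. hnorm lam \<phi> (- \<sigma>) (\<lambda>v.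
             (\<Sum>y\<in>g k ` S. complex_of_real (measure (lebesgue_on S) {t\<in>S. g k t = y}) * y v) - w v))
          \<longlonglongrightarrow> 0)"

text \<open>\<open>g\<close> is the (Sobolev) time derivative of \<open>f\<close> on \<open>(0,T)\<close> with values in \<open>H\<^sub>-\<^sub>\<sigma>\<close>: \<open>g\<close> is
  locally Bochner integrable and \<open>f\<close> is a primitive of \<open>g\<close>, so \<open>f\<close> is locally absolutely
  continuous. At each point of continuity of \<open>g\<close> it is the classical derivative of \<open>f\<close>.\<close>

definition has_time_deriv ::
  "(nat \<Rightarrow> real) \<Rightarrow> (nat \<Rightarrow> 'h::complex_hilbert_space) \<Rightarrow> real \<Rightarrow> real
    \<Rightarrow> (real \<Rightarrow> 'h \<Rightarrow> complex) \<Rightarrow> (real \<Rightarrow> 'h \<Rightarrow> complex) \<Rightarrow> bool" where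
  "has_time_deriv lam \<phi> \<sigma> T f g \<longleftrightarrow>
     (\<forall>t\<in>{0<..<T}. f t \<in> hdual lam \<phi> \<sigma> \<and> g t \<in> hdual lam \<phi> \<sigma>) \<and>
     (\<forall>a b. 0 < a \<and> a \<le> b \<and> b < T \<longrightarrow>
        has_bochner_hdual lam \<phi> \<sigma> {a..b} g (\<lambda>v. f b v - f a v))"

text \<open>The Caputo derivative at time \<open>t\<close> of a function with second time derivative \<open>u''\<close> is \<open>w\<close>;
  it is well-defined when the Bochner integral exists.\<close>

definition has_caputo_deriv ::
  "(nat \<Rightarrow> real) \<Rightarrow> (nat \<Rightarrow> 'h::complex_hilbert_space) \<Rightarrow> real \<Rightarrow> real
    \<Rightarrow> (real \<Rightarrow> 'h \<Rightarrow> complex) \<Rightarrow> real \<Rightarrow> ('h \<Rightarrow> complex) \<Rightarrow> bool" where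
  "has_caputo_deriv lam \<phi> \<sigma> \<alpha> u'' t w \<longleftrightarrow>
     (\<exists>y. has_bochner_hdual lam \<phi> \<sigma> {0<..<t}
            (\<lambda>r v. complex_of_real ((t - r) powr (1 - \<alpha>)) * u'' r v) y \<and>
          w = (\<lambda>v. complex_of_real (1 / Gamma (2 - \<alpha>)) * y v))"


subsection \<open>The initial value problem\<close>

text \<open>The power \<open>\<i>\<^sup>a\<close> for real \<open>a\<close>.\<close>

definition ipow :: "real \<Rightarrow> complex" where
  "ipow a = exp (\<i> * complex_of_real (pi * a / 2))"

definition mittag_leffler :: "real \<Rightarrow> real \<Rightarrow> complex \<Rightarrow> complex" where
  "mittag_leffler \<alpha> \<beta> z = (\<Sum>k. z ^ k / Gamma (complex_of_real (\<alpha> * real k + \<beta>)))"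

text \<open>Weak solutions for \<open>u0\<close> in \<open>H\<close> and \<open>u1\<close> in \<open>H\<^bsub>-1/\<alpha>\<^esub>\<close>. Here \<open>u'\<close> and \<open>u''\<close> are the first and second
  time derivatives in \<open>H\<^bsub>-2/\<alpha>\<^esub>\<close>; \<open>u'\<close> is itself locally absolutely continuous, so its values as
  elements of \<open>H\<^bsub>-2/\<alpha>\<^esub>\<close> are determined by \<open>u\<close> at every time.\<close>

definition weak_solution ::
  "(nat \<Rightarrow> real) \<Rightarrow> (nat \<Rightarrow> 'h::complex_hilbert_space) \<Rightarrow> real \<Rightarrow> real
    \<Rightarrow> 'h \<Rightarrow> ('h \<Rightarrow> complex) \<Rightarrow> (real \<Rightarrow> 'h) \<Rightarrow> bool" where
  "weak_solution lam \<phi> \<alpha> T u0 u1 u \<longleftrightarrow>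
     continuous_on {0..T} u \<and>
     (\<exists>u' u''.
        has_time_deriv lam \<phi> (2 / \<alpha>) T (\<lambda>t. cinner (u t)) u' \<and>
        has_time_deriv lam \<phi> (2 / \<alpha>) T u' u'' \<and>
        (AE t in lebesgue_on {0<..<T}. \<exists>w.
           has_caputo_deriv lam \<phi> (2 / \<alpha>) \<alpha> u'' t w \<and>
           w \<in> hdual lam \<phi> (2 / \<alpha>) \<and> op_ext lam \<phi> (u t) \<in> hdual lam \<phi> (2 / \<alpha>) \<and>
           (\<forall>v\<in>hspace lam \<phi> (2 / \<alpha>). ipow \<alpha> * w v + op_ext lam \<phi> (u t) v = 0)) \<and>
        ((\<lambda>t. norm (u t - u0)) \<longlongrightarrow> 0) (at_right 0) \<and>
        (\<forall>\<^sub>F t in at_right 0. u' t \<in> hdual lam \<phi> (1 / \<alpha>)) \<and>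
        ((\<lambda>t. hnorm lam \<phi> (- (1 / \<alpha>)) (\<lambda>v. u' t v - u1 v)) \<longlongrightarrow> 0) (at_right 0))"

end

theory Submission
  imports Defs "HOL-Complex_Analysis.Complex_Analysis" "HOL-Real_Asymp.Real_Asymp"
begin

text \<open>In the eigenbasis the problem decouples into scalar fractional equations with rate
  \<open>\<i>\<^sup>-\<^sup>\<alpha> \<lambda>\<close>, whose solutions are Mittag-Leffler functions on the ray \<open>arg z = - \<pi> \<alpha> / 2\<close>. This is
  exactly the ray on which \<open>E\<close> neither grows nor decays: there \<open>z\<^bsup>1/\<alpha>\<^esup>\<close> is purely imaginary, and the
  residue of the Hankel-type integral of \<open>E\<close> is \<open>z\<^bsup>(1-\<beta>)/\<alpha>\<^esup> exp (z\<^bsup>1/\<alpha>\<^esup>) / \<alpha>\<close>, while the remaining line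
  integrals are \<open>O(1/\<bar>z\<bar>)\<close>. By homogeneity a time derivative costs a factor \<open>\<lambda>\<^bsup>1/\<alpha>\<^esup>\<close>, which is what
  the spaces of the theorem measure, and dominated convergence over the modes gives the existence part.
  For uniqueness, the fractional integral of order \<open>\<alpha>\<close> turns the equation of each mode into a
  Volterra equation with a bounded kernel.\<close>

subsection \<open>Mittag-Leffler functions on a critical ray\<close>

text \<open>On the critical ray no decay is to spare, and as the eigenvalues grow the arguments run
  through the whole ray; so a bound of exactly the right power, uniform along the ray, is what
  everything rests on. It is obtained in the variable \<open>y = ln zeta\<close>, where powers of
  \<open>zeta\<close> are exponentials and no branch cut is left. The horizontal lines of the
  contour can then be placed anywhere, even below \<open>Im y = - pi\<close>; this is used because
  the lower line has to keep its distance from the pole at \<open>Im y = - pi / 2\<close> and also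
  from the next pole below it. The dual spaces are not types, so every passage between their Bochner
  integrals and scalar integrals goes through two lemmas, \<open>has_bochner_hdualI\<close> and
  \<open>has_bochner_hdualD\<close>. The first asks for a majorant that separates mode and time, and
  the bounds on the modes are shaped to provide one. In the uniqueness part the second derivative of
  a weak solution is a priori integrable only away from time \<open>0\<close>. Its integrability up
  to \<open>0\<close> is extracted from the existence of the Caputo integral at later times.\<close>

lemma contour_integral_linepath_same_Im:
  assumes "a < b"
  shows "contour_integral (linepath (Complex a c) (Complex b c)) f = integral {a..b} (\<lambda>x. f (Complex x c))"
proof -
  have "contour_integral (linepath (Complex a c) (Complex b c)) f =
         of_real (b - a) * integral {0..1} (\<lambda>x. f (linepath (Complex a c) (Complex b c) x))"
    by (simp add: contour_integral_integral Complex_eq)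
  also have "integral {0..1} (\<lambda>x. f (linepath (Complex a c) (Complex b c) x)) =
             integral {0..1} (\<lambda>x. f (Complex (linepath a b x) c))"
    by (simp add: linepath_def Complex_eq scaleR_conv_of_real algebra_simps)
  also have "\<dots> = integral {0..(b - a) / (b - a)} (\<lambda>x. f (Complex (a + (b - a) * x) c))"
    using \<open>a < b\<close> by (simp add: algebra_simps linepath_def)
  also have "{0..(b - a) / (b - a)} = (\<lambda>x. x / (b - a)) ` {0..b - a}"
    using \<open>a < b\<close> by simp
  also have "integral \<dots> (\<lambda>x. f (Complex (a + (b - a) * x) c)) =
             integral {a-a..b-a} (\<lambda>x. f (Complex (x + a) c)) / of_real (b - a)"
    using \<open>a < b\<close> by (subst integral_stretch_real) (auto simp: scaleR_conv_of_real add_ac)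
  also have "\<dots> = integral {a..b} (\<lambda>x. f (Complex x c)) / of_real (b - a)"
    by (subst integral_shift_real_ivl) (rule refl)
  finally show ?thesis
    using \<open>a < b\<close> by simp
qed

section \<open>Vertical segments and the residue theorem on rectangles\<close>

definition vint :: "(complex \<Rightarrow> complex) \<Rightarrow> real \<Rightarrow> real \<Rightarrow> real \<Rightarrow> complex" where
  "vint h p q x = \<i> * integral {p..q} (\<lambda>\<theta>. h (Complex x \<theta>))"

text \<open>The contours below are only ever moved in the horizontal direction. Solving the residue
  theorem for the two vertical sides turns such a move into the integral of a difference along the
  two horizontal lines plus the residues that are passed.\<close>

lemma rectangle_residues:
  assumes "A < B" "p < q" "finite pts" and pts: "pts \<subseteq> box (Complex A p) (Complex B q)"
    and S: "open S" "connected S" "cbox (Complex A p) (Complex B q) \<subseteq> S"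
    and h: "h holomorphic_on S - pts"
  shows "vint h p q B - vint h p q A =
    integral {A..B} (\<lambda>x. h (Complex x q) - h (Complex x p)) + 2 * pi * \<i> * (\<Sum>z\<in>pts. residue h z)"
proof -
  define a1 a2 a3 a4 where a: "a1 = Complex A p" "a2 = Complex B p" "a3 = Complex B q" "a4 = Complex A q"
  have le: "Re a1 \<le> Re a3" "Im a1 \<le> Im a3" using assms by (auto simp: a)
  have img: "path_image (rectpath a1 a3) = cbox a1 a3 - box a1 a3"
    by (rule path_image_rectpath_cbox_minus_box[OF le])
  have sub: "cbox a1 a3 - box a1 a3 \<subseteq> S - pts"
    using S(3) pts by (auto simp: a)
  have rp: "rectpath a1 a3 = linepath a1 a2 +++ linepath a2 a3 +++ linepath a3 a4 +++ linepath a4 a1"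
    by (simp add: rectpath_def a Let_def)
  have segs: "closed_segment a1 a2 \<subseteq> S - pts" "closed_segment a2 a3 \<subseteq> S - pts"
    "closed_segment a3 a4 \<subseteq> S - pts" "closed_segment a4 a1 \<subseteq> S - pts"
    using sub unfolding img[symmetric] rp by (auto simp: path_image_join)
  have cont: "continuous_on T h" if "T \<subseteq> S - pts" for T
    using h that continuous_on_subset holomorphic_on_imp_continuous_on by blast
  have ci: "h contour_integrable_on linepath a1 a2" "h contour_integrable_on linepath a2 a3"
    "h contour_integrable_on linepath a3 a4" "h contour_integrable_on linepath a4 a1"
    using segs cont by (auto intro!: contour_integrable_continuous_linepath)
  have "contour_integral (rectpath a1 a3) h = 2 * pi * \<i> * (\<Sum>z\<in>pts. winding_number (rectpath a1 a3) z * residue h z)"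
  proof (rule Residue_theorem[OF S(1,2) \<open>finite pts\<close> h])
    show "path_image (rectpath a1 a3) \<subseteq> S - pts" using img sub by simp
    show "\<forall>z. z \<notin> S \<longrightarrow> winding_number (rectpath a1 a3) z = 0"
      using S(3) le by (auto intro!: winding_number_rectpath_outside simp: a)
  qed auto
  also have "(\<Sum>z\<in>pts. winding_number (rectpath a1 a3) z * residue h z) = (\<Sum>z\<in>pts. residue h z)"
    by (rule sum.cong) (use pts winding_number_rectpath in \<open>auto simp: a\<close>)
  finally have 1: "contour_integral (rectpath a1 a3) h = 2 * pi * \<i> * (\<Sum>z\<in>pts. residue h z)" .
  have "contour_integral (rectpath a1 a3) h = contour_integral (linepath a1 a2) h
      + contour_integral (linepath a2 a3) h + contour_integral (linepath a3 a4) h + contour_integral (linepath a4 a1) h"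
    unfolding rp using ci by (simp add: contour_integrable_joinI valid_path_join)
  also have "contour_integral (linepath a3 a4) h = - contour_integral (linepath a4 a3) h"
    by (rule contour_integral_reverse_linepath) (use segs cont in auto)
  also have "contour_integral (linepath a4 a1) h = - contour_integral (linepath a1 a4) h"
    by (rule contour_integral_reverse_linepath) (use segs cont in auto)
  also have "contour_integral (linepath a1 a2) h = integral {A..B} (\<lambda>x. h (Complex x p))"
    unfolding a by (rule contour_integral_linepath_same_Im[OF \<open>A < B\<close>])
  also have "contour_integral (linepath a4 a3) h = integral {A..B} (\<lambda>x. h (Complex x q))"
    unfolding a by (rule contour_integral_linepath_same_Im[OF \<open>A < B\<close>])
  also have "contour_integral (linepath a2 a3) h = vint h p q B"
    unfolding a vint_def by (rule contour_integral_linepath_same_Re) (use \<open>p < q\<close> in auto)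
  also have "contour_integral (linepath a1 a4) h = vint h p q A"
    unfolding a vint_def by (rule contour_integral_linepath_same_Re) (use \<open>p < q\<close> in auto)
  finally have 2: "contour_integral (rectpath a1 a3) h = integral {A..B} (\<lambda>x. h (Complex x p)) + vint h p q B
     - integral {A..B} (\<lambda>x. h (Complex x q)) - vint h p q A" by simp
  have i: "(\<lambda>x. h (Complex x r)) integrable_on {A..B}" if "r = p \<or> r = q" for r
  proof (rule integrable_continuous_real)
    have "(\<lambda>x. Complex x r) ` {A..B} \<subseteq> cbox a1 a3 - box a1 a3"
      using that assms(1,2) by (auto simp: a in_cbox_complex_iff in_box_complex_iff)
    then have "continuous_on ((\<lambda>x. Complex x r) ` {A..B}) h" using sub cont by blast
    then show "continuous_on {A..B} (\<lambda>x. h (Complex x r))"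
      by (intro continuous_on_compose2[of _ h _ "\<lambda>x. Complex x r"]) (auto intro!: continuous_intros simp: Complex_eq)
  qed
  show ?thesis using 1 2 i by (simp add: integral_diff algebra_simps)
qed

text \<open>With \<open>zeta = exp y\<close> this is \<open>exp zeta * zeta powr (- s)\<close> times
  \<open>d zeta\<close>; the factor \<open>exp y\<close> of the substitution accounts for the
  \<open>1\<close> in \<open>1 - s\<close>. The function is entire in \<open>y\<close>, and Hankel's
  loop becomes the boundary of a half-strip that is open to the right.\<close>

definition hankel :: "real \<Rightarrow> complex \<Rightarrow> complex" where
  "hankel s y = exp (exp y + of_real (1 - s) * y)"

lemma norm_hankel: "norm (hankel s (Complex x \<theta>)) = exp (exp x * cos \<theta> + (1 - s) * x)"
  by (simp add: hankel_def Re_exp)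

lemma continuous_on_hankel [continuous_intros]:
  "continuous_on A f \<Longrightarrow> continuous_on A (\<lambda>x. hankel s (f x))"
  unfolding hankel_def by (intro continuous_intros)

lemma holomorphic_hankel: "hankel s holomorphic_on A"
  unfolding hankel_def[abs_def] by (intro holomorphic_intros)

lemma continuous_on_Complex_left: "continuous_on A (\<lambda>x. Complex x c)"
  and continuous_on_Complex_right: "continuous_on A (\<lambda>x. Complex c x)"
  by (auto simp: Complex_eq intro!: continuous_intros)

lemma norm_vint_le:
  assumes "p \<le> q" "continuous_on {p..q} (\<lambda>\<theta>. h (Complex x \<theta>))"
    and "\<And>\<theta>. \<theta> \<in> {p..q} \<Longrightarrow> norm (h (Complex x \<theta>)) \<le> B"
  shows "norm (vint h p q x) \<le> B * (q - p)"
  using integral_bound[OF assms(1,2), of B] assms(3) by (simp add: vint_def norm_mult)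

lemma vint_hankel_at_top:
  assumes "p \<le> q" "k > 0" "\<And>\<theta>. \<theta> \<in> {p..q} \<Longrightarrow> cos \<theta> \<le> - k"
  shows "(vint (hankel s) p q \<longlongrightarrow> 0) at_top"
proof (rule tendsto_0_le[where K = 1])
  show "((\<lambda>x. exp (- k * exp x + (1 - s) * x) * (q - p)) \<longlongrightarrow> 0) at_top"
    using \<open>k > 0\<close> by real_asymp
  have "norm (vint (hankel s) p q x) \<le> exp (- k * exp x + (1 - s) * x) * (q - p)" for x
  proof (rule norm_vint_le[OF assms(1)])
    fix \<theta> assume "\<theta> \<in> {p..q}"
    from assms(3)[OF this] have "exp x * cos \<theta> \<le> exp x * (-k)" by (intro mult_left_mono) auto
    then show "norm (hankel s (Complex x \<theta>)) \<le> exp (- k * exp x + (1 - s) * x)"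
      by (simp add: norm_hankel mult.commute)
  qed (intro continuous_intros continuous_on_Complex_right)
  then show "\<forall>\<^sub>F x in at_top. norm (vint (hankel s) p q x) \<le> norm (exp (- k * exp x + (1 - s) * x) * (q - p)) * 1"
    using assms(1) by (simp add: abs_mult)
qed

text \<open>A segment far to the left is an arc of a small circle about \<open>zeta = 0\<close>;
  \<open>s < 1\<close> is the integrability of \<open>zeta powr (- s)\<close> there.\<close>

lemma vint_hankel_at_bot:
  assumes "p \<le> q" "s < 1"
  shows "(vint (hankel s) p q \<longlongrightarrow> 0) at_bot"
proof (rule tendsto_0_le[where K = 1])
  have "1 - s > 0" using assms by simp
  then have "filterlim (\<lambda>x. exp x + (1 - s) * x) at_bot at_bot"
    by real_asymp
  then show "((\<lambda>x. exp (exp x + (1 - s) * x) * (q - p)) \<longlongrightarrow> 0) at_bot"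
    by (intro tendsto_mult_left_zero filterlim_compose[OF exp_at_bot])
  have "norm (vint (hankel s) p q x) \<le> exp (exp x + (1 - s) * x) * (q - p)" for x
    by (rule norm_vint_le[OF assms(1)])
      (auto intro!: continuous_intros continuous_on_Complex_right simp: norm_hankel)
  then show "\<forall>\<^sub>F x in at_bot. norm (vint (hankel s) p q x) \<le> norm (exp (exp x + (1 - s) * x) * (q - p)) * 1"
    using assms(1) by (simp add: abs_mult)
qed

section \<open>Integrals along horizontal lines\<close>

lemma Gamma_integral_exp:
  assumes "k > 0" "a > (0::real)"
  shows "((\<lambda>x. exp (- k * exp x + a * x)) has_integral Gamma a / k powr a) UNIV"
proof -
  \<comment> \<open>The substitution \<open>t = k * exp x\<close> in Euler's integral maps the line
    onto the open half-line, so the null set \<open>{0}\<close> has to be removed from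
    \<open>{0..}\<close>.\<close>
  have "range (\<lambda>x. k * exp x) = {0<..}"
  proof (intro equalityI subsetI)
    fix y :: real assume "y \<in> {0<..}"
    then show "y \<in> range (\<lambda>x. k * exp x)" using \<open>k > 0\<close>
      by (intro image_eqI[of _ _ "ln (y / k)"]) auto
  qed (use \<open>k > 0\<close> in auto)
  moreover have G: "((\<lambda>t. t powr (a - 1) / exp t) has_integral Gamma a) {0<..}"
    using Gamma_integral_real[OF \<open>a > 0\<close>]
    by (subst has_integral_spike_set_eq[where T = "{0..}"]) (auto intro: negligible_subset[of "{0}"])
  moreover have "(\<lambda>t. t powr (a - 1) / exp t) absolutely_integrable_on {0<..}"
    using G by (intro nonnegative_absolutely_integrable_1) auto
  ultimately have *: "(\<lambda>x. \<bar>k * exp x\<bar> * ((k * exp x) powr (a - 1) / exp (k * exp x))) absolutely_integrable_on UNIV \<and>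
     integral UNIV (\<lambda>x. \<bar>k * exp x\<bar> * ((k * exp x) powr (a - 1) / exp (k * exp x))) = Gamma a"
    by (subst has_absolute_integral_change_of_variables_1'[where g = "\<lambda>x. k * exp x" and f = "\<lambda>t. t powr (a - 1) / exp t"])
       (use \<open>k > 0\<close> in \<open>auto intro!: derivative_eq_intros inj_onI simp: integral_unique\<close>)
  have eq: "\<bar>k * exp x\<bar> * ((k * exp x) powr (a - 1) / exp (k * exp x)) = k powr a * exp (- k * exp x + a * x)" for x
  proof -
    have "\<bar>k * exp x\<bar> * ((k * exp x) powr (a - 1)) = (k * exp x) powr a"
      using \<open>k > 0\<close> by (simp add: powr_mult powr_diff)
    also have "\<dots> = k powr a * exp (a * x)"
      using \<open>k > 0\<close> by (simp add: powr_def ln_mult distrib_left exp_add)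
    finally show ?thesis by (simp add: exp_add exp_diff divide_simps mult_ac)
  qed
  have "((\<lambda>x. k powr a * exp (- k * exp x + a * x)) has_integral Gamma a) UNIV"
    using * unfolding eq by (auto simp: has_integral_iff absolutely_integrable_on_def)
  from has_integral_divide[OF this, of "k powr a"] show ?thesis using \<open>k > 0\<close> by simp
qed

lemma integrable_exp_exp:
  assumes "k > 0" "a > 0"
  shows "(\<lambda>x. exp (- k * exp x + a * x)) integrable_on (UNIV :: real set)"
  using Gamma_integral_exp[OF assms] by (auto simp: integrable_on_def)

lemma integrable_exp_exp_atLeast:
  assumes "k > 0"
  shows "(\<lambda>x. exp (- k * exp x + c * x)) integrable_on {M::real..}"
proof (rule measurable_bounded_by_integrable_imp_integrable)
  show "(\<lambda>x. exp (- k * exp x + c * x)) \<in> borel_measurable (lebesgue_on {M..})"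
    by (intro continuous_imp_measurable_on_sets_lebesgue continuous_intros) auto
  \<comment> \<open>The integral over the whole line requires a positive coefficient of
    \<open>x\<close>. On \<open>{M..}\<close> the coefficient \<open>c\<close> may be raised to
    \<open>\<bar>c\<bar> + 1\<close>; the constant factor in front pays for the negative
    \<open>x\<close>.\<close>
  have "(\<lambda>x. exp ((2 * \<bar>c\<bar> + 1) * \<bar>M\<bar>) * exp (- k * exp x + (\<bar>c\<bar> + 1) * x)) integrable_on UNIV"
    by (intro integrable_on_mult_right integrable_exp_exp assms) auto
  then have "(\<lambda>x. exp ((2 * \<bar>c\<bar> + 1) * \<bar>M\<bar>) * exp (- k * exp x + (\<bar>c\<bar> + 1) * x)) absolutely_integrable_on UNIV"
    by (rule nonnegative_absolutely_integrable_1) auto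
  then have "(\<lambda>x. exp ((2 * \<bar>c\<bar> + 1) * \<bar>M\<bar>) * exp (- k * exp x + (\<bar>c\<bar> + 1) * x)) absolutely_integrable_on {M..}"
    by (rule set_integrable_subset) auto
  then show "(\<lambda>x. exp ((2 * \<bar>c\<bar> + 1) * \<bar>M\<bar>) * exp (- k * exp x + (\<bar>c\<bar> + 1) * x)) integrable_on {M..}"
    by (rule set_lebesgue_integral_eq_integral)
  fix x assume "x \<in> {M..}"
  then have x: "- x \<le> \<bar>M\<bar>" by auto
  have "c * x \<le> \<bar>c\<bar> * \<bar>x\<bar>" by (metis abs_ge_self abs_mult)
  also have "\<dots> \<le> (2 * \<bar>c\<bar> + 1) * \<bar>M\<bar> + (\<bar>c\<bar> + 1) * x"
  proof (cases "x \<ge> 0")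
    case True
    have "0 \<le> (2 * \<bar>c\<bar> + 1) * \<bar>M\<bar>" by simp
    then show ?thesis using True by (simp add: algebra_simps)
  next
    case False
    have "(2 * \<bar>c\<bar> + 1) * (- x) \<le> (2 * \<bar>c\<bar> + 1) * \<bar>M\<bar>" by (intro mult_left_mono x) auto
    then show ?thesis using False by (simp add: algebra_simps)
  qed
  finally show "norm (exp (- k * exp x + c * x)) \<le> exp ((2 * \<bar>c\<bar> + 1) * \<bar>M\<bar>) * exp (- k * exp x + (\<bar>c\<bar> + 1) * x)"
    by (simp add: exp_add[symmetric])
qed auto

lemma tendsto_integral_atLeast:
  fixes f :: "real \<Rightarrow> complex"
  assumes "f integrable_on {M..}" "g integrable_on {M..}" "\<And>x. x \<ge> M \<Longrightarrow> norm (f x) \<le> g x"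
  shows "(\<lambda>k::nat. integral {M..M + real k} f) \<longlonglongrightarrow> integral {M..} f"
proof -
  have "(\<lambda>k::nat. integral {M..} (\<lambda>x. if x \<in> {M..M + real k} then f x else 0)) \<longlonglongrightarrow> integral {M..} f"
  proof (rule dominated_convergence(2))
    fix k :: nat
    have "f integrable_on {M..M + real k}"
      by (rule integrable_on_subinterval[OF assms(1)]) auto
    then show "(\<lambda>x. if x \<in> {M..M + real k} then f x else 0) integrable_on {M..}"
      by (subst integrable_restrict_Int) (simp add: inf_absorb1 Int_absorb2 Icc_subset_Ici_iff)
  next
    show "g integrable_on {M..}" by fact
    fix x k assume "x \<in> {M..}"
    then show "norm (if x \<in> {M..M + real k} then f x else 0) \<le> g x"
      using assms(3)[of x] norm_ge_zero[of "f x"] by (auto simp del: norm_ge_zero)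
  next
    fix x assume "x \<in> {M..}"
    have "\<forall>\<^sub>F k::nat in sequentially. f x = (if x \<in> {M..M + real k} then f x else 0)"
      using eventually_ge_at_top[of "nat \<lceil>x - M\<rceil>"]
      by eventually_elim (use \<open>x \<in> {M..}\<close> in \<open>auto simp: nat_le_iff ceiling_le_iff\<close>)
    then show "(\<lambda>k::nat. if x \<in> {M..M + real k} then f x else 0) \<longlonglongrightarrow> f x"
      by (rule Lim_transform_eventually[OF tendsto_const])
  qed
  also have "(\<lambda>k::nat. integral {M..} (\<lambda>x. if x \<in> {M..M + real k} then f x else 0))
     = (\<lambda>k. integral {M..M + real k} f)"
    by (rule ext) (subst integral_restrict_Int, simp add: Int_absorb2 Icc_subset_Ici_iff)
  finally show ?thesis .
qed

section \<open>Vertical integrals of \<open>hankel\<close> and Hankel's formula\<close>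

lemma vint_hankel_diff:
  assumes "A \<le> B" "p < q"
  shows "vint (hankel s) p q B - vint (hankel s) p q A =
    integral {A..B} (\<lambda>x. hankel s (Complex x q) - hankel s (Complex x p))"
proof (cases "A = B")
  case False
  then show ?thesis
    using rectangle_residues[of A B p q "{}" UNIV "hankel s"] assms holomorphic_hankel[of s UNIV]
    by (simp add: connected_UNIV)
qed simp

text \<open>Both lines are mapped by \<open>exp\<close> to the negative half-axis: they are the two
  edges of the classical cut, and the two values differ only in their phase.\<close>

lemma hankel_pi:
  "hankel s (Complex x pi) - hankel s (Complex x (- pi)) =
     2 * \<i> * sin (pi * (1 - s)) * exp (- exp x + (1 - s) * x)"
proof -
  have e: "exp (Complex x pi) = - of_real (exp x)" "exp (Complex x (- pi)) = - of_real (exp x)"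
    by (simp_all add: complex_eq_iff Re_exp Im_exp)
  define t where "t = pi * (1 - s)"
  have q: "hankel s (Complex x pi) = of_real (exp (- exp x + (1 - s) * x)) * exp (\<i> * of_real t)"
    unfolding t_def hankel_def e
    by (simp add: exp_of_real[symmetric] Complex_eq exp_add[symmetric] algebra_simps)
  have p: "hankel s (Complex x (- pi)) = of_real (exp (- exp x + (1 - s) * x)) * exp (- (\<i> * of_real t))"
    unfolding t_def hankel_def e
    by (simp add: exp_of_real[symmetric] Complex_eq exp_add[symmetric] algebra_simps)
  have "hankel s (Complex x pi) - hankel s (Complex x (- pi)) =
      of_real (exp (- exp x + (1 - s) * x)) * (exp (\<i> * of_real t) - exp (- (\<i> * of_real t)))"
    unfolding p q by (rule right_diff_distrib[symmetric])
  also have "exp (\<i> * of_real t) - exp (- (\<i> * of_real t)) = 2 * \<i> * of_real (sin t)"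
    by (simp add: sin_exp_eq flip: sin_of_real)
  finally show ?thesis
    unfolding t_def by (simp only: mult_ac)
qed

text \<open>For these \<open>s\<close> the left end of the strip contributes nothing in the limit,
  so the loop collapses onto the cut. The jump across the cut integrates to
  \<open>2 * \<i> * sin (pi * (1 - s)) * Gamma (1 - s)\<close>, which is the claimed limit by the
  reflection formula.\<close>

lemma vint_hankel_pi_01:
  assumes "0 < s" "s < 1"
  shows "(\<lambda>k::nat. vint (hankel s) (- pi) pi (real k)) \<longlonglongrightarrow> 2 * pi * \<i> * complex_of_real (rGamma s)"
proof -
  let ?g = "\<lambda>x. hankel s (Complex x pi) - hankel s (Complex x (- pi))"
  let ?c = "2 * \<i> * sin (pi * (1 - s)) :: complex"
  have I: "((\<lambda>x. exp (- exp x + (1 - s) * x)) has_integral Gamma (1 - s)) UNIV"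
    using Gamma_integral_exp[of 1 "1 - s"] assms by simp
  have "(\<lambda>k::nat. integral UNIV (\<lambda>x. if x \<in> {- real k..real k} then ?g x else 0)) \<longlonglongrightarrow> integral UNIV ?g"
  proof (rule dominated_convergence(2))
    fix k :: nat
    show "(\<lambda>x. if x \<in> {- real k..real k} then ?g x else 0) integrable_on UNIV"
      unfolding integrable_restrict_UNIV
      by (intro integrable_continuous_real continuous_intros continuous_on_Complex_left)
  next
    show "(\<lambda>x. 2 * exp (- exp x + (1 - s) * x)) integrable_on UNIV"
      using I by (intro integrable_on_mult_right) (auto simp: integrable_on_def)
  next
    fix k :: nat and x
    have "norm (?g x) \<le> 2 * 1 * exp (- exp x + (1 - s) * x)"
      unfolding hankel_pi norm_mult
      by (intro mult_mono) (auto simp: norm_mult)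
    then show "norm (if x \<in> {- real k..real k} then ?g x else 0) \<le> 2 * exp (- exp x + (1 - s) * x)"
      by auto
  next
    fix x
    have "\<forall>\<^sub>F k::nat in sequentially. ?g x = (if x \<in> {- real k..real k} then ?g x else 0)"
      using eventually_ge_at_top[of "nat \<lceil>\<bar>x\<bar>\<rceil>"]
      by eventually_elim (auto simp: nat_le_iff ceiling_le_iff abs_le_iff)
    then show "(\<lambda>k::nat. if x \<in> {- real k..real k} then ?g x else 0) \<longlonglongrightarrow> ?g x"
      by (rule Lim_transform_eventually[OF tendsto_const])
  qed
  then have "(\<lambda>k::nat. integral {- real k..real k} ?g) \<longlonglongrightarrow> integral UNIV ?g"
    unfolding integral_restrict_UNIV .
  moreover have "(\<lambda>k::nat. vint (hankel s) (- pi) pi (- real k)) \<longlonglongrightarrow> 0"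
    by (rule filterlim_compose[OF vint_hankel_at_bot]) (use assms in \<open>auto intro!: filterlim_uminus_at_bot_at_top filterlim_compose[OF _ filterlim_real_sequentially]\<close>)
  ultimately have "(\<lambda>k::nat. vint (hankel s) (- pi) pi (- real k) + integral {- real k..real k} ?g) \<longlonglongrightarrow> 0 + integral UNIV ?g"
    by (intro tendsto_add)
  also have "(\<lambda>k::nat. vint (hankel s) (- pi) pi (- real k) + integral {- real k..real k} ?g) = (\<lambda>k. vint (hankel s) (- pi) pi (real k))"
    by (rule ext) (subst vint_hankel_diff[symmetric], auto)
  also have "integral UNIV ?g = ?c * of_real (Gamma (1 - s))"
    unfolding hankel_pi
    by (intro integral_unique has_integral_mult_right has_integral_of_real I)
  also have "0 + ?c * of_real (Gamma (1 - s)) = 2 * pi * \<i> * complex_of_real (rGamma s)"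
  proof -
    have "rGamma (complex_of_real s) * rGamma (complex_of_real (1 - s)) = of_real (sin (pi * s) / pi)"
      using rGamma_reflection_complex[of "of_real s"] by (simp add: sin_of_real flip: of_real_mult)
    then have "complex_of_real (rGamma s * rGamma (1 - s)) = of_real (sin (pi * s) / pi)"
      unfolding of_real_mult rGamma_complex_of_real[symmetric] by simp
    then have "rGamma s * rGamma (1 - s) = sin (pi * s) / pi"
      using of_real_eq_iff by blast
    then have "sin (pi * (1 - s)) = pi * (rGamma s * rGamma (1 - s))" by (simp add: right_diff_distrib)
    moreover have "rGamma (1 - s) * Gamma (1 - s) = 1"
      using Gamma_real_pos[of "1 - s"] assms(2) by (simp add: rGamma_inverse_Gamma del: Gamma_real_pos)
    ultimately have "sin (pi * (1 - s)) * Gamma (1 - s) = pi * rGamma s" by simp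
    then have "of_real (sin (pi * (1 - s)) * Gamma (1 - s)) = (of_real (pi * rGamma s) :: complex)" by simp
    then show ?thesis by (simp add: algebra_simps)
  qed
  finally show ?thesis .
qed

text \<open>Cauchy's formula for \<open>exp zeta / zeta\<close>. The jump across the cut contains
  \<open>sin 0\<close>, so the integral does not depend on \<open>x\<close>; far to the left the
  integrand is close to \<open>1\<close>.\<close>

lemma vint_hankel_pi_1: "vint (hankel 1) (- pi) pi x = 2 * pi * \<i>"
proof -
  have e: "norm (vint (hankel 1) (- pi) pi x - 2 * pi * \<i>) \<le> e * (2 * pi)" if "e > 0" for e
  proof -
    have "isCont (exp :: complex \<Rightarrow> complex) 0" by simp
    then obtain d where d: "d > 0" "\<And>w::complex. norm w < d \<Longrightarrow> norm (exp w - 1) < e"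
      using \<open>e > 0\<close> unfolding isCont_def LIM_def by (auto simp: dist_norm) (metis cancel_comm_monoid_add_class.diff_cancel exp_zero norm_zero)
    define A where "A = min x (ln (d / 2))"
    have A: "exp A < d" using d(1) by (metis A_def exp_ln field_sum_of_halves half_gt_zero less_add_same_cancel1 min.cobounded2 exp_le_cancel_iff order_le_less_trans)
    have "vint (hankel 1) (- pi) pi x - vint (hankel 1) (- pi) pi A = 0"
      by (subst vint_hankel_diff) (auto simp: A_def hankel_pi)
    then have "vint (hankel 1) (- pi) pi x - 2 * pi * \<i> = vint (hankel 1) (- pi) pi A - 2 * pi * \<i>" by simp
    also have "\<dots> = vint (\<lambda>y. hankel 1 y - 1) (- pi) pi A"
      by (subst (2) vint_def, subst integral_diff)
         (auto simp: vint_def algebra_simps scaleR_conv_of_real intro!: integrable_continuous_real continuous_intros continuous_on_Complex_right)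
    also have "norm \<dots> \<le> e * (pi - (- pi))"
      by (rule norm_vint_le)
         (auto intro!: less_imp_le[OF d(2)] continuous_intros continuous_on_Complex_right simp: hankel_def A)
    finally show ?thesis by simp
  qed
  have "norm (vint (hankel 1) (- pi) pi x - 2 * pi * \<i>) \<le> 0"
    by (rule field_le_epsilon) (use e[of "e / (2 * pi)" for e] in auto)
  then show ?thesis by simp
qed

text \<open>Integration by parts in Hankel's integral. Up to boundary terms it is the relation
  \<open>1 / Gamma s = s / Gamma (s + 1)\<close>, and it carries the formula from
  \<open>0 < s \<le> 1\<close> to all positive \<open>s\<close>.\<close>

lemma vint_hankel_rec:
  assumes "p < q"
  shows "vint (hankel s) p q x - of_real s * vint (hankel (s + 1)) p q x
    = hankel (s + 1) (Complex x q) - hankel (s + 1) (Complex x p)"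
proof -
  have "((\<lambda>\<theta>. hankel (s+1) (Complex x \<theta>)) has_vector_derivative
     \<i> * (hankel s (Complex x \<theta>) - of_real s * hankel (s + 1) (Complex x \<theta>))) (at \<theta> within {p..q})" for \<theta>
  proof -
    let ?D = "\<lambda>y. (exp y - of_real s) * hankel (s + 1) y"
    have "(hankel (s + 1) has_field_derivative ?D y) (at y)" for y
      unfolding hankel_def[abs_def] by (auto intro!: derivative_eq_intros simp: algebra_simps)
    moreover have "(Complex x has_vector_derivative \<i>) (at \<theta> within {p..q})"
      unfolding Complex_eq by (auto intro!: derivative_eq_intros simp: has_vector_derivative_def scaleR_conv_of_real mult.commute)
    ultimately have "((hankel (s+1) \<circ> Complex x) has_vector_derivative \<i> * ?D (Complex x \<theta>)) (at \<theta> within {p..q})"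
      by (intro field_vector_diff_chain_at[unfolded o_def] field_vector_diff_chain_within) (auto intro: has_field_derivative_at_within)
    moreover have "exp y * hankel (s + 1) y = hankel s y" for y
      by (simp add: hankel_def exp_add[symmetric] algebra_simps)
    ultimately show ?thesis by (simp add: o_def algebra_simps)
  qed
  then have "((\<lambda>\<theta>. \<i> * (hankel s (Complex x \<theta>) - of_real s * hankel (s + 1) (Complex x \<theta>))) has_integral
     (hankel (s + 1) (Complex x q) - hankel (s + 1) (Complex x p))) {p..q}"
    by (intro fundamental_theorem_of_calculus) (use assms in auto)
  moreover have "((\<lambda>\<theta>. hankel r (Complex x \<theta>)) has_integral integral {p..q} (\<lambda>\<theta>. hankel r (Complex x \<theta>))) {p..q}" for r
    by (intro integrable_integral integrable_continuous_real continuous_intros continuous_on_Complex_right)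
  then have "((\<lambda>\<theta>. \<i> * (hankel s (Complex x \<theta>) - of_real s * hankel (s + 1) (Complex x \<theta>))) has_integral
     \<i> * (integral {p..q} (\<lambda>\<theta>. hankel s (Complex x \<theta>)) - of_real s * integral {p..q} (\<lambda>\<theta>. hankel (s + 1) (Complex x \<theta>)))) {p..q}"
    by (intro has_integral_mult_right has_integral_diff)
  ultimately show ?thesis
    by (auto simp: vint_def algebra_simps dest: has_integral_unique)
qed

lemma vint_hankel_pi:
  assumes "0 < s"
  shows "(\<lambda>k::nat. vint (hankel s) (- pi) pi (real k)) \<longlonglongrightarrow> 2 * pi * \<i> * complex_of_real (rGamma s)"
proof -
  \<comment> \<open>Induction on an integer bound of \<open>s\<close>. A step lowers
    \<open>s\<close> by one, and its boundary terms vanish in the limit because \<open>cos\<close>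
    is \<open>- 1\<close> at both ends.\<close>
  have "(\<lambda>k::nat. vint (hankel s) (- pi) pi (real k)) \<longlonglongrightarrow> 2 * pi * \<i> * complex_of_real (rGamma s)" if "0 < s" "s \<le> real (Suc n)" for n s
    using that
  proof (induction n arbitrary: s)
    case 0
    show ?case
    proof (cases "s = 1")
      case True
      then show ?thesis by (simp add: vint_hankel_pi_1)
    qed (use 0 vint_hankel_pi_01 in auto)
  next
    case (Suc n)
    show ?case
    proof (cases "s \<le> 1")
      case True
      then show ?thesis using Suc.IH[of s] Suc.prems by simp
    next
      case False
      define r where "r = s - 1"
      have r: "r > 0" "s = r + 1" using False by (auto simp: r_def)
      have lim: "(\<lambda>k::nat. vint (hankel r) (- pi) pi (real k)) \<longlonglongrightarrow> 2 * pi * \<i> * complex_of_real (rGamma r)"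
        by (rule Suc.IH) (use Suc.prems r in auto)
      have b: "(\<lambda>k::nat. hankel s (Complex (real k) \<theta>)) \<longlonglongrightarrow> 0" if "cos \<theta> = - 1" for \<theta>
      proof (rule tendsto_norm_zero_cancel)
        show "(\<lambda>k. norm (hankel s (Complex (real k) \<theta>))) \<longlonglongrightarrow> 0"
          unfolding norm_hankel that by real_asymp
      qed
      have "(\<lambda>k::nat. (vint (hankel r) (- pi) pi (real k) - (hankel s (Complex (real k) pi) - hankel s (Complex (real k) (- pi)))) / of_real r)
         \<longlonglongrightarrow> (2 * pi * \<i> * complex_of_real (rGamma r) - (0 - 0)) / of_real r"
        by (intro tendsto_intros lim b) (use r in auto)
      also have "(\<lambda>k::nat. (vint (hankel r) (- pi) pi (real k) - (hankel s (Complex (real k) pi) - hankel s (Complex (real k) (- pi)))) / of_real r)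
        = (\<lambda>k. vint (hankel s) (- pi) pi (real k))"
        using vint_hankel_rec[of "-pi" pi r] r by (auto simp: field_simps fun_eq_iff)
      also have "(2 * pi * \<i> * complex_of_real (rGamma r) - (0 - 0)) / of_real r = 2 * pi * \<i> * complex_of_real (rGamma s)"
        using rGamma_plus1[of r] r by (simp add: field_simps flip: of_real_mult)
      finally show ?thesis .
    qed
  qed
  from this[of s "nat \<lceil>s\<rceil>"] assms show ?thesis by (simp add: le_of_int_ceiling) linarith
qed

lemma vint_split:
  assumes "p \<le> q" "q \<le> r" "continuous_on {p..r} (\<lambda>\<theta>. h (Complex x \<theta>))"
  shows "vint h p r x = vint h p q x + vint h q r x"
  unfolding vint_def
  by (subst Henstock_Kurzweil_Integration.integral_combine[OF assms(1,2), symmetric])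
     (use assms in \<open>auto intro!: integrable_continuous_real simp: distrib_left\<close>)

lemma cos_le_upper:
  assumes "pi / 2 < q" "q \<le> \<theta>" "\<theta> \<le> pi"
  shows "cos \<theta> \<le> cos q" "cos q < 0"
proof -
  show "cos \<theta> \<le> cos q" using assms by (intro cos_monotone_0_pi_le) (auto intro: order_trans[OF pi_half_ge_zero])
  have "cos q < cos (pi / 2)" using assms by (intro cos_monotone_0_pi) auto
  then show "cos q < 0" by simp
qed

lemma cos_le_lower:
  assumes "- (3 * pi / 2) < p" "p \<le> \<theta>" "\<theta> \<le> - pi"
  shows "cos \<theta> \<le> cos p" "cos p < 0"
  using cos_le_upper[of "2 * pi + p" "2 * pi + \<theta>"] assms
  by (simp_all add: cos_add)

text \<open>The ends \<open>- pi\<close> and \<open>pi\<close> may be moved as long as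
  \<open>cos\<close> stays negative, because there \<open>hankel\<close> decays doubly exponentially
  to the right. This freedom is used later to keep the two lines away from the poles of the kernel
  of \<open>E\<close>.\<close>

lemma vint_hankel:
  assumes "0 < s" "- (3 * pi / 2) < p" "p \<le> - pi" "pi / 2 < q" "q \<le> pi"
  shows "(\<lambda>k::nat. vint (hankel s) p q (real k)) \<longlonglongrightarrow> 2 * pi * \<i> * complex_of_real (rGamma s)"
proof -
  have 1: "(\<lambda>k::nat. vint (hankel s) p (- pi) (real k)) \<longlonglongrightarrow> 0"
    by (rule filterlim_compose[OF vint_hankel_at_top[where k = "- cos p"] filterlim_real_sequentially])
       (use assms cos_le_lower[of p] in auto)
  have 2: "(\<lambda>k::nat. vint (hankel s) q pi (real k)) \<longlonglongrightarrow> 0"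
    by (rule filterlim_compose[OF vint_hankel_at_top[where k = "- cos q"] filterlim_real_sequentially])
       (use assms cos_le_upper[of q] in auto)
  have "vint (hankel s) p q x = vint (hankel s) p (- pi) x + vint (hankel s) (- pi) pi x - vint (hankel s) q pi x" for x
  proof -
    have "- pi \<le> q" using assms(4) pi_gt_zero by linarith
    then have "vint (hankel s) p q x = vint (hankel s) p (- pi) x + vint (hankel s) (- pi) q x"
      and "vint (hankel s) (- pi) pi x = vint (hankel s) (- pi) q x + vint (hankel s) q pi x"
      using assms by (auto intro!: vint_split continuous_intros continuous_on_Complex_right)
    then show ?thesis by simp
  qed
  moreover have "(\<lambda>k::nat. vint (hankel s) p (- pi) (real k) + vint (hankel s) (- pi) pi (real k) - vint (hankel s) q pi (real k))
     \<longlonglongrightarrow> 0 + 2 * pi * \<i> * complex_of_real (rGamma s) - 0"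
    by (intro tendsto_intros 1 2 vint_hankel_pi assms)
  ultimately show ?thesis by simp
qed

lemma hankel_line_integrable:
  assumes "cos \<theta> < 0"
  shows "(\<lambda>x. hankel s (Complex x \<theta>)) absolutely_integrable_on {M..}"
proof (rule measurable_bounded_by_integrable_imp_absolutely_integrable)
  show "(\<lambda>x. hankel s (Complex x \<theta>)) \<in> borel_measurable (lebesgue_on {M..})"
    by (intro continuous_imp_measurable_on_sets_lebesgue continuous_intros continuous_on_Complex_left) auto
  show "(\<lambda>x. exp (- (- cos \<theta>) * exp x + (1 - s) * x)) integrable_on {M..}"
    by (rule integrable_exp_exp_atLeast) (use assms in auto)
qed (auto simp: norm_hankel mult.commute)

text \<open>Hankel's formula for \<open>1 / \<Gamma>\<close> in the variable \<open>y = ln \<zeta>\<close>: the contour comes in along the line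
  \<open>Im y = p\<close>, runs up the segment \<open>Re y = m\<close> and leaves along \<open>Im y = q\<close>.\<close>

lemma hankel_formula:
  assumes "0 < s" "- (3 * pi / 2) < p" "p \<le> - pi" "pi / 2 < q" "q \<le> pi"
  shows "vint (hankel s) p q (real m) +
     (integral {real m..} (\<lambda>x. hankel s (Complex x q)) - integral {real m..} (\<lambda>x. hankel s (Complex x p)))
    = 2 * pi * \<i> * complex_of_real (rGamma s)"
proof -
  let ?M = "real m"
  let ?g = "\<lambda>x. hankel s (Complex x q) - hankel s (Complex x p)"
  have c: "cos p < 0" "cos q < 0" "p < q"
    using cos_le_upper[of q q] cos_le_lower[of p p] assms pi_gt_zero by auto
  have int: "(\<lambda>x. hankel s (Complex x q)) absolutely_integrable_on {?M..}" "(\<lambda>x. hankel s (Complex x p)) absolutely_integrable_on {?M..}"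
    by (auto intro!: hankel_line_integrable c)
  have g: "?g absolutely_integrable_on {?M..}"
    by (intro set_integral_diff int)
  have "(\<lambda>k::nat. integral {?M..?M + real k} ?g) \<longlonglongrightarrow> integral {?M..} ?g"
    by (rule tendsto_integral_atLeast[where g = "\<lambda>x. norm (?g x)"])
       (use g in \<open>auto simp: absolutely_integrable_on_def\<close>)
  then have "(\<lambda>k::nat. vint (hankel s) p q ?M + integral {?M..?M + real k} ?g) \<longlonglongrightarrow> vint (hankel s) p q ?M + integral {?M..} ?g"
    by (intro tendsto_intros)
  also have "(\<lambda>k::nat. vint (hankel s) p q ?M + integral {?M..?M + real k} ?g) = (\<lambda>k. vint (hankel s) p q (real (k + m)))"
    by (rule ext) (subst vint_hankel_diff[symmetric], use c in \<open>auto simp: add.commute\<close>)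
  finally have "(\<lambda>k. vint (hankel s) p q (real (k + m))) \<longlonglongrightarrow> vint (hankel s) p q ?M + integral {?M..} ?g" .
  moreover have "(\<lambda>k. vint (hankel s) p q (real (k + m))) \<longlonglongrightarrow> 2 * pi * \<i> * complex_of_real (rGamma s)"
    by (rule LIMSEQ_ignore_initial_segment[OF vint_hankel[OF assms]])
  ultimately have "vint (hankel s) p q ?M + integral {?M..} ?g = 2 * pi * \<i> * complex_of_real (rGamma s)"
    by (rule LIMSEQ_unique)
  moreover have "integral {?M..} ?g = integral {?M..} (\<lambda>x. hankel s (Complex x q)) - integral {?M..} (\<lambda>x. hankel s (Complex x p))"
    using int by (intro integral_diff) (auto simp: absolutely_integrable_on_def)
  ultimately show ?thesis by simp
qed

text \<open>In the variable \<open>zeta = exp y\<close> this is \<open>exp zeta * zeta powr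
  (\<alpha> - \<beta>) / (zeta powr \<alpha> - z)\<close> times \<open>d zeta\<close>. For large
  \<open>Re y\<close> it is the sum of the Hankel integrands that belong to the terms of the series
  of \<open>E\<close>.\<close>

definition ml_kernel :: "real \<Rightarrow> real \<Rightarrow> complex \<Rightarrow> complex \<Rightarrow> complex" where
  "ml_kernel \<alpha> \<beta> z y = hankel \<beta> y / (1 - z * exp (- (of_real \<alpha> * y)))"

lemma hankel_geometric:
  "z ^ k * hankel (\<alpha> * real k + \<beta>) y = hankel \<beta> y * (z * exp (- (of_real \<alpha> * y))) ^ k"
proof -
  have "hankel (\<alpha> * real k + \<beta>) y = hankel \<beta> y * exp (of_nat k * (- (of_real \<alpha> * y)))"
    by (simp add: hankel_def exp_add[symmetric] algebra_simps)
  then show ?thesis by (simp only: exp_of_nat_mult power_mult_distrib mult_ac)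
qed

text \<open>To the right of \<open>M\<close> the ratio of the geometric series is at most
  \<open>\<rho> < 1\<close> in modulus. This yields the limit together with a majorant independent
  of \<open>K\<close>, the two inputs of dominated convergence.\<close>

lemma ml_kernel_partial_sums:
  assumes z: "norm z < exp (\<alpha> * M)" and y: "Re y \<ge> M" and "\<alpha> > 0"
  defines "\<rho> \<equiv> norm z * exp (- (\<alpha> * M))"
  shows "(\<lambda>K. \<Sum>k<K. z ^ k * hankel (\<alpha> * real k + \<beta>) y) \<longlonglongrightarrow> ml_kernel \<alpha> \<beta> z y" (is ?A)
    and "norm (\<Sum>k<K. z ^ k * hankel (\<alpha> * real k + \<beta>) y) \<le> norm (hankel \<beta> y) * (1 / (1 - \<rho>))" (is ?B)
proof -
  let ?w = "z * exp (- (of_real \<alpha> * y))"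
  have \<rho>: "0 \<le> \<rho>" "\<rho> < 1" using z by (auto simp: \<rho>_def exp_minus divide_simps)
  have w: "norm ?w \<le> \<rho>"
    unfolding \<rho>_def norm_mult using y \<open>\<alpha> > 0\<close> by (intro mult_left_mono) auto
  have "(\<lambda>k. hankel \<beta> y * ?w ^ k) sums (hankel \<beta> y * (1 / (1 - ?w)))"
    by (intro sums_mult geometric_sums) (use w \<rho> in auto)
  then show ?A
    by (simp add: sums_def hankel_geometric ml_kernel_def)
  have "norm (\<Sum>k<K. hankel \<beta> y * ?w ^ k) \<le> (\<Sum>k<K. norm (hankel \<beta> y) * \<rho> ^ k)"
    by (intro sum_norm_le) (auto simp: norm_mult[of "hankel \<beta> y"] norm_power simp del: norm_exp_eq_Re intro!: mult_left_mono power_mono w)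
  also have "\<dots> = norm (hankel \<beta> y) * (\<Sum>k<K. \<rho> ^ k)" by (simp add: sum_distrib_left)
  also have "(\<Sum>k<K. \<rho> ^ k) \<le> (\<Sum>k. \<rho> ^ k)"
    by (intro sum_le_suminf summable_geometric) (use \<rho> in auto)
  also have "(\<Sum>k. \<rho> ^ k) = 1 / (1 - \<rho>)" by (intro suminf_geometric) (use \<rho> in auto)
  finally show ?B by (simp add: hankel_geometric mult_left_mono)
qed

text \<open>Hankel's formula for the coefficients, summed under the integrals. The condition on
  \<open>m\<close> places all poles of the kernel to the left of the vertical segment.\<close>

lemma mittag_leffler_hankel:
  assumes \<alpha>: "\<alpha> > 0" and \<beta>: "\<beta> > 0" and z: "norm z < exp (\<alpha> * real m)"
    and pq: "- (3 * pi / 2) < p" "p \<le> - pi" "pi / 2 < q" "q \<le> pi"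
  shows "vint (ml_kernel \<alpha> \<beta> z) p q (real m) +
     (integral {real m..} (\<lambda>x. ml_kernel \<alpha> \<beta> z (Complex x q)) - integral {real m..} (\<lambda>x. ml_kernel \<alpha> \<beta> z (Complex x p)))
    = 2 * pi * \<i> * mittag_leffler \<alpha> \<beta> z"
proof -
  let ?M = "real m"
  let ?h = "\<lambda>k. hankel (\<alpha> * real k + \<beta>)"
  define \<rho> where "\<rho> = norm z * exp (- (\<alpha> * ?M))"
  have c: "cos p < 0" "cos q < 0" "p < q"
    using cos_le_upper[of q q] cos_le_lower[of p p] pq pi_gt_zero by auto
  note S = ml_kernel_partial_sums[OF z _ \<alpha>, folded \<rho>_def, of _ \<beta>]
  have ih: "(\<lambda>x. hankel s (Complex x \<theta>)) integrable_on {?M..}" "(\<lambda>x. norm (hankel s (Complex x \<theta>))) integrable_on {?M..}"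
    if "\<theta> = p \<or> \<theta> = q" for s \<theta>
    using hankel_line_integrable[of \<theta> ?M s] that c by (auto simp: absolutely_integrable_on_def)
  have line: "(\<lambda>K. integral {?M..} (\<lambda>x. \<Sum>k<K. z ^ k * ?h k (Complex x \<theta>))) \<longlonglongrightarrow> integral {?M..} (\<lambda>x. ml_kernel \<alpha> \<beta> z (Complex x \<theta>))"
    if "\<theta> = p \<or> \<theta> = q" for \<theta>
  proof (rule dominated_convergence(2))
    show "(\<lambda>x. norm (hankel \<beta> (Complex x \<theta>)) * (1 / (1 - \<rho>))) integrable_on {?M..}"
      using ih[OF that] by (intro integrable_on_mult_left) auto
    show "(\<lambda>x. \<Sum>k<K. z ^ k * ?h k (Complex x \<theta>)) integrable_on {?M..}" for K
      by (intro integrable_sum integrable_on_mult_right ih that) auto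
  next
    fix x K assume "x \<in> {?M..}"
    then show "norm (\<Sum>k<K. z ^ k * ?h k (Complex x \<theta>)) \<le> norm (hankel \<beta> (Complex x \<theta>)) * (1 / (1 - \<rho>))"
      by (intro S) simp
  next
    fix x assume "x \<in> {?M..}"
    then show "(\<lambda>K. \<Sum>k<K. z ^ k * ?h k (Complex x \<theta>)) \<longlonglongrightarrow> ml_kernel \<alpha> \<beta> z (Complex x \<theta>)"
      by (intro S) simp
  qed
  have line_eq: "integral {?M..} (\<lambda>x. \<Sum>k<K. z ^ k * ?h k (Complex x \<theta>)) = (\<Sum>k<K. z ^ k * integral {?M..} (\<lambda>x. ?h k (Complex x \<theta>)))"
    if "\<theta> = p \<or> \<theta> = q" for \<theta> K
    by (subst integral_sum) (auto intro!: integrable_on_mult_right ih that)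
  have ch: "continuous_on {p..q} (\<lambda>\<theta>. hankel s (Complex ?M \<theta>))" for s
    by (intro continuous_intros continuous_on_Complex_right)
  have "(\<lambda>K. integral {p..q} (\<lambda>\<theta>. \<Sum>k<K. z ^ k * ?h k (Complex ?M \<theta>))) \<longlonglongrightarrow> integral {p..q} (\<lambda>\<theta>. ml_kernel \<alpha> \<beta> z (Complex ?M \<theta>))"
  proof (rule dominated_convergence(2))
    show "(\<lambda>\<theta>. norm (hankel \<beta> (Complex ?M \<theta>)) * (1 / (1 - \<rho>))) integrable_on {p..q}"
      by (intro integrable_continuous_real continuous_intros continuous_on_Complex_right)
    show "(\<lambda>\<theta>. \<Sum>k<K. z ^ k * ?h k (Complex ?M \<theta>)) integrable_on {p..q}" for K
      by (intro integrable_continuous_real continuous_intros continuous_on_Complex_right)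
  next
    fix \<theta> K
    show "norm (\<Sum>k<K. z ^ k * ?h k (Complex ?M \<theta>)) \<le> norm (hankel \<beta> (Complex ?M \<theta>)) * (1 / (1 - \<rho>))"
      by (intro S) simp
  next
    fix \<theta>
    show "(\<lambda>K. \<Sum>k<K. z ^ k * ?h k (Complex ?M \<theta>)) \<longlonglongrightarrow> ml_kernel \<alpha> \<beta> z (Complex ?M \<theta>)"
      by (intro S) simp
  qed
  then have vert: "(\<lambda>K. \<i> * integral {p..q} (\<lambda>\<theta>. \<Sum>k<K. z ^ k * ?h k (Complex ?M \<theta>))) \<longlonglongrightarrow> vint (ml_kernel \<alpha> \<beta> z) p q ?M"
    unfolding vint_def by (intro tendsto_intros)
  have vert_eq: "\<i> * integral {p..q} (\<lambda>\<theta>. \<Sum>k<K. z ^ k * ?h k (Complex ?M \<theta>)) = (\<Sum>k<K. z ^ k * vint (?h k) p q ?M)" for K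
    unfolding vint_def
    by (subst integral_sum) (auto intro!: integrable_continuous_real continuous_intros ch simp: sum_distrib_left mult.left_commute)
  have pos: "0 < \<alpha> * real k + \<beta>" for k using \<alpha> \<beta> by (simp add: add_nonneg_pos)
  have summand: "z ^ k * vint (?h k) p q ?M + (z ^ k * integral {?M..} (\<lambda>x. ?h k (Complex x q)) - z ^ k * integral {?M..} (\<lambda>x. ?h k (Complex x p)))
     = 2 * pi * \<i> * (z ^ k / Gamma (complex_of_real (\<alpha> * real k + \<beta>)))" for k
  proof -
    have "2 * pi * \<i> * (z ^ k / Gamma (complex_of_real (\<alpha> * real k + \<beta>))) = z ^ k * (2 * pi * \<i> * complex_of_real (rGamma (\<alpha> * real k + \<beta>)))"
      by (simp only: Gamma_complex_of_real rGamma_inverse_Gamma of_real_inverse divide_inverse mult_ac)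
    then show ?thesis by (simp only: hankel_formula[OF pos pq, of k m, symmetric] distrib_left right_diff_distrib)
  qed
  have "(\<lambda>K. \<Sum>k<K. 2 * pi * \<i> * (z ^ k / Gamma (complex_of_real (\<alpha> * real k + \<beta>)))) \<longlonglongrightarrow>
     vint (ml_kernel \<alpha> \<beta> z) p q ?M +
     (integral {?M..} (\<lambda>x. ml_kernel \<alpha> \<beta> z (Complex x q)) - integral {?M..} (\<lambda>x. ml_kernel \<alpha> \<beta> z (Complex x p)))"
    unfolding summand[symmetric] sum.distrib sum_subtractf
    using tendsto_add[OF vert tendsto_diff[OF line[OF disjI2[OF refl]] line[OF disjI1[OF refl]]]]
    by (simp only: vert_eq line_eq simp_thms)
  then have "(\<lambda>k. 2 * pi * \<i> * (z ^ k / Gamma (complex_of_real (\<alpha> * real k + \<beta>)))) sums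
     (vint (ml_kernel \<alpha> \<beta> z) p q ?M +
     (integral {?M..} (\<lambda>x. ml_kernel \<alpha> \<beta> z (Complex x q)) - integral {?M..} (\<lambda>x. ml_kernel \<alpha> \<beta> z (Complex x p))))"
    (is "_ sums ?X")
    by (simp only: sums_def)
  moreover define c :: complex where "c = 2 * pi * \<i>"
  ultimately have "(\<lambda>k. c * (z ^ k / Gamma (complex_of_real (\<alpha> * real k + \<beta>)))) sums ?X" by simp
  from sums_divide[OF this, of c] have "(\<lambda>k. z ^ k / Gamma (complex_of_real (\<alpha> * real k + \<beta>))) sums (?X / c)"
    by (simp add: c_def)
  then have "mittag_leffler \<alpha> \<beta> z = ?X / c"
    unfolding mittag_leffler_def by (rule sums_unique[symmetric])
  moreover have "c \<noteq> 0" by (simp add: c_def)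
  ultimately show ?thesis unfolding c_def[symmetric] by simp
qed

text \<open>The point solves \<open>exp (\<alpha> * y) = z\<close>, and the denominator has
  derivative \<open>\<alpha>\<close> there, so the pole is simple.\<close>

lemma ml_kernel_residue:
  assumes \<alpha>: "0 < \<alpha>" and \<tau>: "\<tau> > 0"
    and holo: "ml_kernel \<alpha> \<beta> (of_real (\<tau> powr \<alpha>) * exp (\<i> * of_real (\<alpha> * \<theta>))) holomorphic_on S - {Complex (ln \<tau>) \<theta>}"
    and S: "open S" "Complex (ln \<tau>) \<theta> \<in> S"
  shows "residue (ml_kernel \<alpha> \<beta> (of_real (\<tau> powr \<alpha>) * exp (\<i> * of_real (\<alpha> * \<theta>)))) (Complex (ln \<tau>) \<theta>)
    = hankel \<beta> (Complex (ln \<tau>) \<theta>) / of_real \<alpha>"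
proof -
  define y0 where "y0 = Complex (ln \<tau>) \<theta>"
  define z where "z = of_real (\<tau> powr \<alpha>) * exp (\<i> * of_real (\<alpha> * \<theta>))"
  have z: "z = exp (of_real \<alpha> * y0)"
    using \<tau> by (simp add: z_def y0_def Complex_eq powr_def exp_of_real[symmetric] exp_add[symmetric] algebra_simps)
  let ?g = "\<lambda>y. 1 - z * exp (- (of_real \<alpha> * y))"
  have g0: "?g y0 = 0" by (simp add: z exp_minus)
  have "(?g has_field_derivative of_real \<alpha> * (z * exp (- (of_real \<alpha> * y0)))) (at y0)"
    by (auto intro!: derivative_eq_intros)
  then have "(?g has_field_derivative of_real \<alpha>) (at y0)"
    by (simp add: z exp_minus)
  then have "((\<lambda>y. (?g y - ?g y0) / (y - y0)) \<longlongrightarrow> of_real \<alpha>) (at y0)"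
    unfolding has_field_derivative_iff .
  then have "((\<lambda>y. hankel \<beta> y / (?g y / (y - y0))) \<longlongrightarrow> hankel \<beta> y0 / of_real \<alpha>) (at y0)"
    using \<alpha> g0
    by (intro tendsto_divide isContD continuous_on_interior[of UNIV] continuous_on_hankel continuous_on_id) auto
  then have "((\<lambda>y. ml_kernel \<alpha> \<beta> z y * (y - y0)) \<longlongrightarrow> hankel \<beta> y0 / of_real \<alpha>) (at y0)"
    by (simp add: ml_kernel_def)
  then show ?thesis
    unfolding y0_def[symmetric] z_def[symmetric]
    using assms(3-) by (intro residue_simple'[of S]) (simp_all add: y0_def z_def)
qed

text \<open>To the left the denominator grows like \<open>norm z * exp (- (\<alpha> * x))\<close>.
  This adds \<open>\<alpha>\<close> to the exponent of the numerator and relaxes the condition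
  \<open>s < 1\<close> of \<open>vint_hankel_at_bot\<close> to
  \<open>\<beta> < \<alpha> + 1\<close>.\<close>

lemma ml_kernel_at_bot:
  assumes "p \<le> q" "0 < \<alpha>" "\<beta> < \<alpha> + 1" "z \<noteq> 0"
  shows "(vint (ml_kernel \<alpha> \<beta> z) p q \<longlongrightarrow> 0) at_bot"
proof (rule tendsto_0_le[where K = 1])
  define c where "c = 1 - \<beta> + \<alpha>"
  have c: "c > 0" using assms by (simp add: c_def)
  then have "filterlim (\<lambda>x. exp x + c * x) at_bot at_bot"
    by real_asymp
  then show "((\<lambda>x. exp (exp x + c * x) * (2 / norm z * (q - p))) \<longlongrightarrow> 0) at_bot"
    by (intro tendsto_mult_left_zero filterlim_compose[OF exp_at_bot])
  have "((\<lambda>x. exp (\<alpha> * x)) \<longlongrightarrow> 0) at_bot"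
    using assms by real_asymp
  \<comment> \<open>From here on the growing term of the denominator has modulus above
    \<open>2\<close>, so dropping the \<open>1\<close> costs at most half of it.\<close>
  then have "\<forall>\<^sub>F x in at_bot. exp (\<alpha> * x) < norm z / 2"
    using assms by (intro order_tendstoD) auto
  then show "\<forall>\<^sub>F x in at_bot. norm (vint (ml_kernel \<alpha> \<beta> z) p q x) \<le> norm (exp (exp x + c * x) * (2 / norm z * (q - p))) * 1"
  proof eventually_elim
    case (elim x)
    have den: "norm z * exp (- (\<alpha> * x)) / 2 \<le> norm (1 - z * exp (- (of_real \<alpha> * Complex x \<theta>)))" for \<theta>
    proof -
      have "2 \<le> norm z * exp (- (\<alpha> * x))" using elim by (simp add: exp_minus field_simps)
      moreover have "norm (z * exp (- (of_real \<alpha> * Complex x \<theta>))) = norm z * exp (- (\<alpha> * x))"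
        by (simp add: norm_mult)
      moreover have "norm (z * exp (- (of_real \<alpha> * Complex x \<theta>))) - norm (1::complex) \<le> norm (1 - z * exp (- (of_real \<alpha> * Complex x \<theta>)))"
        by (metis norm_minus_commute norm_triangle_ineq2)
      ultimately show ?thesis by simp
    qed
    have pos: "0 < norm z * exp (- (\<alpha> * x)) / 2" using assms by simp
    have "norm (vint (ml_kernel \<alpha> \<beta> z) p q x) \<le> exp (exp x + c * x) * (2 / norm z) * (q - p)"
    proof (rule norm_vint_le[OF assms(1)])
      fix \<theta>
      have "norm (ml_kernel \<alpha> \<beta> z (Complex x \<theta>)) \<le> exp (exp x + (1 - \<beta>) * x) / (norm z * exp (- (\<alpha> * x)) / 2)"
        unfolding ml_kernel_def norm_divide
        by (intro frac_le den pos) (auto simp: norm_hankel)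
      also have "\<dots> = exp (exp x + c * x) * (2 / norm z)"
        by (simp add: c_def exp_add exp_diff exp_minus field_simps)
      finally show "norm (ml_kernel \<alpha> \<beta> z (Complex x \<theta>)) \<le> exp (exp x + c * x) * (2 / norm z)" .
    next
      show "continuous_on {p..q} (\<lambda>\<theta>. ml_kernel \<alpha> \<beta> z (Complex x \<theta>))"
        unfolding ml_kernel_def using den pos
        by (intro continuous_intros continuous_on_Complex_right ballI) (metis norm_zero not_less)
    qed
    then show ?case using assms(1) by (simp add: abs_mult mult.assoc)
  qed
qed

text \<open>By \<open>den\<close> the denominator is comparable to its growing part on the whole
  line. The integrand is then at most \<open>1 / (\<delta> * norm z)\<close> times the integrand of
  \<open>Gamma_integral_exp\<close>, and the integral of that over the whole line bounds the finite
  and the infinite piece alike.\<close>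

lemma ml_kernel_line_le:
  assumes \<alpha>: "0 < \<alpha>" and \<beta>: "\<beta> < \<alpha> + 1" and "cos \<theta> < 0" "\<delta> > 0" "z \<noteq> 0"
    and den: "\<And>x. norm (1 - z * exp (- (of_real \<alpha> * Complex x \<theta>))) \<ge> \<delta> * (norm z * exp (- (\<alpha> * x)))"
  defines "I \<equiv> Gamma (\<alpha> + 1 - \<beta>) / (- cos \<theta>) powr (\<alpha> + 1 - \<beta>) / (\<delta> * norm z)"
  shows "A < B \<Longrightarrow> norm (integral {A..B} (\<lambda>x. ml_kernel \<alpha> \<beta> z (Complex x \<theta>))) \<le> I"
    and "norm (integral {A..} (\<lambda>x. ml_kernel \<alpha> \<beta> z (Complex x \<theta>))) \<le> I"
    and "continuous_on S (\<lambda>x. ml_kernel \<alpha> \<beta> z (Complex x \<theta>))"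
proof -
  let ?h = "\<lambda>x. ml_kernel \<alpha> \<beta> z (Complex x \<theta>)"
  let ?g = "\<lambda>x. 1 / (\<delta> * norm z) * exp (- (- cos \<theta>) * exp x + (\<alpha> + 1 - \<beta>) * x)"
  have pos: "0 < \<delta> * (norm z * exp (- (\<alpha> * x)))" for x using assms by simp
  have le: "norm (?h x) \<le> ?g x" for x
  proof -
    have "norm (?h x) \<le> exp (exp x * cos \<theta> + (1 - \<beta>) * x) / (\<delta> * (norm z * exp (- (\<alpha> * x))))"
      unfolding ml_kernel_def norm_divide
      by (intro frac_le den pos) (auto simp: norm_hankel)
    also have "\<dots> = ?g x"
      by (simp add: exp_add exp_diff exp_minus field_simps)
    finally show ?thesis .
  qed
  show cont: "continuous_on S ?h" for S
    unfolding ml_kernel_def using den pos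
    by (intro continuous_intros continuous_on_Complex_left ballI) (metis norm_zero not_less)
  have G: "(?g has_integral I) UNIV"
    using has_integral_mult_right[OF Gamma_integral_exp[of "- cos \<theta>" "\<alpha> + 1 - \<beta>"], of "1 / (\<delta> * norm z)"] assms
    by (simp add: mult_ac)
  have "?g absolutely_integrable_on UNIV"
    using G assms by (intro nonnegative_absolutely_integrable_1) auto
  then have gS: "?g absolutely_integrable_on S" if "S \<in> sets lebesgue" for S
    by (rule set_integrable_subset) (use that in auto)
  have gI: "integral S ?g \<le> I" "?g integrable_on S" if "S \<in> sets lebesgue" for S
  proof -
    show i: "?g integrable_on S" using gS[OF that] by (simp add: absolutely_integrable_on_def)
    have "integral S ?g \<le> integral UNIV ?g"
      using G i assms by (intro integral_subset_le) auto
    also have "integral UNIV ?g = I" by (rule integral_unique[OF G])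
    finally show "integral S ?g \<le> I" .
  qed
  have hS: "?h integrable_on S" if "S \<in> sets lebesgue" for S
    by (rule measurable_bounded_by_integrable_imp_integrable[OF _ gI(2)[OF that]])
       (use that le cont in \<open>auto intro!: continuous_imp_measurable_on_sets_lebesgue\<close>)
  have *: "norm (integral S ?h) \<le> I" if "S \<in> sets lebesgue" for S
    using integral_norm_bound_integral[OF hS[OF that] gI(2)[OF that] le] gI(1)[OF that] by linarith
  show "A < B \<Longrightarrow> norm (integral {A..B} ?h) \<le> I" "norm (integral {A..} ?h) \<le> I"
    by (auto intro!: *)
qed

text \<open>The vertical segment of \<open>mittag_leffler_hankel\<close> is pushed to the left, past
  one pole, until its contribution vanishes. Since \<open>cos \<theta> = 0\<close>, the residue has
  modulus exactly \<open>\<tau> powr (1 - \<beta>) / \<alpha>\<close>. The lines contribute a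
  multiple of \<open>\<tau> powr (- \<alpha>)\<close>, and for \<open>\<tau> \<ge> 1\<close> this
  power is not larger because \<open>\<beta> < \<alpha> + 1\<close>.\<close>

lemma mittag_leffler_ray_bound:
  assumes \<alpha>: "1 < \<alpha>" "\<alpha> < 2" and \<beta>: "0 < \<beta>" "\<beta> < \<alpha> + 1"
  shows "\<exists>C\<ge>0. \<forall>\<tau>\<ge>1. norm (mittag_leffler \<alpha> \<beta> (ipow (- \<alpha>) * of_real (\<tau> powr \<alpha>))) \<le> C * \<tau> powr (1 - \<beta>)"
proof -
  define \<theta> where "\<theta> = - pi / 2"
  \<comment> \<open>On these two lines \<open>z exp (- \<alpha> y)\<close> is \<open>- r\<close> and \<open>- r \<i>\<^sup>-\<^sup>\<alpha>\<close> with \<open>r > 0\<close>, hence stays away from \<open>1\<close>,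
    and of all poles only \<open>ln \<tau> + \<i> \<theta>\<close> lies between them.\<close>
  define p q where "p = - pi / 2 - pi / \<alpha>" and "q = pi / \<alpha>"
  define \<delta> where "\<delta> = sin (pi * \<alpha> / 2)"
  define I where "I \<phi> = Gamma (\<alpha> + 1 - \<beta>) / (- cos \<phi>) powr (\<alpha> + 1 - \<beta>)" for \<phi>
  \<comment> \<open>\<open>p\<close> is \<open>\<theta> - pi / \<alpha>\<close>, midway between two
    poles. The mirror image \<open>\<theta> + pi / \<alpha>\<close> lies below
    \<open>pi / 2\<close>, where \<open>hankel\<close> grows to the right, so \<open>q\<close> is
    placed higher by \<open>pi / 2\<close>. It is still below the next pole at height
    \<open>\<theta> + 2 * pi / \<alpha>\<close> because \<open>\<alpha> < 2\<close>.\<close>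
  have "pi / 2 < pi / \<alpha>" "pi / \<alpha> < pi" using \<alpha> by (auto simp: field_simps)
  then have pq: "- (3 * pi / 2) < p" "p \<le> - pi" "pi / 2 < q" "q \<le> pi" "p < q"
    unfolding p_def q_def using pi_gt_zero by linarith+
  have cos: "cos p < 0" "cos q < 0"
    using cos_le_upper[of q q] cos_le_lower[of p p] pq by auto
  have \<delta>: "\<delta> > 0"
    unfolding \<delta>_def using \<alpha> by (intro sin_gt_zero) auto
  have G: "Gamma (\<alpha> + 1 - \<beta>) > 0" using \<beta> by (intro Gamma_real_pos) auto
  have I0: "I p \<ge> 0" "I q \<ge> 0" using G by (auto simp: I_def)
  have bound: "norm (mittag_leffler \<alpha> \<beta> (ipow (- \<alpha>) * of_real (\<tau> powr \<alpha>)))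
     \<le> \<tau> powr (1 - \<beta>) / \<alpha> + (I q / \<delta> + I p) / pi * \<tau> powr (- \<alpha>)" if "\<tau> > 0" for \<tau>
  proof -
    define z where "z = of_real (\<tau> powr \<alpha>) * exp (\<i> * of_real (\<alpha> * \<theta>))"
    define y0 where "y0 = Complex (ln \<tau>) \<theta>"
    \<comment> \<open>All poles have the same real part and are spaced by
      \<open>2 * pi / \<alpha>\<close>, so \<open>y0\<close> is the only one in this open
      strip.\<close>
    define S where "S = {y. \<theta> - 2 * pi / \<alpha> < Im y} \<inter> {y. Im y < \<theta> + 2 * pi / \<alpha>}"
    let ?h = "ml_kernel \<alpha> \<beta> z"
    have z_eq: "ipow (- \<alpha>) * of_real (\<tau> powr \<alpha>) = z"
      by (simp add: ipow_def z_def \<theta>_def mult.commute)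
    have nz: "norm z = \<tau> powr \<alpha>" by (simp add: z_def norm_mult)
    have z0: "z \<noteq> 0" using nz that by auto
    have z_exp: "z = exp (of_real \<alpha> * y0)"
      using that by (simp add: z_def y0_def Complex_eq powr_def exp_of_real[symmetric] exp_add[symmetric] algebra_simps)
    have z_mult: "z * exp (- (of_real \<alpha> * Complex x \<phi>)) = of_real (\<tau> powr \<alpha> * exp (- (\<alpha> * x))) * exp (\<i> * of_real (\<alpha> * (\<theta> - \<phi>)))" for x \<phi>
      by (simp add: z_def Complex_eq exp_of_real[symmetric] exp_add[symmetric] algebra_simps)
    obtain m :: nat where "ln \<tau> < real m" using reals_Archimedean2 by blast
    then have m: "norm z < exp (\<alpha> * real m)" "ln \<tau> < real m"
      using \<alpha> that by (auto simp: nz powr_def)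
    have S: "open S" "connected S" "cbox (Complex A p) (Complex B q) \<subseteq> S" "y0 \<in> S" for A B
    proof -
      show "open S" unfolding S_def by (intro open_Int open_halfspace_Im_gt open_halfspace_Im_lt)
      show "connected S" unfolding S_def
        by (intro convex_connected convex_Int convex_halfspace_Im_gt convex_halfspace_Im_lt)
      have "\<theta> - 2 * pi / \<alpha> < p" "q < \<theta> + 2 * pi / \<alpha>"
        using \<open>pi / 2 < pi / \<alpha>\<close> \<alpha> pi_gt_zero by (auto simp: \<theta>_def p_def q_def field_simps)
      then show "cbox (Complex A p) (Complex B q) \<subseteq> S" by (auto simp: S_def in_cbox_complex_iff)
      show "y0 \<in> S" using \<alpha> by (auto simp: y0_def S_def)
    qed
    have holo: "?h holomorphic_on S - {y0}"
    proof -
      have "1 - z * exp (- (of_real \<alpha> * y)) \<noteq> 0" if y: "y \<in> S - {y0}" for y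
      proof
        assume "1 - z * exp (- (of_real \<alpha> * y)) = 0"
        then have "exp (of_real \<alpha> * y) = exp (of_real \<alpha> * y0)"
          by (simp add: z_exp exp_minus field_simps)
        then obtain n :: int where n: "of_real \<alpha> * y = of_real \<alpha> * y0 + of_int (2 * n) * of_real pi * \<i>"
          unfolding exp_eq by auto
        then have im: "\<alpha> * (Im y - \<theta>) = 2 * of_int n * pi" and re: "Re y = Re y0"
          using \<alpha> by (auto simp: complex_eq_iff y0_def algebra_simps)
        have "\<alpha> * \<bar>Im y - \<theta>\<bar> < 2 * pi"
          using y \<alpha> by (auto simp: S_def abs_if field_simps)
        then have "\<bar>2 * of_int n * pi\<bar> < 2 * pi" unfolding im[symmetric] using \<alpha> by (simp add: abs_mult)
        then have "\<bar>of_int n :: real\<bar> < 1" by (simp add: abs_mult)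
        then have "n = 0" by linarith
        then have "y = y0" using im re \<alpha> by (simp add: complex_eq_iff y0_def)
        then show False using y by simp
      qed
      then show ?thesis
        unfolding ml_kernel_def[abs_def] by (intro holomorphic_intros holomorphic_hankel) auto
    qed
    have res: "residue ?h y0 = hankel \<beta> y0 / of_real \<alpha>"
      unfolding y0_def z_def by (rule ml_kernel_residue[of _ _ _ _ S]) (use \<alpha> that holo S in \<open>auto simp: y0_def z_def\<close>)
    have norm_res: "norm (residue ?h y0) = \<tau> powr (1 - \<beta>) / \<alpha>"
      unfolding res norm_divide unfolding y0_def norm_hankel using \<alpha> that by (simp add: \<theta>_def powr_def)
    have den_q: "norm (1 - z * exp (- (of_real \<alpha> * Complex x q))) \<ge> \<delta> * (norm z * exp (- (\<alpha> * x)))" for x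
    proof -
      have "\<alpha> * (\<theta> - q) = - (pi * \<alpha> / 2) - pi" using \<alpha> by (simp add: \<theta>_def q_def field_simps)
      then have "\<bar>Im (1 - z * exp (- (of_real \<alpha> * Complex x q)))\<bar> = \<delta> * (norm z * exp (- (\<alpha> * x)))"
        unfolding z_mult nz using \<delta> by (simp add: \<delta>_def Im_exp sin_diff abs_mult)
      then show ?thesis using abs_Im_le_cmod by metis
    qed
    have den_p: "norm (1 - z * exp (- (of_real \<alpha> * Complex x p))) \<ge> 1 * (norm z * exp (- (\<alpha> * x)))" for x
    proof -
      have "\<alpha> * (\<theta> - p) = pi" using \<alpha> by (simp add: \<theta>_def p_def field_simps)
      then have "Re (1 - z * exp (- (of_real \<alpha> * Complex x p))) = 1 + (norm z * exp (- (\<alpha> * x)))"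
        unfolding z_mult nz by (simp add: Re_exp)
      then show ?thesis using complex_Re_le_cmod[of "1 - z * exp (- (of_real \<alpha> * Complex x p))"] by linarith
    qed
    define Iq Ip where "Iq = I q / (\<delta> * norm z)" and "Ip = I p / (1 * norm z)"
    have \<alpha>0: "0 < \<alpha>" using \<alpha> by simp
    note line_q = ml_kernel_line_le[OF \<alpha>0 \<beta>(2) cos(2) \<delta> z0 den_q, folded I_def Iq_def]
    note line_p = ml_kernel_line_le[OF \<alpha>0 \<beta>(2) cos(1) zero_less_one z0 den_p, folded I_def Ip_def]
    \<comment> \<open>Each line occurs in two pieces, from \<open>A\<close> to \<open>m\<close>
      because of the push and from \<open>m\<close> to infinity in the Hankel formula. Both are
      bounded by the same constant, hence the factors \<open>2\<close>.\<close>
    have le: "2 * pi * norm (mittag_leffler \<alpha> \<beta> z) \<le> norm (vint ?h p q A) + (2 * Iq + 2 * Ip + 2 * pi * (\<tau> powr (1 - \<beta>) / \<alpha>))"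
      if A: "A < ln \<tau>" for A
    proof -
      have Am: "A < real m" using A m by simp
      have "vint ?h p q (real m) - vint ?h p q A =
          integral {A..real m} (\<lambda>x. ?h (Complex x q) - ?h (Complex x p)) + 2 * pi * \<i> * (\<Sum>y\<in>{y0}. residue ?h y)"
      proof (rule rectangle_residues[OF Am pq(5) _ _ S(1,2,3) holo])
        show "{y0} \<subseteq> box (Complex A p) (Complex (real m) q)"
          using A m pq pi_gt_zero by (auto simp: y0_def in_box_complex_iff \<theta>_def)
      qed auto
      also have "integral {A..real m} (\<lambda>x. ?h (Complex x q) - ?h (Complex x p))
        = integral {A..real m} (\<lambda>x. ?h (Complex x q)) - integral {A..real m} (\<lambda>x. ?h (Complex x p))"
        by (intro integral_diff integrable_continuous_real line_q line_p)
      finally have vm: "vint ?h p q (real m) = vint ?h p q A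
         + (integral {A..real m} (\<lambda>x. ?h (Complex x q)) - integral {A..real m} (\<lambda>x. ?h (Complex x p))
         + 2 * pi * \<i> * residue ?h y0)"
        by (simp add: diff_eq_eq add.commute)
      have "2 * pi * \<i> * mittag_leffler \<alpha> \<beta> z = vint ?h p q A
         + (integral {A..real m} (\<lambda>x. ?h (Complex x q)) - integral {A..real m} (\<lambda>x. ?h (Complex x p))
         + (integral {real m..} (\<lambda>x. ?h (Complex x q)) - integral {real m..} (\<lambda>x. ?h (Complex x p)))
         + 2 * pi * \<i> * residue ?h y0)"
        unfolding mittag_leffler_hankel[OF \<alpha>0 \<beta>(1) m(1) pq(1-4), symmetric] vm by (simp only: add_ac)
      then have "norm (2 * pi * \<i> * mittag_leffler \<alpha> \<beta> z) \<le> norm (vint ?h p q A)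
         + (Iq + Ip + (Iq + Ip) + norm (2 * pi * \<i> * residue ?h y0))"
        by (simp only:) (intro norm_triangle_mono order_trans[OF norm_triangle_ineq4 add_mono] order_refl line_q(2) line_p(2) line_q(1)[OF Am] line_p(1)[OF Am])
      then show ?thesis by (simp add: norm_mult norm_res)
    qed
    have "2 * pi * norm (mittag_leffler \<alpha> \<beta> z) \<le> 0 + (2 * Iq + 2 * Ip + 2 * pi * (\<tau> powr (1 - \<beta>) / \<alpha>))"
    proof (rule tendsto_lowerbound)
      show "((\<lambda>A. norm (vint ?h p q A) + (2 * Iq + 2 * Ip + 2 * pi * (\<tau> powr (1 - \<beta>) / \<alpha>))) \<longlongrightarrow> 0 + (2 * Iq + 2 * Ip + 2 * pi * (\<tau> powr (1 - \<beta>) / \<alpha>))) at_bot"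
        by (intro tendsto_add tendsto_const tendsto_norm_zero ml_kernel_at_bot) (use pq \<alpha> \<beta> z0 in auto)
      show "\<forall>\<^sub>F A in at_bot. 2 * pi * norm (mittag_leffler \<alpha> \<beta> z) \<le> norm (vint ?h p q A) + (2 * Iq + 2 * Ip + 2 * pi * (\<tau> powr (1 - \<beta>) / \<alpha>))"
        using eventually_gt_at_bot[of "ln \<tau>"] by eventually_elim (rule le)
    qed simp
    then have "pi * norm (mittag_leffler \<alpha> \<beta> z) \<le> pi * (\<tau> powr (1 - \<beta>) / \<alpha> + (Iq + Ip) / pi)"
    proof -
      assume "2 * pi * norm (mittag_leffler \<alpha> \<beta> z) \<le> 0 + (2 * Iq + 2 * Ip + 2 * pi * (\<tau> powr (1 - \<beta>) / \<alpha>))"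
      then have "2 * (pi * norm (mittag_leffler \<alpha> \<beta> z)) \<le> 2 * (pi * (\<tau> powr (1 - \<beta>) / \<alpha>) + (Iq + Ip))"
        by (simp add: mult.assoc)
      moreover have "pi * (\<tau> powr (1 - \<beta>) / \<alpha> + (Iq + Ip) / pi) = pi * (\<tau> powr (1 - \<beta>) / \<alpha>) + (Iq + Ip)"
        by (simp only: distrib_left[of pi "\<tau> powr (1 - \<beta>) / \<alpha>"]) simp
      ultimately show ?thesis by (simp only: mult_le_cancel_left_pos zero_less_numeral)
    qed
    then have "norm (mittag_leffler \<alpha> \<beta> z) \<le> \<tau> powr (1 - \<beta>) / \<alpha> + (Iq + Ip) / pi"
      by (rule mult_left_le_imp_le) simp
    moreover have "(I q / \<delta> + I p) * \<tau> powr (- \<alpha>) = Iq + Ip"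
      by (simp add: Iq_def Ip_def nz powr_minus add_divide_distrib distrib_left distrib_right divide_inverse mult_ac)
    ultimately show ?thesis unfolding z_eq by (simp only: times_divide_eq_left)
  qed
  show ?thesis
  proof (intro exI[of _ "1 / \<alpha> + (I q / \<delta> + I p) / pi"] conjI allI impI)
    show "0 \<le> 1 / \<alpha> + (I q / \<delta> + I p) / pi" using \<alpha> \<delta> I0 by simp
    fix \<tau> :: real assume \<tau>: "1 \<le> \<tau>"
    have "\<tau> powr (- \<alpha>) \<le> \<tau> powr (1 - \<beta>)" using \<tau> \<beta> by (intro powr_mono) auto
    then have "(I q / \<delta> + I p) / pi * \<tau> powr (- \<alpha>) \<le> (I q / \<delta> + I p) / pi * \<tau> powr (1 - \<beta>)"
      using I0 \<delta> by (intro mult_left_mono) auto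
    then show "norm (mittag_leffler \<alpha> \<beta> (ipow (- \<alpha>) * of_real (\<tau> powr \<alpha>))) \<le> (1 / \<alpha> + (I q / \<delta> + I p) / pi) * \<tau> powr (1 - \<beta>)"
      using bound[of \<tau>] \<tau> by (simp add: distrib_right)
  qed
qed

subsection \<open>Fractional integrals and Mittag-Leffler functions\<close>

lemma has_bochner_integral_Beta_interval:
  fixes a b :: real
  assumes "a > 0" "b > 0" "x < t"
  shows "has_bochner_integral (lebesgue_on {x<..<t}) (\<lambda>r. (t - r) powr (a - 1) * (r - x) powr (b - 1))
     (Beta a b * (t - x) powr (a + b - 1))"
proof -
  let ?f = "\<lambda>u. u powr (b - 1) * (1 - u) powr (a - 1) :: real"
  let ?g = "\<lambda>r. (t - r) powr (a - 1) * (r - x) powr (b - 1)"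
  have "set_integrable lborel {0..1} ?f" by (rule integrable_Beta) (use assms in auto)
  then have 1: "?f absolutely_integrable_on {0..1}"
    unfolding set_integrable_def by (subst integrable_completion) (auto dest: borel_measurable_integrable)
  have "(LINT u : {0..1}|lebesgue. ?f u) = Beta b a"
    using set_lebesgue_integral_eq_integral(2)[OF 1] has_integral_Beta_real[of b a] assms
    by (simp add: integral_unique)
  then have "has_bochner_integral lebesgue (\<lambda>u. indicator {0..1} u *\<^sub>R ?f u) (Beta b a)"
    using 1 unfolding set_integrable_def set_lebesgue_integral_def by (simp add: has_bochner_integral_iff)
  \<comment> \<open>The power is one short of \<open>a + b - 1\<close>: the missing factor
    \<open>t - x\<close> is the Jacobian of the affine map of \<open>{0..1}\<close> onto
    \<open>{x..t}\<close>.\<close>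
  then have "has_bochner_integral lebesgue (\<lambda>u. (t - x) powr (a + b - 2) * (indicator {0..1} u *\<^sub>R ?f u)) ((t - x) powr (a + b - 2) * Beta b a)"
    by (rule has_bochner_integral_mult_right)
  also have "(t - x) powr (a + b - 2) * Beta b a = (Beta a b * (t - x) powr (a + b - 1)) /\<^sub>R \<bar>t - x\<bar>"
    using powr_diff[of "t - x" "a + b - 1" 1] assms(3) by (simp add: Beta_commute field_simps)
  also have "(\<lambda>u. (t - x) powr (a + b - 2) * (indicator {0..1} u *\<^sub>R ?f u))
     = (\<lambda>u. indicator {x..t} (x + (t - x) * u) *\<^sub>R ?g (x + (t - x) * u))"
  proof
    fix u
    have "x + (t - x) * u \<in> {x..t} \<longleftrightarrow> u \<in> {0..1}"
    proof -
      have "x + (t - x) * u \<le> t \<longleftrightarrow> (t - x) * u \<le> (t - x) * 1" by (simp add: algebra_simps)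
      then show ?thesis using assms(3) by (simp del: mult_1_right add: zero_le_mult_iff)
    qed
    moreover have "(t - x) powr (a + b - 2) * ?f u = ?g (x + (t - x) * u)" if "u \<in> {0..1}"
    proof -
      have "t - (x + (t - x) * u) = (t - x) * (1 - u)" by (simp add: algebra_simps)
      moreover have "(t - x) powr (a + b - 2) = (t - x) powr (a - 1) * (t - x) powr (b - 1)"
        by (simp add: powr_add[symmetric])
      ultimately show ?thesis using that assms(3) by (simp add: powr_mult)
    qed
    ultimately show "(t - x) powr (a + b - 2) * (indicator {0..1} u *\<^sub>R ?f u) = indicator {x..t} (x + (t - x) * u) *\<^sub>R ?g (x + (t - x) * u)"
      by (auto simp: indicator_def)
  qed
  finally have "has_bochner_integral lebesgue (\<lambda>u. indicator {x..t} (x + (t - x) * u) *\<^sub>R ?g (x + (t - x) * u))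
     ((Beta a b * (t - x) powr (a + b - 1)) /\<^sub>R \<bar>t - x\<bar>)" .
  then have "has_bochner_integral lebesgue (\<lambda>r. indicator {x..t} r *\<^sub>R ?g r) (Beta a b * (t - x) powr (a + b - 1))"
    by (subst has_bochner_integral_lebesgue_real_affine_iff[of "t - x" _ _ x]) (use assms(3) in auto)
  moreover have "AE r in lebesgue. indicator {x..t} r *\<^sub>R ?g r = indicator {x<..<t} r *\<^sub>R ?g r"
  proof (rule AE_I')
    show "{x, t} \<in> null_sets lebesgue" by (intro null_sets_completionI finite_imp_null_set_lborel) auto
  qed (auto simp: indicator_def)
  ultimately have "has_bochner_integral lebesgue (\<lambda>r. indicator {x<..<t} r *\<^sub>R ?g r) (Beta a b * (t - x) powr (a + b - 1))"
    by (subst has_bochner_integral_cong_AE[symmetric]) (auto intro!: measurable_completion)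
  then show ?thesis
    by (simp add: has_bochner_integral_iff integrable_restrict_space integral_restrict_space)
qed

lemma integral_restrict_space_greaterThanLessThan:
  fixes f :: "real \<Rightarrow> complex"
  shows "(LINT r|lebesgue_on {a<..<b}. f r) = (LINT r|lebesgue. indicat_real {a<..<b} r *\<^sub>R f r)"
  by (rule integral_restrict_space) simp

text \<open>The Riemann-Liouville integral without its normalising factor
  \<open>1 / Gamma a\<close>. The semigroup law therefore carries a Beta factor.\<close>

definition frac_int :: "real \<Rightarrow> (real \<Rightarrow> complex) \<Rightarrow> real \<Rightarrow> complex" where
  "frac_int a f t = (LINT r|lebesgue_on {0<..<t}. of_real ((t - r) powr (a - 1)) * f r)"

lemma measurable_lebesgue_on_borel: "(\<lambda>x. x) \<in> borel_measurable (lebesgue_on (S :: real set))"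
  by (intro measurable_restrict_space1 measurable_completion) simp

text \<open>Fubini on the triangle \<open>x < r < t\<close>, where the integral over
  \<open>r\<close> is a Beta integral. The condition \<open>a + b \<ge> 1\<close> keeps the
  resulting kernel \<open>(t - x) powr (a + b - 1)\<close> bounded, so that the law holds at the
  given \<open>t\<close> and not just for almost all times.\<close>

lemma frac_int_frac_int:
  assumes "a > 0" "b > 0" "a + b \<ge> 1" "t > 0" and q: "integrable (lebesgue_on {0<..<t}) q"
  shows "frac_int a (frac_int b q) t = of_real (Beta a b) * frac_int (a + b) q t"
proof -
  define M where "M = lebesgue_on {0<..<t}"
  interpret M: finite_measure M
    unfolding M_def by (rule finite_measure_lebesgue_on) auto
  interpret P: pair_sigma_finite M M ..
  have [measurable]: "(\<lambda>p. fst p) \<in> borel_measurable (M \<Otimes>\<^sub>M M)" "(\<lambda>p. snd p) \<in> borel_measurable (M \<Otimes>\<^sub>M M)"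
    by (auto intro!: measurable_compose[OF measurable_fst] measurable_compose[OF measurable_snd] measurable_lebesgue_on_borel simp: M_def)
  have q[measurable]: "q \<in> borel_measurable M" "integrable M q" using q by (auto simp: M_def)
  have [measurable]: "(\<lambda>p. q (fst p)) \<in> borel_measurable (M \<Otimes>\<^sub>M M)"
    by (rule measurable_compose[OF measurable_fst q(1)])
  have sp: "space M = {0<..<t}" by (simp add: M_def)
  \<comment> \<open>Extended by zero from the triangle to the square, so that Fubini can be applied
    to the product of \<open>M\<close> with itself.\<close>
  define k where "k x r = (if x < r then (t - r) powr (a - 1) * (r - x) powr (b - 1) else 0)" for x r
  define F where "F x r = of_real (k x r) * q x" for x r
  have k0: "k x r \<ge> 0" for x r by (simp add: k_def)
  have k: "has_bochner_integral M (k x) (Beta a b * (t - x) powr (a + b - 1))" if "x \<in> {0<..<t}" for x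
  proof -
    have "{0<..<t} \<inter> {x<..<t} = {x<..<t}" using that by auto
    then have *: "indicat_real {0<..<t} r * k x r = indicat_real {x<..<t} r * ((t - r) powr (a - 1) * (r - x) powr (b - 1))" for r
      using that by (auto simp: k_def indicator_def)
    show ?thesis
      using has_bochner_integral_Beta_interval[of a b x t] assms that
      by (simp add: M_def has_bochner_integral_iff integrable_restrict_space integral_restrict_space * )
  qed
  have F: "integrable M (F x)" "(LINT r|M. F x r) = of_real (Beta a b * (t - x) powr (a + b - 1)) * q x"
    "(LINT r|M. norm (F x r)) = Beta a b * (t - x) powr (a + b - 1) * norm (q x)" if "x \<in> {0<..<t}" for x
    using k[OF that] unfolding F_def by (auto simp: has_bochner_integral_iff norm_mult k0)
  have [measurable]: "case_prod F \<in> borel_measurable (M \<Otimes>\<^sub>M M)"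
    unfolding F_def k_def split_beta by measurable
  have int: "integrable M (\<lambda>x. of_real ((t - x) powr (a + b - 1)) * q x)"
  proof (rule Bochner_Integration.integrable_bound)
    show "integrable M (\<lambda>x. of_real (t powr (a + b - 1)) * q x)" using q by simp
    have [measurable]: "(\<lambda>x. x) \<in> borel_measurable M" by (simp add: M_def measurable_lebesgue_on_borel)
    show "(\<lambda>x. of_real ((t - x) powr (a + b - 1)) * q x) \<in> borel_measurable M" by measurable
    show "AE x in M. norm (of_real ((t - x) powr (a + b - 1)) * q x) \<le> norm (of_real (t powr (a + b - 1)) * q x)"
      by (rule AE_I2) (use assms in \<open>auto simp: norm_mult sp intro!: mult_right_mono powr_mono2\<close>)
  qed
  have Fi: "integrable (M \<Otimes>\<^sub>M M) (case_prod F)"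
  proof (rule P.Fubini_integrable)
    have "integrable M (\<lambda>x. Beta a b * norm (of_real ((t - x) powr (a + b - 1)) * q x))"
      using int by (intro integrable_mult_right integrable_norm) auto
    then show "integrable M (\<lambda>x. LINT r|M. norm (case_prod F (x, r)))"
      by (rule Bochner_Integration.integrable_cong[THEN iffD1, rotated 2]) (auto simp: F sp norm_mult)
    show "AE x in M. integrable M (\<lambda>r. case_prod F (x, r))"
      by (rule AE_I2) (auto simp: F sp)
  qed simp
  have inner: "of_real ((t - r) powr (a - 1)) * frac_int b q r = (LINT x|M. F x r)" if "r \<in> {0<..<t}" for r
  proof -
    have *: "indicat_real {0<..<t} x *\<^sub>R F x r = of_real ((t - r) powr (a - 1)) * (indicat_real {0<..<r} x *\<^sub>R (of_real ((r - x) powr (b - 1)) * q x))" for x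
      using that by (auto simp: F_def k_def indicator_def)
    show ?thesis
      unfolding M_def frac_int_def by (simp only: integral_restrict_space_greaterThanLessThan * integral_mult_right_zero)
  qed
  have "frac_int a (frac_int b q) t = (LINT r|M. LINT x|M. F x r)"
    unfolding frac_int_def[of a] M_def[symmetric]
    by (rule Bochner_Integration.integral_cong) (auto simp: inner sp)
  also have "\<dots> = (LINT x|M. LINT r|M. F x r)"
    by (rule P.Fubini_integral[OF Fi])
  also have "\<dots> = (LINT x|M. of_real (Beta a b) * (of_real ((t - x) powr (a + b - 1)) * q x))"
    by (rule Bochner_Integration.integral_cong) (auto simp: F sp)
  also have "\<dots> = of_real (Beta a b) * frac_int (a + b) q t"
    by (simp add: frac_int_def M_def)
  finally show ?thesis .
qed

text \<open>For \<open>\<alpha> \<ge> 1\<close> the kernel is bounded by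
  \<open>b powr (\<alpha> - 1)\<close>. Feeding a bound of \<open>d\<close> back into the equation
  integrates a power of \<open>t\<close>, and repeating this produces
  \<open>B * (K * t) ^ n / fact n\<close>, which tends to \<open>0\<close>.\<close>

lemma volterra_unique:
  assumes cont: "continuous_on {0..b} d" and "1 \<le> \<alpha>"
    and eq: "\<And>t. t \<in> {0<..<b} \<Longrightarrow> d t = \<kappa> * frac_int \<alpha> d t"
    and t: "t \<in> {0<..<b}"
  shows "d t = 0"
proof -
  have "compact (d ` {0..b})" using cont by (intro compact_continuous_image) auto
  then obtain B where B: "\<And>r. r \<in> {0..b} \<Longrightarrow> norm (d r) \<le> B"
    unfolding bounded_iff by (metis compact_imp_bounded bounded_iff image_eqI)
  define K where "K = norm \<kappa> * b powr (\<alpha> - 1)"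
  have dm: "d \<in> borel_measurable (lebesgue_on {0<..<t})" if "t \<in> {0<..<b}" for t
    by (intro continuous_imp_measurable_on_sets_lebesgue continuous_on_subset[OF cont]) (use that in auto)
  have *: "norm (d t) \<le> B * (K * t) ^ n / fact n" if "t \<in> {0<..<b}" for n t
    using that
  proof (induction n arbitrary: t)
    case 0
    then show ?case using B by auto
  next
    case (Suc n)
    note t = Suc.prems
    let ?M = "lebesgue_on {0<..<t}"
    let ?c = "b powr (\<alpha> - 1) * (B * K ^ n / fact n)"
    \<comment> \<open>The integral of \<open>r ^ n\<close> is read off from the Beta integral with
      \<open>a = 1\<close>, whose first factor is \<open>1\<close> on the open interval.\<close>
    have "has_bochner_integral ?M (\<lambda>r. (t - r) powr (1 - 1) * (r - 0) powr (real (Suc n) - 1)) (Beta 1 (real (Suc n)) * (t - 0) powr (1 + real (Suc n) - 1))"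
      by (rule has_bochner_integral_Beta_interval) (use t in auto)
    also have "?this \<longleftrightarrow> has_bochner_integral ?M (\<lambda>r. r ^ n) (t ^ Suc n / real (Suc n))"
    proof (rule has_bochner_integral_cong)
      have "Beta 1 (real (Suc n)) = 1 / real (Suc n)"
        using Gamma_fact[of n, where 'a = real] Gamma_fact[of "Suc n", where 'a = real] Gamma_fact[of 0, where 'a = real]
        by (simp add: Beta_def fact_reduce)
      moreover have "(t - 0) powr (1 + real (Suc n) - 1) = t ^ Suc n"
        using t by (simp add: powr_realpow del: of_nat_Suc power_Suc)
      ultimately show "Beta 1 (real (Suc n)) * (t - 0) powr (1 + real (Suc n) - 1) = t ^ Suc n / real (Suc n)"
        by simp
    qed (auto simp: powr_realpow)
    finally have pw: "has_bochner_integral ?M (\<lambda>r. r ^ n) (t ^ Suc n / real (Suc n))" .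
    have le: "norm (of_real ((t - r) powr (\<alpha> - 1)) * d r) \<le> ?c * r ^ n" if "r \<in> {0<..<t}" for r
    proof -
      have "(t - r) powr (\<alpha> - 1) \<le> b powr (\<alpha> - 1)"
        using that t \<open>1 \<le> \<alpha>\<close> by (intro powr_mono2) auto
      moreover have "norm (d r) \<le> B * (K * r) ^ n / fact n"
        by (rule Suc.IH) (use that t in auto)
      ultimately have "(t - r) powr (\<alpha> - 1) * norm (d r) \<le> b powr (\<alpha> - 1) * (B * (K * r) ^ n / fact n)"
        by (intro mult_mono) auto
      then show ?thesis by (simp add: norm_mult power_mult_distrib mult_ac)
    qed
    have "norm (frac_int \<alpha> d t) \<le> (LINT r|?M. ?c * r ^ n)"
      unfolding frac_int_def
    proof (rule Bochner_Integration.integral_norm_bound_integral)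
      show g: "integrable ?M (\<lambda>r. ?c * r ^ n)"
        using pw by (simp add: has_bochner_integral_iff)
      have [measurable]: "d \<in> borel_measurable ?M" "(\<lambda>r. r) \<in> borel_measurable ?M"
        by (auto intro: dm t measurable_lebesgue_on_borel)
      show "integrable ?M (\<lambda>r. of_real ((t - r) powr (\<alpha> - 1)) * d r)"
      proof (rule Bochner_Integration.integrable_bound[OF g])
        show "AE r in ?M. norm (of_real ((t - r) powr (\<alpha> - 1)) * d r) \<le> norm (?c * r ^ n)"
        proof (rule AE_I2)
          fix r assume "r \<in> space ?M"
          then show "norm (of_real ((t - r) powr (\<alpha> - 1)) * d r) \<le> norm (?c * r ^ n)"
            using le[of r] abs_ge_self[of "?c * r ^ n"] unfolding real_norm_def by simp
        qed
      qed measurable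
    qed (use le in auto)
    also have "\<dots> = ?c * (t ^ Suc n / real (Suc n))"
      using pw by (simp add: has_bochner_integral_iff)
    finally have "norm (d t) \<le> norm \<kappa> * (?c * (t ^ Suc n / real (Suc n)))"
      unfolding eq[OF t] norm_mult by (intro mult_left_mono) auto
    also have "\<dots> = B * (K * t) ^ Suc n / fact (Suc n)"
      by (simp add: K_def power_mult_distrib field_simps)
    finally show ?case .
  qed
  have "(\<lambda>n. B * ((K * t) ^ n / fact n)) \<longlonglongrightarrow> B * 0"
    using summable_LIMSEQ_zero[OF summable_exp[of "K * t"]]
    by (intro tendsto_mult tendsto_const) (simp add: field_simps)
  then have "norm (d t) \<le> B * 0"
    by (rule tendsto_lowerbound) (use *[OF t] in auto)
  then show ?thesis by simp
qed

section \<open>The power series of \<open>E\<close> and its behaviour in time\<close>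

lemma summable_mittag_leffler_abs:
  assumes "\<alpha> \<ge> 1" "\<beta> > 0" "R \<ge> 0"
  shows "summable (\<lambda>k. R ^ k / Gamma (\<alpha> * real k + \<beta>))"
proof (rule summable_ratio_test)
  let ?x = "\<lambda>k. \<alpha> * real k + \<beta>"
  show "1 / 2 < (1 :: real)" by simp
  \<comment> \<open>The part \<open>2 * R\<close> brings the ratio down to \<open>1 / 2\<close>; the
    additional \<open>2\<close> puts the arguments into the range where \<open>Gamma\<close>
    increases.\<close>
  fix k assume k: "k \<ge> nat \<lceil>2 * R + 2\<rceil>"
  have x: "?x k \<ge> 2 * R + 2"
  proof -
    have "2 * R + 2 \<le> real k" using k by linarith
    also have "\<dots> \<le> \<alpha> * real k" using assms by (simp add: mult_le_cancel_right1)
    finally show ?thesis using assms by simp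
  qed
  then have x2: "?x k \<ge> 2" using assms by simp
  have G: "Gamma (?x k) > 0" using x2 by (intro Gamma_real_pos) auto
  have "Gamma (?x k + 1) \<le> Gamma (?x (Suc k))"
  proof (cases "\<alpha> = 1")
    case False
    then have "Gamma (?x k + 1) < Gamma (?x (Suc k))"
      using x2 assms by (intro Gamma_real_strict_mono) (auto simp: algebra_simps)
    then show ?thesis by simp
  qed (simp add: add_ac)
  moreover have "Gamma (?x k + 1) = ?x k * Gamma (?x k)"
    by (rule Gamma_plus1) (use x2 in \<open>auto elim!: nonpos_Ints_cases\<close>)
  moreover have "2 * R * Gamma (?x k) \<le> ?x k * Gamma (?x k)"
    using x G by (intro mult_right_mono) auto
  ultimately have le: "2 * R * Gamma (?x k) \<le> Gamma (?x (Suc k))" by linarith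
  have G': "Gamma (?x (Suc k)) > 0" using x2 assms by (intro Gamma_real_pos) (auto intro: add_nonneg_pos)
  have "R / Gamma (?x (Suc k)) \<le> 1 / 2 * (1 / Gamma (?x k))"
    using le G G' by (simp add: field_simps)
  then have "R ^ k * (R / Gamma (?x (Suc k))) \<le> R ^ k * (1 / 2 * (1 / Gamma (?x k)))"
    using assms by (intro mult_left_mono) auto
  then show "norm (R ^ Suc k / Gamma (?x (Suc k))) \<le> 1 / 2 * norm (R ^ k / Gamma (?x k))"
    using G G' assms by (simp add: mult_ac)
qed

lemma mittag_leffler_arg_pos:
  "\<lbrakk>\<alpha> \<ge> 1; \<beta> > 0\<rbrakk> \<Longrightarrow> \<alpha> * real k + \<beta> > 0"
  by (intro add_nonneg_pos) auto

lemma norm_mittag_leffler_term: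
  assumes "\<alpha> \<ge> 1" "\<beta> > 0"
  shows "norm (z ^ k / Gamma (complex_of_real (\<alpha> * real k + \<beta>))) = norm z ^ k / Gamma (\<alpha> * real k + \<beta>)"
proof -
  have "Gamma (\<alpha> * real k + \<beta>) > 0" by (intro Gamma_real_pos mittag_leffler_arg_pos assms)
  then show ?thesis
    by (simp only: Gamma_complex_of_real norm_divide norm_power norm_of_real abs_of_pos)
qed

lemma mittag_leffler_sums:
  assumes "\<alpha> \<ge> 1" "\<beta> > 0"
  shows "(\<lambda>k. z ^ k / Gamma (complex_of_real (\<alpha> * real k + \<beta>))) sums mittag_leffler \<alpha> \<beta> z"
  unfolding mittag_leffler_def
  by (intro summable_sums summable_norm_cancel[of "\<lambda>k. z ^ k / Gamma (complex_of_real (\<alpha> * real k + \<beta>))"])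
     (simp only: norm_mittag_leffler_term[OF assms] summable_mittag_leffler_abs[OF assms norm_ge_zero])

lemma norm_mittag_leffler_le:
  assumes "\<alpha> \<ge> 1" "\<beta> > 0" "norm z \<le> R"
  shows "norm (mittag_leffler \<alpha> \<beta> z) \<le> (\<Sum>k. R ^ k / Gamma (\<alpha> * real k + \<beta>))"
  unfolding mittag_leffler_def
proof (rule norm_suminf_le)
  have "0 \<le> R" using assms(3) norm_ge_zero[of z] by linarith
  then show "summable (\<lambda>k. R ^ k / Gamma (\<alpha> * real k + \<beta>))"
    by (intro summable_mittag_leffler_abs assms)
  fix k
  have "Gamma (\<alpha> * real k + \<beta>) > 0" by (intro Gamma_real_pos mittag_leffler_arg_pos assms)
  then show "norm (z ^ k / Gamma (complex_of_real (\<alpha> * real k + \<beta>))) \<le> R ^ k / Gamma (\<alpha> * real k + \<beta>)"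
    unfolding norm_mittag_leffler_term[OF assms(1,2)]
    by (intro divide_right_mono power_mono assms(3)) auto
qed

lemma mittag_leffler_0: "\<beta> > 0 \<Longrightarrow> mittag_leffler \<alpha> \<beta> 0 = 1 / of_real (Gamma \<beta>)"
  unfolding mittag_leffler_def by (subst suminf_finite[of "{0}"]) (auto simp: Gamma_complex_of_real)

lemma mittag_leffler_shift:
  assumes "\<alpha> \<ge> 1" "\<beta> > 0"
  shows "mittag_leffler \<alpha> \<beta> z = 1 / of_real (Gamma \<beta>) + z * mittag_leffler \<alpha> (\<alpha> + \<beta>) z"
proof -
  have "(\<lambda>k. z * (z ^ k / Gamma (complex_of_real (\<alpha> * real k + (\<alpha> + \<beta>))))) sums (z * mittag_leffler \<alpha> (\<alpha> + \<beta>) z)"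
    by (intro sums_mult mittag_leffler_sums) (use assms in auto)
  also have "(\<lambda>k. z * (z ^ k / Gamma (complex_of_real (\<alpha> * real k + (\<alpha> + \<beta>))))) = (\<lambda>k. z ^ Suc k / Gamma (complex_of_real (\<alpha> * real (Suc k) + \<beta>)))"
    by (simp add: algebra_simps)
  finally have "(\<lambda>k. z ^ Suc k / Gamma (complex_of_real (\<alpha> * real (Suc k) + \<beta>))) sums (z * mittag_leffler \<alpha> (\<alpha> + \<beta>) z)" .
  then have "(\<lambda>k. z ^ k / Gamma (complex_of_real (\<alpha> * real k + \<beta>))) sums (z * mittag_leffler \<alpha> (\<alpha> + \<beta>) z + z ^ 0 / Gamma (complex_of_real (\<alpha> * real 0 + \<beta>)))"
    by (subst (asm) sums_Suc_iff) simp
  from sums_unique2[OF mittag_leffler_sums[OF assms] this] show ?thesis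
    by (simp add: Gamma_complex_of_real add.commute)
qed

text \<open>On coefficients this is \<open>(\<alpha> * k + \<beta>) / Gamma (\<alpha> * k + \<beta>
  + 1) = 1 / Gamma (\<alpha> * k + \<beta>)\<close>. The form with \<open>z * D\<close> involves no
  division by \<open>z\<close> and so includes \<open>z = 0\<close>.\<close>

lemma mittag_leffler_derivative:
  assumes "\<alpha> \<ge> 1" "\<beta> > 0"
  obtains D where "(mittag_leffler \<alpha> (\<beta> + 1) has_field_derivative D) (at z)"
    "of_real \<beta> * mittag_leffler \<alpha> (\<beta> + 1) z + of_real \<alpha> * (z * D) = mittag_leffler \<alpha> \<beta> z"
proof -
  define c where "c k = 1 / Gamma (complex_of_real (\<alpha> * real k + (\<beta> + 1)))" for k
  have \<beta>1: "\<beta> + 1 > 0" using assms by simp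
  have s: "(\<lambda>k. c k * y ^ k) sums mittag_leffler \<alpha> (\<beta> + 1) y" for y
    using mittag_leffler_sums[OF assms(1) \<beta>1, of y] by (simp add: c_def)
  have sd: "summable (\<lambda>k. diffs c k * y ^ k)" for y
    using termdiff_converges_all[of c] s sums_summable by blast
  have "((\<lambda>y. \<Sum>k. c k * y ^ k) has_field_derivative (\<Sum>k. diffs c k * z ^ k)) (at z)"
    by (rule termdiffs_strong_converges_everywhere) (use s sums_summable in blast)
  moreover have "(\<lambda>y. \<Sum>k. c k * y ^ k) = mittag_leffler \<alpha> (\<beta> + 1)"
    using s by (auto simp: sums_iff)
  ultimately have der: "(mittag_leffler \<alpha> (\<beta> + 1) has_field_derivative (\<Sum>k. diffs c k * z ^ k)) (at z)" by simp
  have "(\<lambda>k. z * (diffs c k * z ^ k)) sums (z * (\<Sum>k. diffs c k * z ^ k))"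
    by (intro sums_mult summable_sums sd)
  also have "(\<lambda>k. z * (diffs c k * z ^ k)) = (\<lambda>k. of_nat (Suc k) * c (Suc k) * z ^ Suc k)"
    by (simp add: diffs_def fun_eq_iff)
  finally have "(\<lambda>k. of_nat (Suc k) * c (Suc k) * z ^ Suc k) sums (z * (\<Sum>k. diffs c k * z ^ k))" .
  then have "(\<lambda>k. of_nat k * c k * z ^ k) sums (z * (\<Sum>k. diffs c k * z ^ k))"
    by (subst (asm) sums_Suc_iff) simp
  then have "(\<lambda>k. of_real \<beta> * (c k * z ^ k) + of_real \<alpha> * (of_nat k * c k * z ^ k)) sums
     (of_real \<beta> * mittag_leffler \<alpha> (\<beta> + 1) z + of_real \<alpha> * (z * (\<Sum>k. diffs c k * z ^ k)))"
    by (intro sums_add sums_mult s)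
  also have "(\<lambda>k. of_real \<beta> * (c k * z ^ k) + of_real \<alpha> * (of_nat k * c k * z ^ k)) = (\<lambda>k. z ^ k / Gamma (complex_of_real (\<alpha> * real k + \<beta>)))"
  proof
    fix k
    let ?x = "\<alpha> * real k + \<beta>"
    have x: "?x > 0" by (intro mittag_leffler_arg_pos assms)
    have "Gamma (?x + 1) = ?x * Gamma ?x"
      by (rule Gamma_plus1) (use x in \<open>auto elim!: nonpos_Ints_cases\<close>)
    moreover have "Gamma ?x > 0" by (intro Gamma_real_pos x)
    ultimately have "?x * (1 / Gamma (?x + 1)) = 1 / Gamma ?x" using x by simp
    then have "of_real ?x * (1 / of_real (Gamma (?x + 1))) = (1 / of_real (Gamma ?x) :: complex)"
      by (metis of_real_1 of_real_divide of_real_mult)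
    then have "of_real ?x * c k = 1 / Gamma (complex_of_real ?x)"
      by (simp only: c_def Gamma_complex_of_real add.assoc)
    then have "z ^ k / Gamma (complex_of_real ?x) = of_real ?x * c k * z ^ k" by simp
    then show "of_real \<beta> * (c k * z ^ k) + of_real \<alpha> * (of_nat k * c k * z ^ k) = z ^ k / Gamma (complex_of_real ?x)"
      by (simp add: algebra_simps)
  qed
  finally have "of_real \<beta> * mittag_leffler \<alpha> (\<beta> + 1) z + of_real \<alpha> * (z * (\<Sum>k. diffs c k * z ^ k)) = mittag_leffler \<alpha> \<beta> z"
    using sums_unique2 mittag_leffler_sums[OF assms] by blast
  with der show ?thesis by (rule that)
qed

text \<open>With this power of \<open>t\<close> in front, a time derivative lowers
  \<open>\<beta>\<close> by one and a fractional integral of order \<open>p\<close> raises it by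
  \<open>p\<close>. The parameter \<open>c\<close> is the rate of the scalar equation.\<close>

definition ml_fun :: "real \<Rightarrow> real \<Rightarrow> complex \<Rightarrow> real \<Rightarrow> complex" where
  "ml_fun \<alpha> \<beta> c t = of_real (t powr (\<beta> - 1)) * mittag_leffler \<alpha> \<beta> (c * of_real (t powr \<alpha>))"

lemma ml_fun_derivative:
  assumes "\<alpha> \<ge> 1" "\<beta> > 0" "t > 0"
  shows "(ml_fun \<alpha> (\<beta> + 1) c has_vector_derivative ml_fun \<alpha> \<beta> c t) (at t)"
proof -
  let ?z = "\<lambda>t. c * of_real (t powr \<alpha>)"
  obtain D where D: "(mittag_leffler \<alpha> (\<beta> + 1) has_field_derivative D) (at (?z t))"
    "of_real \<beta> * mittag_leffler \<alpha> (\<beta> + 1) (?z t) + of_real \<alpha> * (?z t * D) = mittag_leffler \<alpha> \<beta> (?z t)"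
    by (rule mittag_leffler_derivative[OF assms(1,2)])
  have p: "((\<lambda>t. complex_of_real (t powr r)) has_vector_derivative of_real (r * t powr (r - 1))) (at t)" for r
    by (intro has_vector_derivative_of_real) (use assms in \<open>auto intro!: derivative_eq_intros simp: has_real_derivative_iff_has_vector_derivative[symmetric]\<close>)
  have "(?z has_vector_derivative c * of_real (\<alpha> * t powr (\<alpha> - 1))) (at t)"
    by (intro has_vector_derivative_mult_right p)
  from field_vector_diff_chain_at[OF this D(1)]
  have m: "((\<lambda>t. mittag_leffler \<alpha> (\<beta> + 1) (?z t)) has_vector_derivative c * of_real (\<alpha> * t powr (\<alpha> - 1)) * D) (at t)"
    by (simp add: o_def)
  have "((\<lambda>t. of_real (t powr \<beta>) * mittag_leffler \<alpha> (\<beta> + 1) (?z t)) has_vector_derivative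
      of_real (t powr \<beta>) * (c * of_real (\<alpha> * t powr (\<alpha> - 1)) * D) + of_real (\<beta> * t powr (\<beta> - 1)) * mittag_leffler \<alpha> (\<beta> + 1) (?z t)) (at t)"
    by (intro has_vector_derivative_mult p m)
  also have "of_real (t powr \<beta>) * (c * of_real (\<alpha> * t powr (\<alpha> - 1)) * D) + of_real (\<beta> * t powr (\<beta> - 1)) * mittag_leffler \<alpha> (\<beta> + 1) (?z t)
     = of_real (t powr (\<beta> - 1)) * (of_real \<beta> * mittag_leffler \<alpha> (\<beta> + 1) (?z t) + of_real \<alpha> * (?z t * D))"
  proof -
    have "t powr \<beta> * t powr (\<alpha> - 1) = t powr (\<beta> - 1) * t powr \<alpha>"
      by (simp add: powr_add[symmetric] algebra_simps)
    then have "complex_of_real (t powr \<beta>) * of_real (t powr (\<alpha> - 1)) = of_real (t powr (\<beta> - 1)) * of_real (t powr \<alpha>)"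
      by (metis of_real_mult)
    then show ?thesis by (simp add: algebra_simps)
  qed
  also note D(2)
  finally show ?thesis by (simp add: ml_fun_def[abs_def])
qed

text \<open>Lowering \<open>\<beta> = 1\<close> by one would leave the range of
  \<open>ml_fun_derivative\<close>. Splitting off the constant term of the series first leaves
  \<open>c * ml_fun \<alpha> (\<alpha> + 1) c\<close>, to which that rule applies.\<close>

lemma ml_fun_1_derivative:
  assumes "\<alpha> \<ge> 1" "t > 0"
  shows "(ml_fun \<alpha> 1 c has_vector_derivative c * ml_fun \<alpha> \<alpha> c t) (at t)"
proof -
  have "ml_fun \<alpha> 1 c r = 1 + c * ml_fun \<alpha> (\<alpha> + 1) c r" if "r > 0" for r
    using mittag_leffler_shift[OF assms(1), of 1 "c * of_real (r powr \<alpha>)"] that by (simp add: ml_fun_def mult_ac)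
  moreover have "((\<lambda>r. 1 + c * ml_fun \<alpha> (\<alpha> + 1) c r) has_vector_derivative 0 + c * ml_fun \<alpha> \<alpha> c t) (at t)"
    by (intro has_vector_derivative_add has_vector_derivative_const has_vector_derivative_mult_right ml_fun_derivative) (use assms in auto)
  ultimately show ?thesis
    using assms(2) by (auto intro: has_vector_derivative_transform_within_open[of _ _ _ "{0<..}"])
qed

text \<open>The derivative rule reaches only second parameters above \<open>1\<close>.
  \<open>mittag_leffler_shift\<close> replaces \<open>\<beta>\<close> by
  \<open>\<alpha> + \<beta> > 1\<close> and thereby covers small \<open>\<beta>\<close>.\<close>

lemma continuous_on_mittag_leffler:
  assumes "\<alpha> \<ge> 1" "\<beta> > 0"
  shows "continuous_on S (mittag_leffler \<alpha> \<beta>)"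
proof -
  have "isCont (mittag_leffler \<alpha> \<beta>) z" for z
  proof -
    have "isCont (mittag_leffler \<alpha> (\<alpha> + \<beta>)) z"
    proof (rule mittag_leffler_derivative[of \<alpha> "\<alpha> + \<beta> - 1" z])
      fix D assume "(mittag_leffler \<alpha> (\<alpha> + \<beta> - 1 + 1) has_field_derivative D) (at z)"
      then show ?thesis by (simp add: DERIV_isCont)
    qed (use assms in auto)
    then have "isCont (\<lambda>z. 1 / of_real (Gamma \<beta>) + z * mittag_leffler \<alpha> (\<alpha> + \<beta>) z) z"
      by (intro continuous_intros)
    then show ?thesis using mittag_leffler_shift[OF assms] by presburger
  qed
  then show ?thesis by (simp add: continuous_at_imp_continuous_on)
qed

lemma continuous_on_ml_fun:
  assumes "\<alpha> \<ge> 1" "\<beta> > 0"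
  shows "continuous_on {0<..} (ml_fun \<alpha> \<beta> c)"
  unfolding ml_fun_def[abs_def]
  by (intro continuous_intros continuous_on_compose2[OF continuous_on_mittag_leffler[OF assms, of UNIV]]) auto

text \<open>Each term of the series gives a Beta integral, whose Gamma factors move the second
  parameter to \<open>p + \<beta>\<close>. Sum and integral may be interchanged because the
  integrals of the absolute values are again terms of a convergent series of this kind.\<close>

lemma has_bochner_integral_ml_fun:
  assumes "\<alpha> \<ge> 1" "\<beta> > 0" "p > 0" "t > 0"
  shows "has_bochner_integral (lebesgue_on {0<..<t}) (\<lambda>r. of_real ((t - r) powr (p - 1)) * ml_fun \<alpha> \<beta> c r)
     (of_real (Gamma p) * ml_fun \<alpha> (p + \<beta>) c t)"
proof -
  let ?M = "lebesgue_on {0<..<t}"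
  let ?x = "\<lambda>k. \<alpha> * real k + \<beta>"
  let ?b = "\<lambda>k r. (t - r) powr (p - 1) * r powr (?x k - 1)"
  let ?I = "\<lambda>k. Beta p (?x k) * t powr (p + ?x k - 1)"
  let ?d = "\<lambda>k. c ^ k / Gamma (complex_of_real (?x k))"
  have x: "?x k > 0" for k by (intro mittag_leffler_arg_pos assms)
  have b: "has_bochner_integral ?M (?b k) (?I k)" for k
    using has_bochner_integral_Beta_interval[of p "?x k" 0 t] assms x by simp
  have I0: "?I k \<ge> 0" for k using Gamma_real_pos[of p] Gamma_real_pos[of "?x k"] Gamma_real_pos[of "p + ?x k"] x[of k] assms
    by (auto simp: Beta_def)
  define f where "f k r = ?d k * of_real (?b k r)" for k r
  have f: "has_bochner_integral ?M (f k) (?d k * of_real (?I k))" for k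
    unfolding f_def by (intro has_bochner_integral_mult_right has_bochner_integral_of_real b)
  have dI: "?d k * of_real (?I k) = of_real (Gamma p * t powr (p + \<beta> - 1)) * ((c * of_real (t powr \<alpha>)) ^ k / Gamma (complex_of_real (\<alpha> * real k + (p + \<beta>))))" for k
  proof -
    have "Gamma (?x k) > 0" "t powr (p + ?x k - 1) = t powr (p + \<beta> - 1) * (t powr \<alpha>) ^ k"
      using Gamma_real_pos[OF x] assms by (auto simp: powr_add[symmetric] powr_power algebra_simps)
    then show ?thesis
      unfolding Gamma_complex_of_real Beta_def
      by (simp add: power_mult_distrib field_simps)
  qed
  have fsum: "(\<lambda>k. f k r) sums (of_real ((t - r) powr (p - 1)) * ml_fun \<alpha> \<beta> c r)" and fabs: "summable (\<lambda>k. norm (f k r))" if "r \<in> {0<..<t}" for r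
  proof -
    have eq: "f k r = of_real ((t - r) powr (p - 1) * r powr (\<beta> - 1)) * ((c * of_real (r powr \<alpha>)) ^ k / Gamma (complex_of_real (?x k)))" for k
    proof -
      have "r powr (?x k - 1) = r powr (\<beta> - 1) * (r powr \<alpha>) ^ k"
        using that by (auto simp: powr_add[symmetric] powr_power algebra_simps)
      then show ?thesis by (simp add: f_def power_mult_distrib)
    qed
    show "(\<lambda>k. f k r) sums (of_real ((t - r) powr (p - 1)) * ml_fun \<alpha> \<beta> c r)"
      unfolding eq using sums_mult[OF mittag_leffler_sums[OF assms(1,2)], of "of_real ((t - r) powr (p - 1) * r powr (\<beta> - 1))" "c * of_real (r powr \<alpha>)"]
      by (simp add: ml_fun_def mult_ac)
    show "summable (\<lambda>k. norm (f k r))"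
      unfolding eq norm_mult[of "of_real _"] norm_mittag_leffler_term[OF assms(1,2)]
      by (intro summable_mult summable_mittag_leffler_abs assms) auto
  qed
  have pb: "p + \<beta> > 0" using assms by simp
  have abs: "summable (\<lambda>k. LINT r|?M. norm (f k r))"
  proof -
    have "norm (f k r) = norm (?d k) * ?b k r" for k r
      unfolding f_def norm_mult[of "?d k"] norm_of_real by (intro arg_cong2[of _ _ _ _ "(*)"] refl abs_of_nonneg) simp
    then have "(LINT r|?M. norm (f k r)) = norm (?d k) * ?I k" for k
      using b[of k] by (simp only: has_bochner_integral_iff integral_mult_right_zero)
    also have "norm (?d k) * ?I k = norm (?d k * of_real (?I k))" for k
      unfolding norm_mult using I0[of k] by (simp only: norm_of_real abs_of_nonneg)
    finally show ?thesis
      unfolding dI norm_mult[of "of_real _"] norm_mittag_leffler_term[OF assms(1) pb]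
      by (simp only:) (intro summable_mult summable_mittag_leffler_abs assms pb norm_ge_zero)
  qed
  have fi: "integrable ?M (f k)" for k using f by (simp add: has_bochner_integral_iff)
  have fa: "AE r in ?M. summable (\<lambda>k. norm (f k r))" by (rule AE_I2) (use fabs in auto)
  have "integrable ?M (\<lambda>r. \<Sum>k. f k r)" by (rule integrable_suminf[OF fi fa abs])
  moreover have "(LINT r|?M. (\<Sum>k. f k r)) = (\<Sum>k. ?d k * of_real (?I k))"
    using integral_suminf[OF fi fa abs] f by (simp only: has_bochner_integral_iff)
  moreover have "(\<Sum>k. ?d k * of_real (?I k)) = of_real (Gamma p) * ml_fun \<alpha> (p + \<beta>) c t"
    unfolding dI using sums_unique[OF sums_mult[OF mittag_leffler_sums[OF assms(1) pb]], symmetric]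
    by (simp add: ml_fun_def)
  ultimately have "has_bochner_integral ?M (\<lambda>r. \<Sum>k. f k r) (of_real (Gamma p) * ml_fun \<alpha> (p + \<beta>) c t)"
    by (simp add: has_bochner_integral_iff)
  then show ?thesis
    by (rule has_bochner_integral_cong[THEN iffD1, rotated 3]) (use fsum in \<open>auto simp: sums_iff\<close>)
qed

subsection \<open>Spaces of coefficients\<close>

lemma cinner_add_right: "cinner x (y + z) = cinner x y + cinner x z"
  for x :: "'h::complex_hilbert_space"
  by (metis cinner_add_left cinner_commute complex_cnj_add)

lemma cinner_scaleC_right: "cinner x (c *\<^sub>C y) = cnj c * cinner x y"
  for x :: "'h::complex_hilbert_space"
  by (metis cinner_scaleC_left cinner_commute complex_cnj_mult)

lemma cinner_0_left [simp]: "cinner 0 y = 0" for y :: "'h::complex_hilbert_space"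
  using cinner_add_left[of 0 0 y] by simp

lemma cinner_0_right [simp]: "cinner y 0 = 0" for y :: "'h::complex_hilbert_space"
  using cinner_add_right[of y 0 0] by simp

lemma cinner_minus_left: "cinner (- x) y = - cinner x y" for x :: "'h::complex_hilbert_space"
  using cinner_add_left[of "- x" x y] by (simp add: eq_neg_iff_add_eq_0)

lemma cinner_minus_right: "cinner y (- x) = - cinner y x" for x :: "'h::complex_hilbert_space"
  using cinner_add_right[of y "- x" x] by (simp add: eq_neg_iff_add_eq_0)

lemma cinner_diff_left: "cinner (x - y) z = cinner x z - cinner y z" for x :: "'h::complex_hilbert_space"
  using cinner_add_left[of x "- y" z] by (simp add: cinner_minus_left)

lemma cinner_diff_right: "cinner z (x - y) = cinner z x - cinner z y" for x :: "'h::complex_hilbert_space"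
  using cinner_add_right[of z x "- y"] by (simp add: cinner_minus_right)

lemma cinner_sum_left: "cinner (sum f A) y = (\<Sum>i\<in>A. cinner (f i) y)" for y :: "'h::complex_hilbert_space"
  by (induction A rule: infinite_finite_induct) (auto simp: cinner_add_left)

lemma cinner_sum_right: "cinner y (sum f A) = (\<Sum>i\<in>A. cinner y (f i))" for y :: "'h::complex_hilbert_space"
  by (induction A rule: infinite_finite_induct) (auto simp: cinner_add_right)

lemma cinner_self: "cinner x x = of_real ((norm x)\<^sup>2)" for x :: "'h::complex_hilbert_space"
proof -
  have "Im (cinner x x) = 0"
    using arg_cong[OF cinner_commute[of x x], of Im] by simp
  then show ?thesis
    by (simp add: norm_eq_sqrt_cinner cinner_ge_zero complex_eq_iff)
qed

lemma complex_mult_cnj_cmod: "z * cnj z = (of_real (cmod z))\<^sup>2"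
  by (metis complex_norm_square of_real_power)

lemma cauchy_schwarz: "cmod (cinner x y) \<le> norm x * norm y" for x :: "'h::complex_hilbert_space"
proof (cases "y = 0")
  case False
  define c where "c = cinner x y / of_real ((norm y)\<^sup>2)"
  have ny: "(norm y)\<^sup>2 > 0" using False by simp
  have "cinner (x - c *\<^sub>C y) y = 0"
    using ny by (simp add: cinner_diff_left cinner_scaleC_left c_def cinner_self)
  then have "cinner (x - c *\<^sub>C y) (x - c *\<^sub>C y) = cinner (x - c *\<^sub>C y) x"
    by (simp add: cinner_diff_right[of "x - c *\<^sub>C y"] cinner_scaleC_right)
  also have "\<dots> = cinner x x - c * cnj (cinner x y)"
    by (simp add: cinner_diff_left cinner_scaleC_left cinner_commute[of y x])
  also have "c * cnj (cinner x y) = of_real ((cmod (cinner x y))\<^sup>2 / (norm y)\<^sup>2)"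
    by (simp add: c_def complex_mult_cnj_cmod)
  finally have "(norm (x - c *\<^sub>C y))\<^sup>2 = (norm x)\<^sup>2 - (cmod (cinner x y))\<^sup>2 / (norm y)\<^sup>2"
    unfolding cinner_self by (simp only: of_real_diff[symmetric] of_real_eq_iff)
  then have "(cmod (cinner x y))\<^sup>2 / (norm y)\<^sup>2 \<le> (norm x)\<^sup>2"
    by (metis diff_ge_0_iff_ge zero_le_power2)
  then have "(cmod (cinner x y))\<^sup>2 \<le> (norm x * norm y)\<^sup>2"
    using ny by (simp add: divide_le_eq power_mult_distrib)
  then show ?thesis by (rule power2_le_imp_le) simp
qed simp

lemma bounded_linear_cinner_left: "bounded_linear (\<lambda>x. cinner x y)" for y :: "'h::complex_hilbert_space"
  by (rule bounded_linear_intro[where K = "norm y"])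
     (auto simp: cinner_add_left scaleR_scaleC cinner_scaleC_left scaleR_conv_of_real cauchy_schwarz)

section \<open>Weighted square-summable sequences\<close>

lemma powr_double: "x powr (2 * r) = (x powr r)\<^sup>2" for x r :: real
  by (simp add: power2_eq_square flip: powr_add)

text \<open>Membership in the space of order \<open>r\<close> expressed by coefficients. It treats
  vectors and functionals, hence both signs of \<open>r\<close>, alike.\<close>

definition wsum :: "(nat \<Rightarrow> real) \<Rightarrow> real \<Rightarrow> (nat \<Rightarrow> complex) \<Rightarrow> bool" where
  "wsum lam r x \<longleftrightarrow> summable (\<lambda>n. lam n powr (2 * r) * (cmod (x n))\<^sup>2)"

lemma wsum_mono:
  assumes "wsum lam r x" "\<And>n. cmod (y n) \<le> K * cmod (x n)"
  shows "wsum lam r y"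
  unfolding wsum_def
proof (rule summable_comparison_test')
  show "summable (\<lambda>n. K\<^sup>2 * (lam n powr (2 * r) * (cmod (x n))\<^sup>2))"
    using assms(1) unfolding wsum_def by (rule summable_mult)
  fix n
  have "(cmod (y n))\<^sup>2 \<le> (K * cmod (x n))\<^sup>2" by (intro power_mono assms) auto
  then have "lam n powr (2 * r) * (cmod (y n))\<^sup>2 \<le> lam n powr (2 * r) * (K * cmod (x n))\<^sup>2"
    by (intro mult_left_mono) auto
  then show "norm (lam n powr (2 * r) * (cmod (y n))\<^sup>2) \<le> K\<^sup>2 * (lam n powr (2 * r) * (cmod (x n))\<^sup>2)"
    by (simp add: power_mult_distrib mult_ac)
qed

lemma power2_norm_add_le: "(norm (a + b))\<^sup>2 \<le> 2 * (norm a)\<^sup>2 + 2 * (norm b)\<^sup>2" for a b :: "'a::real_normed_vector"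
proof -
  have "(norm (a + b))\<^sup>2 \<le> (norm a + norm b)\<^sup>2" by (intro power_mono norm_triangle_ineq) auto
  also have "\<dots> \<le> 2 * (norm a)\<^sup>2 + 2 * (norm b)\<^sup>2"
    using sum_squares_bound[of "norm a" "norm b"] by (simp add: power2_sum)
  finally show ?thesis .
qed

lemma wsum_add:
  assumes "wsum lam r x" "wsum lam r y"
  shows "wsum lam r (\<lambda>n. x n + y n)"
  unfolding wsum_def
proof (rule summable_comparison_test')
  show "summable (\<lambda>n. 2 * (lam n powr (2 * r) * (cmod (x n))\<^sup>2) + 2 * (lam n powr (2 * r) * (cmod (y n))\<^sup>2))"
    using assms unfolding wsum_def by (intro summable_add summable_mult)
  fix n
  have "lam n powr (2 * r) * (cmod (x n + y n))\<^sup>2 \<le> lam n powr (2 * r) * (2 * (cmod (x n))\<^sup>2 + 2 * (cmod (y n))\<^sup>2)"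
    by (intro mult_left_mono power2_norm_add_le) auto
  then show "norm (lam n powr (2 * r) * (cmod (x n + y n))\<^sup>2) \<le> 2 * (lam n powr (2 * r) * (cmod (x n))\<^sup>2) + 2 * (lam n powr (2 * r) * (cmod (y n))\<^sup>2)"
    by (simp add: algebra_simps)
qed

lemma wsum_mult: "wsum lam r x \<Longrightarrow> wsum lam r (\<lambda>n. c * x n)"
  by (rule wsum_mono[where K = "cmod c"]) (auto simp: norm_mult)

lemma wsum_diff: "wsum lam r x \<Longrightarrow> wsum lam r y \<Longrightarrow> wsum lam r (\<lambda>n. x n - y n)"
  using wsum_add[of lam r x "\<lambda>n. (-1) * y n"] wsum_mult[of lam r y "-1"] by simp

lemma wsum_zero: "wsum lam r (\<lambda>n. 0)"
  by (simp add: wsum_def)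

lemma wsum_sum: "(\<And>i. i \<in> I \<Longrightarrow> wsum lam r (x i)) \<Longrightarrow> wsum lam r (\<lambda>n. \<Sum>i\<in>I. x i n)"
  by (induction I rule: infinite_finite_induct) (auto intro: wsum_add simp: wsum_zero)

lemma hnorm_nonneg: "wsum lam r (\<lambda>n. f (\<phi> n)) \<Longrightarrow> 0 \<le> hnorm lam \<phi> r f"
  unfolding hnorm_def wsum_def by (simp add: suminf_nonneg)

lemma coeff_le_hnorm:
  assumes "wsum lam r (\<lambda>n. f (\<phi> n))"
  shows "lam n powr r * cmod (f (\<phi> n)) \<le> hnorm lam \<phi> r f"
proof -
  have "(lam n powr r * cmod (f (\<phi> n)))\<^sup>2 = lam n powr (2 * r) * (cmod (f (\<phi> n)))\<^sup>2"
    unfolding powr_double by (simp add: power_mult_distrib)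
  also have "\<dots> \<le> (\<Sum>n. lam n powr (2 * r) * (cmod (f (\<phi> n)))\<^sup>2)"
    using sum_le_suminf[OF assms[unfolded wsum_def], of "{n}"] by simp
  finally show ?thesis unfolding hnorm_def by (rule real_le_rsqrt)
qed

text \<open>For the truncation to \<open>k\<close> modes. The head is measured by a plain sum,
  through which integrals in time pass mode by mode; the tail is measured by a square-summable
  majorant, which makes it small as \<open>k\<close> grows.\<close>

lemma hnorm_head_tail:
  assumes a: "summable (\<lambda>n. (a n)\<^sup>2)" and h: "0 \<le> h"
    and d: "\<And>n. n < k \<Longrightarrow> lam n powr r * cmod (f (\<phi> n)) \<le> d n"
    and t: "\<And>n. n \<ge> k \<Longrightarrow> lam n powr r * cmod (f (\<phi> n)) \<le> a n * h"
  shows "hnorm lam \<phi> r f \<le> (\<Sum>n<k. d n) + h * sqrt (\<Sum>n. (a (n + k))\<^sup>2)"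
    and "wsum lam r (\<lambda>n. f (\<phi> n))"
proof -
  define y where "y n = lam n powr r * cmod (f (\<phi> n))" for n
  have y0: "0 \<le> y n" for n by (simp add: y_def)
  have y2: "lam n powr (2 * r) * (cmod (f (\<phi> n)))\<^sup>2 = (y n)\<^sup>2" for n
    unfolding powr_double by (simp add: y_def power_mult_distrib)
  have ak: "summable (\<lambda>n. (a (n + k))\<^sup>2)" by (rule summable_ignore_initial_segment[OF a])
  have le: "(y (n + k))\<^sup>2 \<le> h\<^sup>2 * (a (n + k))\<^sup>2" for n
    using power_mono[OF t[of "n + k", folded y_def] y0, of 2] by (simp add: power_mult_distrib mult.commute)
  have s2: "summable (\<lambda>n. (y (n + k))\<^sup>2)"
    by (rule summable_comparison_test'[OF summable_mult[OF ak, of "h\<^sup>2"]]) (use le in auto)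
  then have s1: "summable (\<lambda>n. (y n)\<^sup>2)" using summable_iff_shift[of "\<lambda>n. (y n)\<^sup>2" k] by simp
  then show "wsum lam r (\<lambda>n. f (\<phi> n))" by (simp add: wsum_def y2)
  have "hnorm lam \<phi> r f = sqrt (\<Sum>n. (y n)\<^sup>2)" by (simp add: hnorm_def y2)
  also have "(\<Sum>n. (y n)\<^sup>2) = (\<Sum>n. (y (n + k))\<^sup>2) + (\<Sum>n<k. (y n)\<^sup>2)"
    by (rule suminf_split_initial_segment[OF s1])
  also have "sqrt \<dots> \<le> sqrt (\<Sum>n. (y (n + k))\<^sup>2) + sqrt (\<Sum>n<k. (y n)\<^sup>2)"
    by (intro sqrt_add_le_add_sqrt suminf_nonneg s2 sum_nonneg) auto
  also have "sqrt (\<Sum>n<k. (y n)\<^sup>2) \<le> (\<Sum>n<k. \<bar>y n\<bar>)"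
    using L2_set_le_sum_abs[of y "{..<k}"] by (simp add: L2_set_def)
  also have "\<dots> \<le> (\<Sum>n<k. d n)"
    using d y0 by (intro sum_mono) (auto simp: y_def)
  also have "sqrt (\<Sum>n. (y (n + k))\<^sup>2) \<le> sqrt (\<Sum>n. h\<^sup>2 * (a (n + k))\<^sup>2)"
    by (intro real_sqrt_le_mono suminf_le le s2 summable_mult ak)
  also have "\<dots> = h * sqrt (\<Sum>n. (a (n + k))\<^sup>2)"
    using h by (simp add: suminf_mult[OF ak] real_sqrt_mult)
  finally show "hnorm lam \<phi> r f \<le> (\<Sum>n<k. d n) + h * sqrt (\<Sum>n. (a (n + k))\<^sup>2)" by simp
qed

locale spectral_scale =
  fixes lam :: "nat \<Rightarrow> real" and \<phi> :: "nat \<Rightarrow> 'h::complex_hilbert_space"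
  assumes lam_0: "0 < lam 0" and lam_mono: "mono lam"
    and ortho: "cinner (\<phi> m) (\<phi> n) = (if m = n then 1 else 0)"
    and basis: "(\<lambda>n. cinner u (\<phi> n) *\<^sub>C \<phi> n) sums u"
begin

lemma lam_ge: "lam 0 \<le> lam n"
  using lam_mono by (simp add: mono_def)

lemma lam_pos: "0 < lam n"
  using lam_0 lam_ge[of n] by linarith

lemma powr_lam_le:
  assumes "r \<le> s"
  shows "lam n powr r \<le> lam 0 powr (r - s) * lam n powr s"
proof -
  have "lam n powr (r - s) \<le> lam 0 powr (r - s)"
    using assms lam_0 lam_ge by (intro powr_mono2') auto
  then have "lam n powr (r - s) * lam n powr s \<le> lam 0 powr (r - s) * lam n powr s"
    by (intro mult_right_mono) auto
  then show ?thesis by (simp add: powr_add[symmetric])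
qed

lemma wsum_weaken:
  assumes "r \<le> s" "wsum lam s x"
  shows "wsum lam r x"
  unfolding wsum_def
proof (rule summable_comparison_test')
  show "summable (\<lambda>n. lam 0 powr (2 * r - 2 * s) * (lam n powr (2 * s) * (cmod (x n))\<^sup>2))"
    using assms(2) unfolding wsum_def by (rule summable_mult)
  fix n
  have "lam n powr (2 * r) * (cmod (x n))\<^sup>2 \<le> (lam 0 powr (2 * r - 2 * s) * lam n powr (2 * s)) * (cmod (x n))\<^sup>2"
    by (intro mult_right_mono powr_lam_le) (use assms in auto)
  then show "norm (lam n powr (2 * r) * (cmod (x n))\<^sup>2) \<le> lam 0 powr (2 * r - 2 * s) * (lam n powr (2 * s) * (cmod (x n))\<^sup>2)"
    by (simp add: mult.assoc)
qed

lemma wsum_finite: "wsum lam r (\<lambda>n. if n < k then x n else 0)"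
  unfolding wsum_def by (rule summable_finite[of "{..<k}"]) auto

lemma hspace_iff: "u \<in> hspace lam \<phi> s \<longleftrightarrow> wsum lam s (\<lambda>n. cinner u (\<phi> n))"
  by (simp add: hspace_def wsum_def)

lemma parseval: "(\<lambda>n. (cmod (cinner u (\<phi> n)))\<^sup>2) sums (norm u)\<^sup>2"
proof -
  have "(\<lambda>n. cinner (cinner u (\<phi> n) *\<^sub>C \<phi> n) u) sums cinner u u"
    by (rule bounded_linear.sums[OF bounded_linear_cinner_left basis])
  also have "(\<lambda>n. cinner (cinner u (\<phi> n) *\<^sub>C \<phi> n) u) = (\<lambda>n. of_real ((cmod (cinner u (\<phi> n)))\<^sup>2))"
    by (simp add: cinner_scaleC_left cinner_commute[of "\<phi> _" u] complex_mult_cnj_cmod)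
  finally show ?thesis unfolding cinner_self sums_of_real_iff .
qed

lemma hnorm_0_cinner: "hnorm lam \<phi> 0 (cinner u) = norm u"
  using parseval[of u] lam_pos by (auto simp: hnorm_def sums_iff less_imp_neq[symmetric])

lemma coeff_eqI: "(\<And>n. cinner u (\<phi> n) = cinner v (\<phi> n)) \<Longrightarrow> u = v"
  using basis[of u] basis[of v] sums_unique2 by force

lemma cinner_sum_basis:
  "finite F \<Longrightarrow> cinner (\<Sum>n\<in>F. a n *\<^sub>C \<phi> n) (\<phi> m) = (if m \<in> F then a m else 0)"
  by (simp add: cinner_sum_left cinner_scaleC_left ortho if_distrib cong: if_cong)

lemma norm_sum_basis:
  assumes "finite F"
  shows "(norm (\<Sum>n\<in>F. a n *\<^sub>C \<phi> n))\<^sup>2 = (\<Sum>n\<in>F. (cmod (a n))\<^sup>2)"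
proof -
  let ?x = "\<Sum>n\<in>F. a n *\<^sub>C \<phi> n"
  have "cinner ?x ?x = (\<Sum>n\<in>F. cnj (a n) * cinner ?x (\<phi> n))"
    by (subst cinner_sum_right) (simp add: cinner_scaleC_right)
  also have "\<dots> = (\<Sum>n\<in>F. of_real ((cmod (a n))\<^sup>2))"
    using assms by (intro sum.cong refl) (simp add: cinner_sum_basis complex_mult_cnj_cmod mult.commute)
  finally show ?thesis
    unfolding cinner_self of_real_sum[symmetric] of_real_eq_iff .
qed

lemma riesz_fischer:
  assumes "wsum lam 0 a"
  shows "summable (\<lambda>n. a n *\<^sub>C \<phi> n)" "cinner (\<Sum>n. a n *\<^sub>C \<phi> n) (\<phi> m) = a m"
proof -
  have s: "summable (\<lambda>n. (cmod (a n))\<^sup>2)"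
    using assms lam_pos by (auto simp: wsum_def less_imp_neq[symmetric])
  show *: "summable (\<lambda>n. a n *\<^sub>C \<phi> n)"
    unfolding summable_Cauchy
  proof (intro allI impI)
    fix e :: real assume "e > 0"
    then have "e\<^sup>2 > 0" by simp
    with s obtain N where N: "\<And>m n. m \<ge> N \<Longrightarrow> norm (\<Sum>n\<in>{m..<n}. (cmod (a n))\<^sup>2) < e\<^sup>2"
      unfolding summable_Cauchy by blast
    have "norm (\<Sum>n\<in>{m..<n}. a n *\<^sub>C \<phi> n) < e" if "m \<ge> N" for m n
    proof (rule power2_less_imp_less)
      have "(norm (\<Sum>n\<in>{m..<n}. a n *\<^sub>C \<phi> n))\<^sup>2 = (\<Sum>n\<in>{m..<n}. (cmod (a n))\<^sup>2)"
        by (rule norm_sum_basis) simp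
      also have "\<dots> \<le> norm (\<Sum>n\<in>{m..<n}. (cmod (a n))\<^sup>2)" by simp
      also have "\<dots> < e\<^sup>2" by (rule N[OF that])
      finally show "(norm (\<Sum>n\<in>{m..<n}. a n *\<^sub>C \<phi> n))\<^sup>2 < e\<^sup>2" .
    qed (use \<open>e > 0\<close> in simp)
    then show "\<exists>N. \<forall>m\<ge>N. \<forall>n. norm (\<Sum>n\<in>{m..<n}. a n *\<^sub>C \<phi> n) < e" by blast
  qed
  have "(\<lambda>n. cinner (a n *\<^sub>C \<phi> n) (\<phi> m)) sums cinner (\<Sum>n. a n *\<^sub>C \<phi> n) (\<phi> m)"
    by (rule bounded_linear.sums[OF bounded_linear_cinner_left summable_sums[OF *]])
  moreover have "(\<lambda>n. cinner (a n *\<^sub>C \<phi> n) (\<phi> m)) sums a m"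
    using sums_single[of m a] by (simp add: cinner_scaleC_left ortho if_distrib eq_commute cong: if_cong)
  ultimately show "cinner (\<Sum>n. a n *\<^sub>C \<phi> n) (\<phi> m) = a m"
    by (rule sums_unique2)
qed

text \<open>The functional with prescribed brackets \<open>a n\<close> on the basis. Under
  \<open>wsum lam (- \<sigma>) a\<close> the series converges on
  \<open>hspace lam \<phi> \<sigma>\<close>; outside that space its value carries no meaning, in
  line with the convention of \<open>hdual\<close>.\<close>

definition coeff_fun :: "(nat \<Rightarrow> complex) \<Rightarrow> 'h \<Rightarrow> complex" where
  "coeff_fun a v = (\<Sum>n. a n * cinner (\<phi> n) v)"

lemma coeff_fun_basis [simp]: "coeff_fun a (\<phi> m) = a m"
  unfolding coeff_fun_def ortho by (subst suminf_finite[of "{m}"]) auto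

lemma weighted_cauchy_schwarz:
  assumes a: "wsum lam (- \<sigma>) a" and v: "v \<in> hspace lam \<phi> \<sigma>"
  shows "summable (\<lambda>n. cmod (a n * cinner (\<phi> n) v))"
    and "(\<Sum>n. cmod (a n * cinner (\<phi> n) v)) \<le> sqrt (\<Sum>n. lam n powr (2 * - \<sigma>) * (cmod (a n))\<^sup>2) * hnorm lam \<phi> \<sigma> (cinner v)"
proof -
  define x where "x n = lam n powr (- \<sigma>) * cmod (a n)" for n
  define y where "y n = lam n powr \<sigma> * cmod (cinner v (\<phi> n))" for n
  have x2: "lam n powr (2 * - \<sigma>) * (cmod (a n))\<^sup>2 = (x n)\<^sup>2" for n
    unfolding powr_double by (simp add: x_def power_mult_distrib)
  have y2: "lam n powr (2 * \<sigma>) * (cmod (cinner v (\<phi> n)))\<^sup>2 = (y n)\<^sup>2" for n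
    unfolding powr_double by (simp add: y_def power_mult_distrib)
  have sx: "summable (\<lambda>n. (x n)\<^sup>2)" using a unfolding wsum_def x2 .
  have sy: "summable (\<lambda>n. (y n)\<^sup>2)" using v unfolding hspace_iff wsum_def y2 .
  have pos: "0 \<le> x n" "0 \<le> y n" for n by (auto simp: x_def y_def)
  have eq: "cmod (a n * cinner (\<phi> n) v) = x n * y n" for n
  proof -
    have "lam n powr (- \<sigma>) * lam n powr \<sigma> = 1" using lam_pos[of n] by (simp add: powr_add[symmetric])
    moreover have "cmod (cinner (\<phi> n) v) = cmod (cinner v (\<phi> n))" by (metis cinner_commute complex_mod_cnj)
    ultimately show ?thesis by (simp add: x_def y_def norm_mult mult_ac)
  qed
  have le: "(\<Sum>n<N. x n * y n) \<le> sqrt (\<Sum>n. (x n)\<^sup>2) * sqrt (\<Sum>n. (y n)\<^sup>2)" for N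
  proof -
    have "(\<Sum>n<N. x n * y n)\<^sup>2 \<le> (\<Sum>n<N. (x n)\<^sup>2) * (\<Sum>n<N. (y n)\<^sup>2)"
      by (rule Cauchy_Schwarz_ineq_sum)
    also have "\<dots> \<le> (\<Sum>n. (x n)\<^sup>2) * (\<Sum>n. (y n)\<^sup>2)"
      by (intro mult_mono sum_le_suminf sx sy sum_nonneg suminf_nonneg) auto
    finally show ?thesis by (simp add: real_le_rsqrt real_sqrt_mult[symmetric])
  qed
  have s: "summable (\<lambda>n. x n * y n)"
    by (rule summableI_nonneg_bounded[of _ "sqrt (\<Sum>n. (x n)\<^sup>2) * sqrt (\<Sum>n. (y n)\<^sup>2)"]) (use pos le in auto)
  then show "summable (\<lambda>n. cmod (a n * cinner (\<phi> n) v))" unfolding eq .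
  show "(\<Sum>n. cmod (a n * cinner (\<phi> n) v)) \<le> sqrt (\<Sum>n. lam n powr (2 * - \<sigma>) * (cmod (a n))\<^sup>2) * hnorm lam \<phi> \<sigma> (cinner v)"
    unfolding eq hnorm_def x2 y2 by (rule suminf_le_const[OF s le])
qed

lemma coeff_fun_hdual:
  assumes a: "wsum lam (- \<sigma>) a"
  shows "coeff_fun a \<in> hdual lam \<phi> \<sigma>"
  unfolding hdual_def
proof (intro CollectI conjI ballI allI)
  have sum: "summable (\<lambda>n. a n * cinner (\<phi> n) x)" if "x \<in> hspace lam \<phi> \<sigma>" for x
    by (rule summable_norm_cancel[OF weighted_cauchy_schwarz(1)[OF a that]])
  {
    fix x y assume "x \<in> hspace lam \<phi> \<sigma>" "y \<in> hspace lam \<phi> \<sigma>"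
    then show "coeff_fun a (x + y) = coeff_fun a x + coeff_fun a y"
      unfolding coeff_fun_def cinner_add_right distrib_left by (intro suminf_add[symmetric] sum)
  next
    fix c x assume "x \<in> hspace lam \<phi> \<sigma>"
    then show "coeff_fun a (c *\<^sub>C x) = cnj c * coeff_fun a x"
      unfolding coeff_fun_def cinner_scaleC_right mult.left_commute[of "a _" "cnj c"] by (intro suminf_mult sum)
  next
    show "\<exists>K. \<forall>x\<in>hspace lam \<phi> \<sigma>. cmod (coeff_fun a x) \<le> K * hnorm lam \<phi> \<sigma> (cinner x)"
    proof (intro exI ballI)
      fix x assume x: "x \<in> hspace lam \<phi> \<sigma>"
      have "cmod (coeff_fun a x) \<le> (\<Sum>n. cmod (a n * cinner (\<phi> n) x))"
        unfolding coeff_fun_def by (rule summable_norm[OF weighted_cauchy_schwarz(1)[OF a x]])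
      also note weighted_cauchy_schwarz(2)[OF a x]
      finally show "cmod (coeff_fun a x) \<le> sqrt (\<Sum>n. lam n powr (2 * - \<sigma>) * (cmod (a n))\<^sup>2) * hnorm lam \<phi> \<sigma> (cinner x)" .
    qed
  }
qed

lemma basis_hspace: "(\<Sum>n<N. a n *\<^sub>C \<phi> n) \<in> hspace lam \<phi> s"
  unfolding hspace_iff using wsum_finite[of s N a] by (simp add: cinner_sum_basis)

text \<open>The converse of \<open>coeff_fun_hdual\<close>. The functional is tested on truncations
  of its own representer, with coefficients \<open>b n\<close>: its value there is
  \<open>S N\<close> and their norm is \<open>sqrt (S N)\<close>, so boundedness by \<open>K\<close>
  forces \<open>S N \<le> K\<^sup>2\<close>.\<close>

lemma hdual_wsum:
  assumes f: "f \<in> hdual lam \<phi> \<sigma>"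
  shows "wsum lam (- \<sigma>) (\<lambda>n. f (\<phi> n))"
proof -
  have add: "f (x + y) = f x + f y" if "x \<in> hspace lam \<phi> \<sigma>" "y \<in> hspace lam \<phi> \<sigma>" for x y
    using f that by (simp add: hdual_def)
  have scale: "f (c *\<^sub>C x) = cnj c * f x" if "x \<in> hspace lam \<phi> \<sigma>" for c x
    using f that by (simp add: hdual_def)
  obtain K where K: "\<And>x. x \<in> hspace lam \<phi> \<sigma> \<Longrightarrow> cmod (f x) \<le> K * hnorm lam \<phi> \<sigma> (cinner x)"
    using f unfolding hdual_def by blast
  have one: "\<phi> n \<in> hspace lam \<phi> \<sigma>" for n
    unfolding hspace_iff wsum_def ortho by (rule summable_finite[of "{n}"]) auto
  have z: "(0::'h) \<in> hspace lam \<phi> \<sigma>" by (simp add: hspace_def)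
  have f0: "f 0 = 0" using add[OF z z] by simp
  have fs: "f (\<Sum>n<N. b n *\<^sub>C \<phi> n) = (\<Sum>n<N. cnj (b n) * f (\<phi> n))" for N b
  proof (induction N)
    case (Suc N)
    have "b N *\<^sub>C \<phi> N \<in> hspace lam \<phi> \<sigma>"
      unfolding hspace_iff using wsum_mult[OF one[of N, unfolded hspace_iff], of "b N"] by (simp add: cinner_scaleC_left)
    then show ?case using Suc by (simp add: add basis_hspace scale one)
  qed (simp add: f0)
  define S where "S N = (\<Sum>n<N. lam n powr (2 * - \<sigma>) * (cmod (f (\<phi> n)))\<^sup>2)" for N
  have S0: "S N \<ge> 0" for N unfolding S_def by (intro sum_nonneg) auto
  have "S N \<le> K\<^sup>2" for N
  proof -
    define b where "b n = of_real (lam n powr (2 * - \<sigma>)) * f (\<phi> n)" for n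
    let ?x = "\<Sum>n<N. b n *\<^sub>C \<phi> n"
    have "f ?x = of_real (S N)"
      unfolding fs S_def of_real_sum
      by (intro sum.cong refl) (simp add: b_def complex_mult_cnj_cmod mult.left_commute mult.commute[of "cnj _"])
    then have "S N \<le> K * hnorm lam \<phi> \<sigma> (cinner ?x)"
      using K[OF basis_hspace, of b N] S0[of N] by simp
    also have "hnorm lam \<phi> \<sigma> (cinner ?x) = sqrt (S N)"
    proof -
      have "(\<Sum>n. lam n powr (2 * \<sigma>) * (cmod (cinner ?x (\<phi> n)))\<^sup>2) = (\<Sum>n<N. lam n powr (2 * \<sigma>) * (cmod (cinner ?x (\<phi> n)))\<^sup>2)"
        by (rule suminf_finite) (auto simp: cinner_sum_basis)
      also have "\<dots> = S N"
        unfolding S_def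
      proof (intro sum.cong refl)
        fix n assume "n \<in> {..<N}"
        have "lam n powr (2 * \<sigma>) * (lam n powr (2 * - \<sigma>))\<^sup>2 = lam n powr (2 * - \<sigma>)"
          unfolding power2_eq_square by (simp flip: powr_add)
        then show "lam n powr (2 * \<sigma>) * (cmod (cinner ?x (\<phi> n)))\<^sup>2 = lam n powr (2 * - \<sigma>) * (cmod (f (\<phi> n)))\<^sup>2"
          using \<open>n \<in> {..<N}\<close> by (simp add: cinner_sum_basis b_def norm_mult power_mult_distrib mult.assoc[symmetric])
      qed
      finally show ?thesis by (simp add: hnorm_def)
    qed
    finally have le: "S N \<le> K * sqrt (S N)" .
    show "S N \<le> K\<^sup>2"
    proof (cases "S N = 0")
      case False
      then have p: "sqrt (S N) > 0" using S0[of N] by simp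
      have "sqrt (S N) * sqrt (S N) \<le> K * sqrt (S N)" using le S0[of N] by simp
      then have "sqrt (S N) \<le> K" using p by (rule mult_right_le_imp_le)
      then have "(sqrt (S N))\<^sup>2 \<le> K\<^sup>2" using p by (intro power_mono) auto
      then show ?thesis using S0[of N] by simp
    qed simp
  qed
  then show ?thesis
    unfolding wsum_def by (intro summableI_nonneg_bounded[of _ "K\<^sup>2"]) (auto simp: S_def)
qed

lemma cinner_hdual:
  assumes "\<sigma> \<ge> 0"
  shows "cinner u \<in> hdual lam \<phi> \<sigma>"
  unfolding hdual_def
proof (intro CollectI conjI ballI allI)
  show "\<exists>K. \<forall>x\<in>hspace lam \<phi> \<sigma>. cmod (cinner u x) \<le> K * hnorm lam \<phi> \<sigma> (cinner x)"
  proof (intro exI ballI)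
    fix x assume x: "x \<in> hspace lam \<phi> \<sigma>"
    have "norm x = sqrt (\<Sum>n. (cmod (cinner x (\<phi> n)))\<^sup>2)"
      using parseval[of x] by (simp add: sums_iff)
    also have "\<dots> \<le> sqrt (\<Sum>n. lam 0 powr (- (2 * \<sigma>)) * (lam n powr (2 * \<sigma>) * (cmod (cinner x (\<phi> n)))\<^sup>2))"
    proof (intro real_sqrt_le_mono suminf_le)
      fix n
      have "1 * (cmod (cinner x (\<phi> n)))\<^sup>2 \<le> (lam 0 powr (- (2 * \<sigma>)) * lam n powr (2 * \<sigma>)) * (cmod (cinner x (\<phi> n)))\<^sup>2"
        using powr_lam_le[of 0 "2 * \<sigma>" n] lam_pos[of n] assms by (intro mult_right_mono) auto
      then show "(cmod (cinner x (\<phi> n)))\<^sup>2 \<le> lam 0 powr (- (2 * \<sigma>)) * (lam n powr (2 * \<sigma>) * (cmod (cinner x (\<phi> n)))\<^sup>2)"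
        by (simp add: mult.assoc)
    qed (use parseval[of x] x in \<open>auto simp: sums_iff hspace_def intro!: summable_mult\<close>)
    also have "\<dots> = sqrt (lam 0 powr (- (2 * \<sigma>))) * hnorm lam \<phi> \<sigma> (cinner x)"
      using x by (subst suminf_mult) (auto simp: hspace_def hnorm_def real_sqrt_mult)
    finally have "norm u * norm x \<le> norm u * (sqrt (lam 0 powr (- (2 * \<sigma>))) * hnorm lam \<phi> \<sigma> (cinner x))"
      by (intro mult_left_mono) auto
    then show "cmod (cinner u x) \<le> (norm u * sqrt (lam 0 powr (- (2 * \<sigma>)))) * hnorm lam \<phi> \<sigma> (cinner x)"
      using cauchy_schwarz[of u x] by (simp add: mult.assoc)
  qed
qed (auto simp: cinner_add_right cinner_scaleC_right)

lemma hscale_wsum: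
  assumes "f \<in> hscale lam \<phi> r"
  shows "wsum lam r (\<lambda>n. f (\<phi> n))"
  using assms hdual_wsum[of f "- r"] by (auto simp: hscale_def hspace_iff split: if_splits)

end

subsection \<open>Bochner integrals in the dual spaces\<close>

text \<open>The values of \<open>g\<close> will be functionals, so only a scalar reading
  \<open>e\<close> of them is integrated. With \<open>e y = y (\<phi> n)\<close> the sum is the n-th
  coefficient of the elementary integral in \<open>has_bochner_hdual\<close>.\<close>

lemma simple_function_integral_eval:
  fixes g :: "'a \<Rightarrow> 'b" and e :: "'b \<Rightarrow> complex"
  assumes "finite_measure M" and g: "simple_function M g"
  shows "has_bochner_integral M (\<lambda>t. e (g t))
    (\<Sum>y\<in>g ` space M. of_real (measure M {t\<in>space M. g t = y}) * e y)"
proof -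
  interpret finite_measure M by fact
  have fin: "finite (g ` space M)" using g by (rule simple_functionD)
  have sets: "{t\<in>space M. g t = y} \<in> sets M" for y
    using simple_functionD(2)[OF g, of "{y}"] by (simp add: vimage_def Int_def conj_commute)
  have "has_bochner_integral M (\<lambda>t. indicator {t\<in>space M. g t = y} t *\<^sub>R e y) (measure M {t\<in>space M. g t = y} *\<^sub>R e y)" for y
    by (rule has_bochner_integral_indicator) (auto simp: sets less_top[symmetric])
  then have "has_bochner_integral M (\<lambda>t. \<Sum>y\<in>g ` space M. indicator {t\<in>space M. g t = y} t *\<^sub>R e y)
     (\<Sum>y\<in>g ` space M. measure M {t\<in>space M. g t = y} *\<^sub>R e y)"
    by (rule has_bochner_integral_sum)
  then show ?thesis
  proof (rule has_bochner_integral_cong[THEN iffD1, rotated 3])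
    fix t assume t: "t \<in> space M"
    have "(\<Sum>y\<in>g ` space M. indicator {t\<in>space M. g t = y} t *\<^sub>R e y) = (\<Sum>y\<in>g ` space M. if y = g t then e y else 0)"
      using t by (intro sum.cong) (auto simp: indicator_def)
    also have "\<dots> = e (g t)" using t fin by simp
    finally show "(\<Sum>y\<in>g ` space M. indicator {t\<in>space M. g t = y} t *\<^sub>R e y) = e (g t)" .
  qed (auto simp: scaleR_conv_of_real)
qed

lemma simple_approx_integrable:
  fixes f :: "'a \<Rightarrow> complex"
  assumes f: "integrable M f" and "0 < (e::real)"
  obtains s where "simple_function M s" "integrable M s" "(LINT t|M. norm (f t - s t)) \<le> e"
proof -
  from f obtain x where "has_bochner_integral M f x" by (auto simp: integrable.simps)
  then obtain s where s: "\<And>i. Bochner_Integration.simple_bochner_integrable M (s i)"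
    and lim: "(\<lambda>i. \<integral>\<^sup>+t. norm (f t - s i t) \<partial>M) \<longlonglongrightarrow> 0"
    by (auto simp: has_bochner_integral.simps)
  have "\<forall>\<^sub>F i in sequentially. (\<integral>\<^sup>+t. norm (f t - s i t) \<partial>M) < ennreal e"
    using lim assms(2) by (intro order_tendstoD) auto
  then obtain i where i: "(\<integral>\<^sup>+t. norm (f t - s i t) \<partial>M) < ennreal e"
    by (auto simp: eventually_sequentially)
  have si: "integrable M (s i)"
    using has_bochner_integral_simple_bochner_integrable[OF s] by (auto simp: integrable.simps)
  have "(\<integral>\<^sup>+t. norm (f t - s i t) \<partial>M) = ennreal (LINT t|M. norm (f t - s i t))"
    by (intro nn_integral_eq_integral integrable_norm Bochner_Integration.integrable_diff f si) auto
  with i have "(LINT t|M. norm (f t - s i t)) \<le> e"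
    using assms(2) by (simp add: ennreal_less_iff)
  with s si show ?thesis by (intro that[of "s i"]) (auto simp: Bochner_Integration.simple_bochner_integrable.simps)
qed

lemma complete_measure_lebesgue_on:
  assumes "S \<in> sets lebesgue"
  shows "complete_measure (lebesgue_on S)"
proof
  fix A B assume "A \<subseteq> B" "B \<in> null_sets (lebesgue_on S)"
  then have B: "B \<in> null_sets lebesgue" "B \<subseteq> S" using assms by (auto simp: null_sets_restrict_space)
  then have "A \<in> sets lebesgue" using \<open>A \<subseteq> B\<close> completion.complete2 by blast
  then show "A \<in> sets (lebesgue_on S)"
    using \<open>A \<subseteq> B\<close> B(2) assms by (auto simp: sets_restrict_space_iff)
qed

text \<open>For functions that are known only up to null sets: almost-everywhere limits of simple
  functions, and a fractional integral given by an equation that holds almost everywhere.\<close>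

lemma borel_measurable_complete_AE:
  fixes f g :: "'a \<Rightarrow> 'b::topological_space"
  assumes "complete_measure M" "f \<in> borel_measurable M" "AE x in M. f x = g x"
  shows "g \<in> borel_measurable M"
proof (rule borel_measurableI)
  fix U :: "'b set" assume "open U"
  interpret complete_measure M by fact
  show "g -` U \<inter> space M \<in> sets M"
  proof (rule in_sets_AE)
    show "f -` U \<inter> space M \<in> sets M"
      using assms(2) \<open>open U\<close> by (intro measurable_sets) auto
    show "AE x in M. x \<in> f -` U \<inter> space M \<longleftrightarrow> x \<in> g -` U \<inter> space M"
      using assms(3) by eventually_elim auto
  qed auto
qed

context spectral_scale
begin

text \<open>Scalar integrals of the coefficients suffice once the coefficients have a majorant that
  separates mode and time. The simple functions keep \<open>k\<close> modes only; what they omit is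
  at most \<open>h t\<close> times a tail of \<open>a\<close>, hence small in the mean.\<close>

lemma has_bochner_hdualI:
  assumes S: "S \<in> lmeasurable"
    and f: "\<And>t. t \<in> S \<Longrightarrow> f t \<in> hdual lam \<phi> \<sigma>" and w: "w \<in> hdual lam \<phi> \<sigma>"
    and int: "\<And>n. has_bochner_integral (lebesgue_on S) (\<lambda>t. f t (\<phi> n)) (w (\<phi> n))"
    and a: "summable (\<lambda>n. (a n)\<^sup>2)" "\<And>n. 0 \<le> a n"
    and h: "integrable (lebesgue_on S) h" "\<And>t. t \<in> S \<Longrightarrow> 0 \<le> h t"
    and bound: "\<And>t n. t \<in> S \<Longrightarrow> lam n powr (- \<sigma>) * cmod (f t (\<phi> n)) \<le> a n * h t"
  shows "has_bochner_hdual lam \<phi> \<sigma> S f w"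
proof -
  define M where "M = lebesgue_on S"
  have sp: "space M = S" by (simp add: M_def)
  have fin: "finite_measure M" unfolding M_def by (rule finite_measure_lebesgue_on[OF S])
  define F where "F n t = f t (\<phi> n)" for n t
  have F: "integrable M (F n)" "(LINT t|M. F n t) = w (\<phi> n)" for n
    using int[of n] by (auto simp: M_def F_def[abs_def] has_bochner_integral_iff)
  have [measurable]: "F n \<in> borel_measurable M" for n using F by auto
  define H where "H = (LINT t|M. h t)"
  have H0: "0 \<le> H" unfolding H_def by (intro integral_nonneg_AE AE_I2) (use h in \<open>auto simp: sp\<close>)
  define p where "p n = lam n powr (- \<sigma>)" for n
  have p: "p n > 0" for n using lam_pos[of n] by (simp add: p_def)
  \<comment> \<open>The weighted error allowed in each of the first \<open>k\<close> modes; their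
    sum \<open>real k * e k\<close> has to tend to \<open>0\<close>.\<close>
  define e where "e k = 1 / (real k + 1)\<^sup>2" for k
  have e: "e k > 0" for k by (simp add: e_def)
  have "\<exists>s. simple_function M s \<and> integrable M s \<and> (LINT t|M. norm (F n t - s t)) \<le> e k / p n" for k n
    by (rule simple_approx_integrable[OF F(1)[of n], of "e k / p n"]) (use e[of k] p[of n] in auto)
  then have "\<forall>k. \<exists>s. \<forall>n. simple_function M (s n) \<and> integrable M (s n) \<and> (LINT t|M. norm (F n t - s n t)) \<le> e k / p n"
    by (intro allI choice)
  from choice[OF this] obtain s where "\<forall>k n. simple_function M (s k n) \<and> integrable M (s k n) \<and> (LINT t|M. norm (F n t - s k n t)) \<le> e k / p n" ..
  then have s: "\<And>k n. simple_function M (s k n)" "\<And>k n. integrable M (s k n)"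
     "\<And>k n. (LINT t|M. norm (F n t - s k n t)) \<le> e k / p n" by auto
  have [measurable]: "s k n \<in> borel_measurable M" for k n using s(2) by auto
  define g where "g k t v = (\<Sum>n<k. s k n t * cinner (\<phi> n) v)" for k t v
  have g_basis: "g k t (\<phi> n) = (if n < k then s k n t else 0)" for k t n
    by (simp add: g_def ortho if_distrib cong: if_cong)
  have g_hdual: "g k t \<in> hdual lam \<phi> \<sigma>" for k t
  proof -
    have "g k t = coeff_fun (\<lambda>n. if n < k then s k n t else 0)"
      unfolding coeff_fun_def g_def fun_eq_iff
      by (intro allI) (subst suminf_finite[of "{..<k}"], auto)
    then show ?thesis using coeff_fun_hdual[OF wsum_finite[of "- \<sigma>" k "\<lambda>n. s k n t"]] by simp
  qed
  have g_simple: "simple_function M (g k)" for k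
  proof -
    have "simple_function M (\<lambda>t v. \<Sum>n<j. s k n t * cinner (\<phi> n) v)" for j
    proof (induction j)
      case (Suc j)
      have "simple_function M (\<lambda>t. (\<lambda>y z v. y v + z * cinner (\<phi> j) v) (\<lambda>v. \<Sum>n<j. s k n t * cinner (\<phi> n) v) (s k j t))"
        by (rule simple_function_compose2[OF Suc s(1)])
      then show ?case by simp
    qed (simp add: simple_function_const)
    then show ?thesis unfolding g_def[abs_def] .
  qed
  define \<epsilon> where "\<epsilon> k = sqrt (\<Sum>n. (a (n + k))\<^sup>2)" for k
  have \<epsilon>0: "\<epsilon> k \<ge> 0" for k
    unfolding \<epsilon>_def by (intro real_sqrt_ge_zero suminf_nonneg summable_ignore_initial_segment[OF a(1)]) auto
  have \<epsilon>_lim: "\<epsilon> \<longlonglongrightarrow> 0"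
  proof -
    have "(\<lambda>k. (\<Sum>n. (a (n + k))\<^sup>2)) \<longlonglongrightarrow> 0" by (rule suminf_exist_split2[OF a(1)])
    from tendsto_real_sqrt[OF this] show ?thesis by (simp add: \<epsilon>_def[abs_def])
  qed
  define B where "B k = real k * e k + H * \<epsilon> k" for k
  have B0: "B k \<ge> 0" for k using e[of k] H0 \<epsilon>0[of k] by (simp add: B_def)
  have B_lim: "B \<longlonglongrightarrow> 0"
  proof -
    have "(\<lambda>k. real k * e k) \<longlonglongrightarrow> 0" unfolding e_def by real_asymp
    then have "(\<lambda>k. real k * e k + H * \<epsilon> k) \<longlonglongrightarrow> 0 + H * 0" by (intro tendsto_intros \<epsilon>_lim)
    then show ?thesis by (simp add: B_def[abs_def])
  qed
  let ?N = "\<lambda>k t. hnorm lam \<phi> (- \<sigma>) (\<lambda>v. f t v - g k t v)"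
  let ?d = "\<lambda>k t n. p n * norm (F n t - s k n t)"
  have N_le: "?N k t \<le> (\<Sum>n<k. ?d k t n) + h t * \<epsilon> k" if "t \<in> S" for k t
    unfolding \<epsilon>_def
    by (rule hnorm_head_tail[OF a(1) h(2)[OF that]])
       (use bound[OF that] in \<open>auto simp: g_basis F_def p_def\<close>)
  have d_int: "integrable M (\<lambda>t. (\<Sum>n<k. ?d k t n) + h t * \<epsilon> k)" for k
    using F s h by (auto simp: M_def[symmetric])
  have d_le: "(LINT t|M. (\<Sum>n<k. ?d k t n) + h t * \<epsilon> k) \<le> B k" for k
  proof -
    have "(LINT t|M. (\<Sum>n<k. ?d k t n) + h t * \<epsilon> k) = (\<Sum>n<k. p n * (LINT t|M. norm (F n t - s k n t))) + H * \<epsilon> k"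
      using F s h by (subst Bochner_Integration.integral_add) (auto simp: M_def[symmetric] H_def)
    also have "(\<Sum>n<k. p n * (LINT t|M. norm (F n t - s k n t))) \<le> (\<Sum>n<k. e k)"
    proof (rule sum_mono)
      fix n
      show "p n * (LINT t|M. norm (F n t - s k n t)) \<le> e k"
        using mult_left_mono[OF s(3)[where n = n and k = k], of "p n"] p[of n] by simp
    qed
    finally show ?thesis by (simp add: B_def)
  qed
  have 1: "(\<lambda>k. \<integral>\<^sup>+t. ennreal (?N k t) \<partial>M) \<longlonglongrightarrow> 0"
  proof (rule tendsto_sandwich[where f = "\<lambda>_. 0" and h = "\<lambda>k. ennreal (B k)"])
    show "\<forall>\<^sub>F k in sequentially. (\<integral>\<^sup>+t. ennreal (?N k t) \<partial>M) \<le> ennreal (B k)"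
    proof (intro always_eventually allI)
      fix k
      have "(\<integral>\<^sup>+t. ennreal (?N k t) \<partial>M) \<le> (\<integral>\<^sup>+t. ennreal ((\<Sum>n<k. ?d k t n) + h t * \<epsilon> k) \<partial>M)"
        by (intro nn_integral_mono ennreal_leI N_le) (simp add: sp)
      also have "\<dots> = ennreal (LINT t|M. (\<Sum>n<k. ?d k t n) + h t * \<epsilon> k)"
      proof (intro nn_integral_eq_integral d_int AE_I2 add_nonneg_nonneg sum_nonneg)
        fix t assume "t \<in> space M"
        then show "0 \<le> h t * \<epsilon> k" using h(2)[of t] \<epsilon>0[of k] by (simp add: sp)
      qed (use p in \<open>auto intro!: mult_nonneg_nonneg simp: less_imp_le\<close>)
      also have "\<dots> \<le> ennreal (B k)" by (intro ennreal_leI d_le)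
      finally show "(\<integral>\<^sup>+t. ennreal (?N k t) \<partial>M) \<le> ennreal (B k)" .
    qed
    show "(\<lambda>k. ennreal (B k)) \<longlonglongrightarrow> 0" using tendsto_ennrealI[OF B_lim] by simp
  qed auto
  have 2: "(\<lambda>t. ?N k t) \<in> borel_measurable M" for k
    unfolding hnorm_def g_basis F_def[symmetric] by measurable
  let ?R = "\<lambda>k v. (\<Sum>y\<in>g k ` S. complex_of_real (measure M {t\<in>S. g k t = y}) * y v) - w v"
  have 3: "(\<lambda>k. hnorm lam \<phi> (- \<sigma>) (?R k)) \<longlonglongrightarrow> 0"
  proof (rule tendsto_sandwich[where f = "\<lambda>_. 0" and h = B])
    have R: "?R k (\<phi> n) = (if n < k then (LINT t|M. s k n t) else 0) - w (\<phi> n)" for k n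
    proof -
      have "(\<Sum>y\<in>g k ` S. complex_of_real (measure M {t\<in>S. g k t = y}) * y (\<phi> n)) = (LINT t|M. g k t (\<phi> n))"
        using simple_function_integral_eval[OF fin g_simple[of k], of "\<lambda>y. y (\<phi> n)"]
        by (simp add: has_bochner_integral_iff sp)
      then show ?thesis by (simp add: g_basis)
    qed
    have le: "hnorm lam \<phi> (- \<sigma>) (?R k) \<le> (\<Sum>n<k. e k) + H * sqrt (\<Sum>n. (a (n + k))\<^sup>2)"
      and ws: "wsum lam (- \<sigma>) (\<lambda>n. ?R k (\<phi> n))" for k
    proof -
      have d: "lam n powr (- \<sigma>) * cmod (?R k (\<phi> n)) \<le> e k" if "n < k" for n
      proof -
        have "cmod (?R k (\<phi> n)) = cmod (LINT t|M. F n t - s k n t)"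
          unfolding R using that F s by (simp add: norm_minus_commute)
        also have "\<dots> \<le> (LINT t|M. norm (F n t - s k n t))" by (rule integral_norm_bound)
        also have "\<dots> \<le> e k / p n" by (rule s)
        finally have "p n * cmod (?R k (\<phi> n)) \<le> p n * (e k / p n)" using p[of n] by (intro mult_left_mono) auto
        then show ?thesis using p[of n] by (simp add: p_def[symmetric])
      qed
      have t: "lam n powr (- \<sigma>) * cmod (?R k (\<phi> n)) \<le> a n * H" if "n \<ge> k" for n
      proof -
        have "cmod (?R k (\<phi> n)) \<le> (LINT t|M. norm (F n t))"
          unfolding R unfolding F(2)[symmetric] using that integral_norm_bound[of M "F n"] by simp
        then have "p n * cmod (?R k (\<phi> n)) \<le> p n * (LINT t|M. norm (F n t))" using p[of n] by (intro mult_left_mono) auto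
        also have "\<dots> = (LINT t|M. p n * norm (F n t))" by simp
        also have "\<dots> \<le> (LINT t|M. a n * h t)"
        proof (rule integral_mono)
          show "integrable M (\<lambda>t. p n * norm (F n t))" by (intro integrable_mult_right integrable_norm F)
          show "integrable M (\<lambda>t. a n * h t)" unfolding M_def by (intro integrable_mult_right h)
        qed (use bound in \<open>auto simp: sp F_def p_def\<close>)
        finally show ?thesis by (simp add: H_def p_def)
      qed
      show "hnorm lam \<phi> (- \<sigma>) (?R k) \<le> (\<Sum>n<k. e k) + H * sqrt (\<Sum>n. (a (n + k))\<^sup>2)"
        by (rule hnorm_head_tail[OF a(1) H0]) (use d t in auto)
      show "wsum lam (- \<sigma>) (\<lambda>n. ?R k (\<phi> n))"
        by (rule hnorm_head_tail(2)[OF a(1) H0]) (use d t in auto)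
    qed
    show "\<forall>\<^sub>F k in sequentially. 0 \<le> hnorm lam \<phi> (- \<sigma>) (?R k)"
      by (intro always_eventually allI hnorm_nonneg ws)
    show "\<forall>\<^sub>F k in sequentially. hnorm lam \<phi> (- \<sigma>) (?R k) \<le> B k"
      using le by (simp add: B_def \<epsilon>_def)
  qed (use B_lim in auto)
  show ?thesis
    unfolding has_bochner_hdual_def M_def[symmetric]
    by (intro conjI ballI allI exI[of _ g] f w g_simple g_hdual 1 2 3)
qed

text \<open>A weighted coefficient is at most the norm, so convergence in the mean passes to each
  coefficient. The definition grants measurability only of the norms of \<open>f t - g k t\<close>;
  the coefficient of \<open>f\<close> becomes measurable as an almost-everywhere limit of simple
  functions along a subsequence.\<close>

lemma has_bochner_hdualD:
  assumes S: "S \<in> lmeasurable" and B: "has_bochner_hdual lam \<phi> \<sigma> S f w"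
  shows "has_bochner_integral (lebesgue_on S) (\<lambda>t. f t (\<phi> n)) (w (\<phi> n))"
proof -
  define M where "M = lebesgue_on S"
  have sp: "space M = S" by (simp add: M_def)
  have fin: "finite_measure M" unfolding M_def by (rule finite_measure_lebesgue_on[OF S])
  have compl: "complete_measure M"
    unfolding M_def using S by (intro complete_measure_lebesgue_on) auto
  let ?N = "\<lambda>g k t. hnorm lam \<phi> (- \<sigma>) (\<lambda>v. f t v - g k t v)"
  let ?R = "\<lambda>g k v. (\<Sum>y\<in>g k ` S. complex_of_real (measure M {t\<in>S. g k t = y}) * y v) - w v"
  note D = B[unfolded has_bochner_hdual_def, folded M_def]
  have f: "f t \<in> hdual lam \<phi> \<sigma>" if "t \<in> S" for t using conjunct1[OF D] that by (rule bspec)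
  have w: "w \<in> hdual lam \<phi> \<sigma>" using D by (elim conjE)
  obtain g :: "nat \<Rightarrow> real \<Rightarrow> 'h \<Rightarrow> complex" where g0: "(\<forall>k. simple_function M (g k)) \<and>
      (\<forall>k. \<forall>t\<in>S. g k t \<in> hdual lam \<phi> \<sigma>) \<and>
      (\<forall>k. (\<lambda>t. ?N g k t) \<in> borel_measurable M) \<and>
      (\<lambda>k. \<integral>\<^sup>+ t. ennreal (?N g k t) \<partial>M) \<longlonglongrightarrow> 0 \<and>
      (\<lambda>k. hnorm lam \<phi> (- \<sigma>) (?R g k)) \<longlonglongrightarrow> 0"
    using conjunct2[OF conjunct2[OF D]] by (rule exE)
  have lim: "(\<lambda>k. \<integral>\<^sup>+ t. ennreal (?N g k t) \<partial>M) \<longlonglongrightarrow> 0"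
    using g0 by (elim conjE)
  have lim2: "(\<lambda>k. hnorm lam \<phi> (- \<sigma>) (?R g k)) \<longlonglongrightarrow> 0"
    using g0 by (elim conjE)
  have g: "simple_function M (g k)" "t \<in> S \<Longrightarrow> g k t \<in> hdual lam \<phi> \<sigma>" for k t
    using g0[THEN conjunct1, rule_format, of k] g0[THEN conjunct2, THEN conjunct1, rule_format, of t k] by auto
  have meas: "(\<lambda>t. ?N g k t) \<in> borel_measurable M" for k
    by (rule g0[THEN conjunct2, THEN conjunct2, THEN conjunct1, THEN spec])
  note [measurable] = meas
  define p where "p = lam n powr (- \<sigma>)"
  have p: "p > 0" using lam_pos[of n] by (simp add: p_def)
  have ws: "wsum lam (- \<sigma>) (\<lambda>n. f t (\<phi> n) - g k t (\<phi> n))" if "t \<in> S" for t k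
    by (intro wsum_diff hdual_wsum f g that)
  have N0: "0 \<le> ?N g k t" if "t \<in> S" for k t by (rule hnorm_nonneg) (rule ws[OF that])
  have le: "p * cmod (f t (\<phi> n) - g k t (\<phi> n)) \<le> ?N g k t" if "t \<in> S" for k t
    unfolding p_def using coeff_le_hnorm[where f = "\<lambda>v. f t v - g k t v", OF ws[OF that]] .
  have G: "has_bochner_integral M (\<lambda>t. g k t (\<phi> n)) (?R g k (\<phi> n) + w (\<phi> n))" for k
    using simple_function_integral_eval[OF fin g(1)[of k], of "\<lambda>y. y (\<phi> n)"] by (simp add: sp)
  have Gi: "integrable M (\<lambda>t. g k t (\<phi> n))" for k using G[of k] by (simp add: has_bochner_integral_iff)
  \<comment> \<open>The mean distances may be infinite at first; the sequence is used only from
    \<open>K\<close> on, where they are finite.\<close>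
  obtain K where K: "\<And>k. k \<ge> K \<Longrightarrow> (\<integral>\<^sup>+ t. ennreal (?N g k t) \<partial>M) < 1"
    using order_tendstoD(2)[OF lim, of 1] by (auto simp: eventually_sequentially)
  define u where "u k t = ?N g (k + K) t" for k t
  have u: "integrable M (u k)" for k
    unfolding u_def using K[of "k + K"] N0
    by (intro integrableI_nonneg meas AE_I2) (auto simp: sp less_top[symmetric] top_unique)
  have u_nn: "(\<integral>\<^sup>+ t. ennreal (?N g (k + K) t) \<partial>M) = ennreal (LINT t|M. u k t)" for k
    unfolding u_def by (intro nn_integral_eq_integral u[unfolded u_def] AE_I2 N0) (simp add: sp)
  have u_int0: "0 \<le> (LINT t|M. u k t)" for k
    by (intro integral_nonneg_AE AE_I2) (simp add: u_def N0 sp)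
  have u_lim: "(\<lambda>k. LINT t|M. u k t) \<longlonglongrightarrow> 0"
  proof -
    have "(\<lambda>k. ennreal (LINT t|M. u k t)) \<longlonglongrightarrow> ennreal 0"
      unfolding u_nn[symmetric] using LIMSEQ_ignore_initial_segment[OF lim] by simp
    then show ?thesis by (subst (asm) tendsto_ennreal_iff) (use u_int0 in auto)
  qed
  have u_norm: "(LINT t|M. norm (u k t)) = (LINT t|M. u k t)" for k
    by (rule Bochner_Integration.integral_cong) (auto simp: u_def N0 sp)
  obtain r where r: "strict_mono r" "AE t in M. (\<lambda>k. u (r k) t) \<longlonglongrightarrow> 0"
    using tendsto_L1_AE_subseq[of M u, OF u] u_lim unfolding u_norm by auto
  define G' where "G' k t = g (r k + K) t (\<phi> n)" for k t
  have [measurable]: "G' k \<in> borel_measurable M" for k using Gi unfolding G'_def by auto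
  have "AE t in M. lim (\<lambda>k. G' k t) = f t (\<phi> n)"
    using r(2)
  proof (rule AE_mp, intro AE_I2 impI)
    fix t assume t: "t \<in> space M" and ut: "(\<lambda>k. u (r k) t) \<longlonglongrightarrow> 0"
    have "(\<lambda>k. G' k t - f t (\<phi> n)) \<longlonglongrightarrow> 0"
    proof (rule tendsto_0_le[OF ut, of _ "1 / p"])
      show "\<forall>\<^sub>F k in sequentially. norm (G' k t - f t (\<phi> n)) \<le> norm (u (r k) t) * (1 / p)"
      proof (intro always_eventually allI)
        fix k
        have "p * cmod (G' k t - f t (\<phi> n)) \<le> u (r k) t"
          using le[of t "r k + K"] t by (simp add: sp G'_def u_def norm_minus_commute)
        also have "\<dots> \<le> norm (u (r k) t)" by simp
        finally show "norm (G' k t - f t (\<phi> n)) \<le> norm (u (r k) t) * (1 / p)"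
          using p by (simp add: field_simps)
      qed
    qed
    then show "lim (\<lambda>k. G' k t) = f t (\<phi> n)" by (intro limI) (simp add: LIM_zero_iff)
  qed
  then have fm[measurable]: "(\<lambda>t. f t (\<phi> n)) \<in> borel_measurable M"
    by (rule borel_measurable_complete_AE[OF compl, rotated]) measurable
  have diff: "integrable M (\<lambda>t. f t (\<phi> n) - g (k + K) t (\<phi> n))"
    and diff_le: "norm (LINT t|M. f t (\<phi> n) - g (k + K) t (\<phi> n)) \<le> (LINT t|M. u k t) / p" for k
  proof -
    have b: "norm (f t (\<phi> n) - g (k + K) t (\<phi> n)) \<le> u k t / p" if "t \<in> space M" for t
      using le[of t "k + K"] that p by (simp add: sp u_def field_simps)
    have ui: "integrable M (\<lambda>t. u k t / p)" using u by simp
    have [measurable]: "(\<lambda>t. g (k + K) t (\<phi> n)) \<in> borel_measurable M" using Gi by auto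
    show i: "integrable M (\<lambda>t. f t (\<phi> n) - g (k + K) t (\<phi> n))"
    proof (rule Bochner_Integration.integrable_bound[OF ui])
      show "AE t in M. norm (f t (\<phi> n) - g (k + K) t (\<phi> n)) \<le> norm (u k t / p)"
      proof (rule AE_I2)
        fix t assume "t \<in> space M"
        then show "norm (f t (\<phi> n) - g (k + K) t (\<phi> n)) \<le> norm (u k t / p)"
          using b[of t] abs_ge_self[of "u k t / p"] unfolding real_norm_def by linarith
      qed
    qed measurable
    show "norm (LINT t|M. f t (\<phi> n) - g (k + K) t (\<phi> n)) \<le> (LINT t|M. u k t) / p"
      using Bochner_Integration.integral_norm_bound_integral[OF i ui b] by simp
  qed
  have fi: "integrable M (\<lambda>t. f t (\<phi> n))"
    using Bochner_Integration.integrable_add[OF diff[of 0] Gi[of "0 + K"]] by simp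
  have "norm ((LINT t|M. f t (\<phi> n)) - w (\<phi> n)) \<le> (LINT t|M. u k t) / p + hnorm lam \<phi> (- \<sigma>) (?R g (k + K)) / p" for k
  proof -
    have "p * norm (?R g (k + K) (\<phi> n)) \<le> hnorm lam \<phi> (- \<sigma>) (?R g (k + K))"
      unfolding p_def
    proof (rule coeff_le_hnorm[where f = "?R g (k + K)"])
      show "wsum lam (- \<sigma>) (\<lambda>n. ?R g (k + K) (\<phi> n))"
        by (intro wsum_diff wsum_sum wsum_mult hdual_wsum w) (auto intro: g)
    qed
    then have R: "norm (?R g (k + K) (\<phi> n)) \<le> hnorm lam \<phi> (- \<sigma>) (?R g (k + K)) / p"
      using p by (simp add: field_simps)
    have "(LINT t|M. f t (\<phi> n)) - w (\<phi> n) = (LINT t|M. f t (\<phi> n) - g (k + K) t (\<phi> n)) + ?R g (k + K) (\<phi> n)"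
      using G[of "k + K"] fi by (simp add: has_bochner_integral_iff)
    also have "norm \<dots> \<le> (LINT t|M. u k t) / p + hnorm lam \<phi> (- \<sigma>) (?R g (k + K)) / p"
      by (rule norm_triangle_mono[OF diff_le R])
    finally show ?thesis .
  qed
  moreover have "(\<lambda>k. (LINT t|M. u k t) / p + hnorm lam \<phi> (- \<sigma>) (?R g (k + K)) / p) \<longlonglongrightarrow> 0 / p + 0 / p"
    by (intro tendsto_intros u_lim LIMSEQ_ignore_initial_segment[OF lim2]) (use p in auto)
  ultimately have "norm ((LINT t|M. f t (\<phi> n)) - w (\<phi> n)) \<le> 0 / p + 0 / p"
    by (intro tendsto_lowerbound[where F = sequentially]) auto
  then show ?thesis using fi by (simp add: has_bochner_integral_iff M_def)
qed

end

subsection \<open>Uniqueness\<close>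

lemma AE_lebesgue_on_subset:
  assumes "AE x in lebesgue_on T. P x" "S \<subseteq> T" "S \<in> sets lebesgue" "T \<in> sets lebesgue"
  shows "AE x in lebesgue_on S. P x"
proof -
  have "AE x in lebesgue. x \<in> T \<longrightarrow> P x"
    using assms(1,4) by (simp add: AE_restrict_space_iff)
  then have "AE x in lebesgue. x \<in> S \<longrightarrow> P x"
    by eventually_elim (use assms(2) in auto)
  then show ?thesis using assms(3) by (simp add: AE_restrict_space_iff)
qed

lemma AE_lebesgue_on_witness:
  fixes a b c :: real
  assumes "AE x in lebesgue_on {a<..<b}. P x" "a \<le> c" "c < b"
  shows "\<exists>x\<in>{c<..<b}. P x"
proof (rule ccontr)
  assume *: "\<not> (\<exists>x\<in>{c<..<b}. P x)"
  have "AE x in lebesgue. x \<in> {a<..<b} \<longrightarrow> P x"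
    using assms(1) by (simp add: AE_restrict_space_iff)
  then have "AE x in lebesgue. x \<notin> {c<..<b}"
    by eventually_elim (use * assms(2) in auto)
  then have "{c<..<b} \<in> null_sets lebesgue" by (simp add: AE_iff_null_sets)
  then show False using assms(3) by (auto simp: null_sets_def)
qed

lemma integrable_lebesgue_on_subset:
  fixes f :: "real \<Rightarrow> complex"
  assumes "integrable (lebesgue_on T) f" "S \<subseteq> T" "S \<in> sets lebesgue" "T \<in> sets lebesgue"
  shows "integrable (lebesgue_on S) f"
proof -
  have "set_integrable lebesgue T f"
    using assms by (simp add: set_integrable_def integrable_restrict_space)
  then have "set_integrable lebesgue S f" by (rule set_integrable_subset) (use assms in auto)
  then show ?thesis using assms by (simp add: set_integrable_def integrable_restrict_space)
qed

text \<open>Time derivatives are specified on compact subintervals of the open time interval. An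
  integrable majorant allows the lower end to tend to \<open>0\<close> by dominated
  convergence.\<close>

lemma integral_exhaust:
  fixes f :: "real \<Rightarrow> complex" and g :: "real \<Rightarrow> real"
  assumes b: "0 < b"
    and int: "\<And>a. 0 < a \<Longrightarrow> a \<le> b \<Longrightarrow> integrable (lebesgue_on {a..b}) f"
    and g: "integrable (lebesgue_on {0<..b}) g" and le: "\<And>r. r \<in> {0<..b} \<Longrightarrow> norm (f r) \<le> g r"
  shows "integrable (lebesgue_on {0<..<b}) f"
    and "(\<lambda>k. LINT r|lebesgue_on {b / real (k + 2)..b}. f r) \<longlonglongrightarrow> (LINT r|lebesgue_on {0<..<b}. f r)"
proof -
  let ?S = "\<lambda>k::nat. {b / real (k + 2)..b}"
  let ?F = "\<lambda>k r. indicat_real (?S k) r *\<^sub>R f r"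
  let ?G = "\<lambda>r. indicat_real {0<..b} r *\<^sub>R f r"
  have Sk: "0 < b / real (k + 2)" "b / real (k + 2) \<le> b" for k
    using b by (auto simp: field_simps)
  have Fi: "integrable lebesgue (?F k)" for k
    using int[OF Sk] by (simp add: integrable_restrict_space)
  have gi: "integrable lebesgue (\<lambda>r. indicat_real {0<..b} r *\<^sub>R g r)"
    using g by (simp add: integrable_restrict_space)
  have conv: "(\<lambda>k. ?F k r) \<longlonglongrightarrow> ?G r" for r
  proof (rule Lim_transform_eventually[OF tendsto_const])
    show "\<forall>\<^sub>F k in sequentially. ?G r = ?F k r"
    proof (cases "r \<in> {0<..b}")
      case True
      have "(\<lambda>k. b / real (k + 2)) \<longlonglongrightarrow> 0" by real_asymp
      then have "\<forall>\<^sub>F k in sequentially. b / real (k + 2) < r"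
        using True by (intro order_tendstoD) auto
      then show ?thesis by eventually_elim (use True in \<open>auto simp: indicator_def\<close>)
    next
      case False
      then have "r \<notin> ?S k" for k using Sk(1)[of k] by auto
      then show ?thesis using False by simp
    qed
  qed
  have bd: "norm (?F k r) \<le> indicat_real {0<..b} r *\<^sub>R g r" for k r
    using le[of r] Sk(1)[of k] norm_ge_zero[of "f r"] by (auto simp: indicator_def simp del: norm_ge_zero)
  have Gm: "?G \<in> borel_measurable lebesgue"
    by (rule borel_measurable_LIMSEQ_metric[OF _ conv]) (use Fi in auto)
  have Gi: "integrable lebesgue ?G" and lim: "(\<lambda>k. integral\<^sup>L lebesgue (?F k)) \<longlonglongrightarrow> integral\<^sup>L lebesgue ?G"
  proof -
    have Fm: "?F k \<in> borel_measurable lebesgue" for k by (rule borel_measurable_integrable[OF Fi])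
    show "integrable lebesgue ?G"
      by (rule integrable_dominated_convergence[OF Gm Fm gi AE_I2[OF conv] AE_I2[OF bd]])
    show "(\<lambda>k. integral\<^sup>L lebesgue (?F k)) \<longlonglongrightarrow> integral\<^sup>L lebesgue ?G"
      by (rule integral_dominated_convergence[OF Gm Fm gi AE_I2[OF conv] AE_I2[OF bd]])
  qed
  have ae: "AE r in lebesgue. ?G r = indicat_real {0<..<b} r *\<^sub>R f r"
  proof (rule AE_I')
    show "{b} \<in> null_sets lebesgue" by (intro null_sets_completionI finite_imp_null_set_lborel) auto
  qed (auto simp: indicator_def)
  have hb: "has_bochner_integral lebesgue ?G (integral\<^sup>L lebesgue ?G)"
    using Gi by (rule has_bochner_integral_integrable)
  have "(\<lambda>r. indicat_real {0<..<b} r *\<^sub>R f r) \<in> borel_measurable lebesgue"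
    by (rule borel_measurable_complete_AE[OF _ Gm ae]) (rule completion.complete_measure_axioms)
  from has_bochner_integral_cong_AE[OF Gm this ae, THEN iffD1, OF hb]
  have "has_bochner_integral lebesgue (\<lambda>r. indicat_real {0<..<b} r *\<^sub>R f r) (integral\<^sup>L lebesgue ?G)" .
  then show "integrable (lebesgue_on {0<..<b}) f"
    and "(\<lambda>k. LINT r|lebesgue_on {b / real (k + 2)..b}. f r) \<longlonglongrightarrow> (LINT r|lebesgue_on {0<..<b}. f r)"
    using lim by (auto simp: has_bochner_integral_iff integrable_restrict_space integral_restrict_space)
qed

lemma frac_int_1: "frac_int 1 f t = (LINT r|lebesgue_on {0<..<t}. f r)"
  unfolding frac_int_def by (rule Bochner_Integration.integral_cong) auto

lemma primitive_from_zero: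
  fixes F f :: "real \<Rightarrow> complex"
  assumes der: "\<And>a b. 0 < a \<Longrightarrow> a \<le> b \<Longrightarrow> b < T \<Longrightarrow> has_bochner_integral (lebesgue_on {a..b}) f (F b - F a)"
    and lim: "(F \<longlongrightarrow> F0) (at_right 0)"
    and b: "0 < b" "b < T" and g: "integrable (lebesgue_on {0<..b}) g" and le: "\<And>r. r \<in> {0<..b} \<Longrightarrow> norm (f r) \<le> g r"
  shows "integrable (lebesgue_on {0<..<b}) f" "F b = F0 + frac_int 1 f b"
proof -
  have int: "integrable (lebesgue_on {a..b}) f" if "0 < a" "a \<le> b" for a
    using der[OF that b(2)] by (simp add: has_bochner_integral_iff)
  note ex = integral_exhaust[OF b(1) int g le]
  show "integrable (lebesgue_on {0<..<b}) f" by (rule ex(1))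
  have "(\<lambda>k. F (b / real (k + 2))) \<longlonglongrightarrow> F0"
  proof (rule filterlim_compose[OF lim])
    show "filterlim (\<lambda>k. b / real (k + 2)) (at_right 0) sequentially"
      using b(1) by real_asymp
  qed
  then have "(\<lambda>k. F b - F (b / real (k + 2))) \<longlonglongrightarrow> F b - F0" by (intro tendsto_intros)
  also have "(\<lambda>k. F b - F (b / real (k + 2))) = (\<lambda>k. LINT r|lebesgue_on {b / real (k + 2)..b}. f r)"
  proof
    fix k
    have "0 < b / real (k + 2)" "b / real (k + 2) \<le> b" using b by (auto simp: field_simps)
    from der[OF this b(2)] show "F b - F (b / real (k + 2)) = (LINT r|lebesgue_on {b / real (k + 2)..b}. f r)"
      by (simp add: has_bochner_integral_iff)
  qed
  finally have "F b - F0 = (LINT r|lebesgue_on {0<..<b}. f r)"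
    by (rule LIMSEQ_unique[OF _ ex(2)])
  then show "F b = F0 + frac_int 1 f b" by (simp add: frac_int_1 algebra_simps)
qed

text \<open>Applying \<open>frac_int \<alpha>\<close> to the equation for
  \<open>frac_int (2 - \<alpha>) q\<close> produces \<open>frac_int 2 q\<close>, with the factor
  \<open>Beta \<alpha> (2 - \<alpha>) = Gamma \<alpha> * Gamma (2 - \<alpha>)\<close>. On the other
  hand \<open>frac_int 2 q\<close> is \<open>w\<close> minus its affine part, by integrating twice
  from \<open>0\<close>.\<close>

lemma caputo_volterra:
  fixes w p q :: "real \<Rightarrow> complex"
  assumes \<alpha>: "1 < \<alpha>" "\<alpha> < 2" and wc: "continuous_on {0..T} w"
    and wp: "\<And>a b. 0 < a \<Longrightarrow> a \<le> b \<Longrightarrow> b < T \<Longrightarrow> has_bochner_integral (lebesgue_on {a..b}) p (w b - w a)"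
    and pq: "\<And>a b. 0 < a \<Longrightarrow> a \<le> b \<Longrightarrow> b < T \<Longrightarrow> has_bochner_integral (lebesgue_on {a..b}) q (p b - p a)"
    and w0: "(w \<longlongrightarrow> x) (at_right 0)" and p0: "(p \<longlongrightarrow> y) (at_right 0)"
    and cap: "AE t in lebesgue_on {0<..<T}.
       integrable (lebesgue_on {0<..<t}) (\<lambda>r. of_real ((t - r) powr (1 - \<alpha>)) * q r) \<and>
       frac_int (2 - \<alpha>) q t = of_real (Gamma (2 - \<alpha>)) * (c * w t)"
    and b: "b \<in> {0<..<T}"
  shows "w b = x + of_real b * y + c / of_real (Gamma \<alpha>) * frac_int \<alpha> w b"
proof -
  have b': "0 < b" "b < T" using b by auto
  \<comment> \<open>Integrability up to \<open>0\<close> is drawn from one Caputo integral at a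
    later time \<open>t'\<close>: on \<open>{0<..t}\<close> its kernel
    \<open>(t' - r) powr (1 - \<alpha>)\<close> is bounded below by
    \<open>t' powr (1 - \<alpha>)\<close> and can be divided out.\<close>
  have qi: "integrable (lebesgue_on {0<..t}) q" if t: "0 < t" "t < T" for t
  proof -
    obtain t' where t': "t' \<in> {t<..<T}" "integrable (lebesgue_on {0<..<t'}) (\<lambda>r. of_real ((t' - r) powr (1 - \<alpha>)) * q r)"
      using AE_lebesgue_on_witness[OF cap less_imp_le[OF t(1)] t(2)] by blast
    have i: "integrable (lebesgue_on {0<..t}) (\<lambda>r. of_real ((t' - r) powr (1 - \<alpha>)) * q r)"
      by (rule integrable_lebesgue_on_subset[OF t'(2)]) (use t' that in auto)
    show ?thesis
    proof (rule Bochner_Integration.integrable_bound)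
      show "integrable (lebesgue_on {0<..t}) (\<lambda>r. of_real (t' powr (\<alpha> - 1)) * (of_real ((t' - r) powr (1 - \<alpha>)) * q r))"
        using i by simp
      have eq: "of_real ((t' - r) powr (\<alpha> - 1)) * (of_real ((t' - r) powr (1 - \<alpha>)) * q r) = q r" if "r \<in> {0<..t}" for r
      proof -
        have "(t' - r) powr (\<alpha> - 1) * (t' - r) powr (1 - \<alpha>) = 1" using that t' by (simp add: powr_add[symmetric])
        then show ?thesis by (simp only: mult.assoc[symmetric] of_real_mult[symmetric]) simp
      qed
      have [measurable]: "(\<lambda>r. r) \<in> borel_measurable (lebesgue_on {0<..t})" by (rule measurable_lebesgue_on_borel)
      have [measurable]: "(\<lambda>r. of_real ((t' - r) powr (1 - \<alpha>)) * q r) \<in> borel_measurable (lebesgue_on {0<..t})" using i by auto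
      have "(\<lambda>r. of_real ((t' - r) powr (\<alpha> - 1)) * (of_real ((t' - r) powr (1 - \<alpha>)) * q r)) \<in> borel_measurable (lebesgue_on {0<..t})"
        by measurable
      then show "q \<in> borel_measurable (lebesgue_on {0<..t})"
        by (rule measurable_cong[THEN iffD1, rotated]) (simp add: eq)
      show "AE r in lebesgue_on {0<..t}. norm (q r) \<le> norm (of_real (t' powr (\<alpha> - 1)) * (of_real ((t' - r) powr (1 - \<alpha>)) * q r))"
      proof (rule AE_I2)
        fix r assume "r \<in> space (lebesgue_on {0<..t})"
        then have r: "r \<in> {0<..t}" by simp
        have "norm (q r) = (t' - r) powr (\<alpha> - 1) * norm (of_real ((t' - r) powr (1 - \<alpha>)) * q r)"
          by (subst eq[OF r, symmetric], subst norm_mult) simp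
        also have "\<dots> \<le> t' powr (\<alpha> - 1) * norm (of_real ((t' - r) powr (1 - \<alpha>)) * q r)"
          using r t' \<alpha> by (intro mult_right_mono powr_mono2) auto
        finally show "norm (q r) \<le> norm (of_real (t' powr (\<alpha> - 1)) * (of_real ((t' - r) powr (1 - \<alpha>)) * q r))"
          by (simp add: norm_mult)
      qed
    qed
  qed
  have qi': "integrable (lebesgue_on {0<..<b}) q"
    by (rule integrable_lebesgue_on_subset[OF qi[OF b']]) auto
  have p_eq: "p t = y + frac_int 1 q t" if "0 < t" "t < T" for t
    by (rule primitive_from_zero(2)[OF pq p0 that integrable_norm[OF qi[OF that]]]) auto
  \<comment> \<open>A constant majorant, so that \<open>primitive_from_zero\<close> applies a second
    time, now to \<open>w\<close>.\<close>
  have p_bd: "norm (p r) \<le> norm y + (LINT s|lebesgue_on {0<..b}. norm (q s))" if r: "r \<in> {0<..b}" for r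
  proof -
    have "norm (frac_int 1 q r) \<le> (LINT s|lebesgue_on {0<..<r}. norm (q s))"
      unfolding frac_int_1 by (rule integral_norm_bound)
    also have "\<dots> = (LINT s|lebesgue. indicat_real {0<..<r} s *\<^sub>R norm (q s))"
      by (simp add: integral_restrict_space)
    also have "\<dots> \<le> (LINT s|lebesgue. indicat_real {0<..b} s *\<^sub>R norm (q s))"
    proof (rule integral_mono)
      have "integrable (lebesgue_on {0<..<r}) q"
        by (rule integrable_lebesgue_on_subset[OF qi[OF b']]) (use r in auto)
      then show "integrable lebesgue (\<lambda>s. indicat_real {0<..<r} s *\<^sub>R norm (q s))"
        by (subst integrable_restrict_space[symmetric]) auto
      show "integrable lebesgue (\<lambda>s. indicat_real {0<..b} s *\<^sub>R norm (q s))"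
        using qi[OF b'] by (subst integrable_restrict_space[symmetric]) auto
    qed (use r in \<open>auto simp: indicator_def\<close>)
    also have "\<dots> = (LINT s|lebesgue_on {0<..b}. norm (q s))"
      by (simp add: integral_restrict_space)
    finally show ?thesis
      using p_eq[of r] r b' norm_triangle_ineq[of y "frac_int 1 q r"] by auto
  qed
  have c_int: "integrable (lebesgue_on {0<..b}) (\<lambda>r. norm y + (LINT s|lebesgue_on {0<..b}. norm (q s)))"
  proof -
    interpret finite_measure "lebesgue_on {0<..b}"
      by (rule finite_measure_lebesgue_on, rule bounded_set_imp_lmeasurable, rule bounded_subset[of "{0..b}"]) auto
    show ?thesis by simp
  qed
  have G2: "Gamma (2 :: real) = 1" using Gamma_fact[of 1, where 'a = real] by simp
  note pw = primitive_from_zero[OF wp w0 b' c_int p_bd]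
  interpret fb: finite_measure "lebesgue_on {0<..<b}" by (rule finite_measure_lebesgue_on) auto
  have mb: "measure (lebesgue_on {0<..<b}) {0<..<b} = b"
    using b' by (simp add: measure_restrict_space)
  have i1: "integrable (lebesgue_on {0<..<b}) (frac_int 1 q)"
  proof -
    have "integrable (lebesgue_on {0<..<b}) (\<lambda>r. p r - y)" using pw(1) by simp
    then show ?thesis
      by (rule Bochner_Integration.integrable_cong[THEN iffD1, rotated 2]) (use p_eq b' in auto)
  qed
  have "frac_int 1 p b = (LINT r|lebesgue_on {0<..<b}. y + frac_int 1 q r)"
    unfolding frac_int_1[of p] by (rule Bochner_Integration.integral_cong) (use p_eq b' in auto)
  also have "\<dots> = of_real b * y + frac_int 1 (frac_int 1 q) b"
    using i1 mb by (simp add: frac_int_1[of "frac_int 1 q"] scaleR_conv_of_real)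
  also have "frac_int 1 (frac_int 1 q) b = frac_int 2 q b"
    using frac_int_frac_int[of 1 1 b q] b' qi' by (simp add: Beta_def G2)
  finally have w_eq: "w b = x + of_real b * y + frac_int 2 q b" using pw(2) by simp
  have "of_real (Gamma (2 - \<alpha>)) * (c * frac_int \<alpha> w b) = frac_int \<alpha> (frac_int (2 - \<alpha>) q) b"
  proof -
    let ?M = "lebesgue_on {0<..<b}"
    have "AE t in ?M. integrable (lebesgue_on {0<..<t}) (\<lambda>r. of_real ((t - r) powr (1 - \<alpha>)) * q r) \<and>
       frac_int (2 - \<alpha>) q t = of_real (Gamma (2 - \<alpha>)) * (c * w t)"
      by (rule AE_lebesgue_on_subset[OF cap]) (use b' in auto)
    then have ae: "AE t in ?M. of_real (Gamma (2 - \<alpha>)) * (c * w t) = frac_int (2 - \<alpha>) q t"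
      by eventually_elim simp
    have [measurable]: "w \<in> borel_measurable ?M"
      by (intro continuous_imp_measurable_on_sets_lebesgue continuous_on_subset[OF wc]) (use b' in auto)
    have [measurable]: "(\<lambda>r. r) \<in> borel_measurable ?M" by (rule measurable_lebesgue_on_borel)
    \<comment> \<open>Almost everywhere it is a multiple of the continuous \<open>w\<close>, and the
      measure is complete.\<close>
    have [measurable]: "frac_int (2 - \<alpha>) q \<in> borel_measurable ?M"
      by (rule borel_measurable_complete_AE[OF complete_measure_lebesgue_on _ ae]) auto
    have "of_real (Gamma (2 - \<alpha>)) * (c * frac_int \<alpha> w b) = (LINT r|?M. of_real ((b - r) powr (\<alpha> - 1)) * (of_real (Gamma (2 - \<alpha>)) * (c * w r)))"
      unfolding frac_int_def by (simp add: mult_ac flip: integral_mult_right_zero)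
    also have "\<dots> = frac_int \<alpha> (frac_int (2 - \<alpha>) q) b"
      unfolding frac_int_def[of \<alpha> "frac_int (2 - \<alpha>) q"]
      by (rule integral_cong_AE) (use ae in \<open>auto elim: eventually_mono\<close>)
    finally show ?thesis .
  qed
  also have "\<dots> = of_real (Gamma \<alpha> * Gamma (2 - \<alpha>)) * frac_int 2 q b"
    using frac_int_frac_int[of \<alpha> "2 - \<alpha>" b q] b' qi' \<alpha> by (simp add: Beta_def G2)
  finally have "of_real (Gamma (2 - \<alpha>)) * (c * frac_int \<alpha> w b) = of_real (Gamma \<alpha> * Gamma (2 - \<alpha>)) * frac_int 2 q b" .
  moreover have "Gamma (2 - \<alpha>) > 0" "Gamma \<alpha> > 0" using \<alpha> by (auto intro!: Gamma_real_pos)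
  ultimately have "frac_int 2 q b = c / of_real (Gamma \<alpha>) * frac_int \<alpha> w b"
    by (simp add: field_simps)
  then show ?thesis using w_eq by simp
qed

section \<open>Weak solutions mode by mode\<close>

context spectral_scale
begin

lemma basis_in_hspace: "\<phi> n \<in> hspace lam \<phi> s"
  unfolding hspace_iff wsum_def ortho by (rule summable_finite[of "{n}"]) auto

lemma norm_basis: "norm (\<phi> n) = 1"
  using cinner_self[of "\<phi> n"] by (simp add: ortho norm_eq_sqrt_cinner)

lemma op_ext_eq: "op_ext lam \<phi> u v = - coeff_fun (\<lambda>n. of_real (lam n) * cinner u (\<phi> n)) v"
  by (simp add: op_ext_def coeff_fun_def)

text \<open>The basis vector \<open>\<phi> n\<close> is an admissible test vector, since it lies in
  every space of the scale. Multiplication by \<open>ipow (- \<alpha>)\<close> isolates the Caputo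
  derivative, and \<open>caputo_volterra\<close> applies with
  \<open>c = ipow (- \<alpha>) * lam n\<close>.\<close>

lemma weak_solution_mode:
  assumes \<alpha>: "1 < \<alpha>" "\<alpha> < 2" and u1: "wsum lam (- (1 / \<alpha>)) (\<lambda>n. u1 (\<phi> n))"
    and ws: "weak_solution lam \<phi> \<alpha> T u0 u1 v" and b: "b \<in> {0<..<T}"
  shows "cinner (v b) (\<phi> n) = cinner u0 (\<phi> n) + of_real b * u1 (\<phi> n)
     + ipow (- \<alpha>) * of_real (lam n) / of_real (Gamma \<alpha>) * frac_int \<alpha> (\<lambda>t. cinner (v t) (\<phi> n)) b"
proof -
  from ws obtain v' v'' where vc: "continuous_on {0..T} v"
    and d1: "has_time_deriv lam \<phi> (2 / \<alpha>) T (\<lambda>t. cinner (v t)) v'"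
    and d2: "has_time_deriv lam \<phi> (2 / \<alpha>) T v' v''"
    and eq: "AE t in lebesgue_on {0<..<T}. \<exists>w.
           has_caputo_deriv lam \<phi> (2 / \<alpha>) \<alpha> v'' t w \<and>
           w \<in> hdual lam \<phi> (2 / \<alpha>) \<and> op_ext lam \<phi> (v t) \<in> hdual lam \<phi> (2 / \<alpha>) \<and>
           (\<forall>x\<in>hspace lam \<phi> (2 / \<alpha>). ipow \<alpha> * w x + op_ext lam \<phi> (v t) x = 0)"
    and l0: "((\<lambda>t. norm (v t - u0)) \<longlongrightarrow> 0) (at_right 0)"
    and ev: "\<forall>\<^sub>F t in at_right 0. v' t \<in> hdual lam \<phi> (1 / \<alpha>)"
    and l1: "((\<lambda>t. hnorm lam \<phi> (- (1 / \<alpha>)) (\<lambda>x. v' t x - u1 x)) \<longlongrightarrow> 0) (at_right 0)"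
    unfolding weak_solution_def by (elim conjE exE) (rule that)
  have int1: "has_bochner_hdual lam \<phi> (2 / \<alpha>) {a..b} v' (\<lambda>x. cinner (v b) x - cinner (v a) x)"
    if "0 < a" "a \<le> b" "b < T" for a b
    using conjunct2[OF d1[unfolded has_time_deriv_def], rule_format, of a b] that by simp
  have int2: "has_bochner_hdual lam \<phi> (2 / \<alpha>) {a..b} v'' (\<lambda>x. v' b x - v' a x)"
    if "0 < a" "a \<le> b" "b < T" for a b
    using conjunct2[OF d2[unfolded has_time_deriv_def], rule_format, of a b] that by simp
  show ?thesis
  proof (rule caputo_volterra[OF \<alpha> _ _ _ _ _ _ b])
    show "continuous_on {0..T} (\<lambda>t. cinner (v t) (\<phi> n))"
      by (rule bounded_linear.continuous_on[OF bounded_linear_cinner_left vc])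
    fix a b :: real assume ab: "0 < a" "a \<le> b" "b < T"
    from int1[OF ab] show "has_bochner_integral (lebesgue_on {a..b}) (\<lambda>t. v' t (\<phi> n)) (cinner (v b) (\<phi> n) - cinner (v a) (\<phi> n))"
      by (rule has_bochner_hdualD[rotated]) simp
    from int2[OF ab] show "has_bochner_integral (lebesgue_on {a..b}) (\<lambda>t. v'' t (\<phi> n)) (v' b (\<phi> n) - v' a (\<phi> n))"
      by (rule has_bochner_hdualD[rotated]) simp
  next
    have "((\<lambda>t. cinner (v t - u0) (\<phi> n)) \<longlongrightarrow> 0) (at_right 0)"
    proof (rule tendsto_0_le[OF l0, of _ 1], intro always_eventually allI)
      fix t
      show "norm (cinner (v t - u0) (\<phi> n)) \<le> norm (norm (v t - u0)) * 1"
        using cauchy_schwarz[of "v t - u0" "\<phi> n"] by (simp add: norm_basis)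
    qed
    then show "((\<lambda>t. cinner (v t) (\<phi> n)) \<longlongrightarrow> cinner u0 (\<phi> n)) (at_right 0)"
      unfolding cinner_diff_left by (rule LIM_zero_cancel)
  next
    let ?p = "lam n powr (- (1 / \<alpha>))"
    have p: "?p > 0" using lam_pos[of n] by simp
    have "((\<lambda>t. v' t (\<phi> n) - u1 (\<phi> n)) \<longlongrightarrow> 0) (at_right 0)"
    proof (rule tendsto_0_le[OF l1, of _ "1 / ?p"])
      show "\<forall>\<^sub>F t in at_right 0. norm (v' t (\<phi> n) - u1 (\<phi> n)) \<le> norm (hnorm lam \<phi> (- (1 / \<alpha>)) (\<lambda>x. v' t x - u1 x)) * (1 / ?p)"
        using ev
      proof eventually_elim
        case (elim t)
        have w: "wsum lam (- (1 / \<alpha>)) (\<lambda>n. v' t (\<phi> n) - u1 (\<phi> n))"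
          by (intro wsum_diff u1 hdual_wsum elim)
        have "?p * norm (v' t (\<phi> n) - u1 (\<phi> n)) \<le> hnorm lam \<phi> (- (1 / \<alpha>)) (\<lambda>x. v' t x - u1 x)"
          by (rule coeff_le_hnorm[where f = "\<lambda>x. v' t x - u1 x", OF w])
        also have "\<dots> \<le> norm (hnorm lam \<phi> (- (1 / \<alpha>)) (\<lambda>x. v' t x - u1 x))" by simp
        finally show ?case using p by (simp add: field_simps)
      qed
    qed
    then show "((\<lambda>t. v' t (\<phi> n)) \<longlongrightarrow> u1 (\<phi> n)) (at_right 0)" by (rule LIM_zero_cancel)
  next
    show "AE t in lebesgue_on {0<..<T}.
       integrable (lebesgue_on {0<..<t}) (\<lambda>r. of_real ((t - r) powr (1 - \<alpha>)) * v'' r (\<phi> n)) \<and>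
       frac_int (2 - \<alpha>) (\<lambda>t. v'' t (\<phi> n)) t = of_real (Gamma (2 - \<alpha>)) * (ipow (- \<alpha>) * of_real (lam n) * cinner (v t) (\<phi> n))"
      using eq
    proof eventually_elim
      case (elim t)
      then obtain w where cap: "has_caputo_deriv lam \<phi> (2 / \<alpha>) \<alpha> v'' t w"
        and "\<forall>x\<in>hspace lam \<phi> (2 / \<alpha>). ipow \<alpha> * w x + op_ext lam \<phi> (v t) x = 0"
        by (elim exE conjE)
      from this(2) basis_in_hspace have e: "ipow \<alpha> * w (\<phi> n) + op_ext lam \<phi> (v t) (\<phi> n) = 0" by (rule bspec)
      from cap obtain y where y: "has_bochner_hdual lam \<phi> (2 / \<alpha>) {0<..<t}
            (\<lambda>r x. complex_of_real ((t - r) powr (1 - \<alpha>)) * v'' r x) y"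
        and w: "w = (\<lambda>x. complex_of_real (1 / Gamma (2 - \<alpha>)) * y x)"
        unfolding has_caputo_deriv_def by (elim exE conjE)
      have hb: "has_bochner_integral (lebesgue_on {0<..<t}) (\<lambda>r. complex_of_real ((t - r) powr (1 - \<alpha>)) * v'' r (\<phi> n)) (y (\<phi> n))"
        by (rule has_bochner_hdualD[OF _ y]) simp
      have G: "Gamma (2 - \<alpha>) > 0" using \<alpha> by (intro Gamma_real_pos) auto
      have i: "ipow (- \<alpha>) * ipow \<alpha> = 1"
        by (simp add: ipow_def exp_add[symmetric])
      have "y (\<phi> n) = of_real (Gamma (2 - \<alpha>)) * (ipow (- \<alpha>) * (ipow \<alpha> * w (\<phi> n)))"
        unfolding w using G i by (simp add: field_simps)
      also have "ipow \<alpha> * w (\<phi> n) = of_real (lam n) * cinner (v t) (\<phi> n)"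
        using e by (simp add: op_ext_eq)
      finally show ?case
        using hb by (simp add: has_bochner_integral_iff frac_int_def mult.assoc)
    qed
  qed
qed

text \<open>In each mode both solutions satisfy the same Volterra equation, so the data cancel in
  the difference. The equation is available on the open interval only; the end points follow by
  continuity.\<close>

lemma weak_solution_unique:
  assumes \<alpha>: "1 < \<alpha>" "\<alpha> < 2" and T: "0 < T" and u1: "wsum lam (- (1 / \<alpha>)) (\<lambda>n. u1 (\<phi> n))"
    and u: "weak_solution lam \<phi> \<alpha> T u0 u1 u" and v: "weak_solution lam \<phi> \<alpha> T u0 u1 v"
    and t: "t \<in> {0..T}"
  shows "v t = u t"
proof (rule coeff_eqI)
  fix n
  define d where "d r = cinner (v r) (\<phi> n) - cinner (u r) (\<phi> n)" for r
  have cont: "continuous_on {0..T} (\<lambda>r. cinner (v r) (\<phi> n))" "continuous_on {0..T} (\<lambda>r. cinner (u r) (\<phi> n))"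
    by (rule bounded_linear.continuous_on[OF bounded_linear_cinner_left conjunct1[OF v[unfolded weak_solution_def]]]
        bounded_linear.continuous_on[OF bounded_linear_cinner_left conjunct1[OF u[unfolded weak_solution_def]]])+
  have dc: "continuous_on {0..T} d"
    unfolding d_def using cont by (intro continuous_on_diff)
  let ?\<kappa> = "ipow (- \<alpha>) * of_real (lam n) / of_real (Gamma \<alpha>)"
  have int: "integrable (lebesgue_on {0<..<b}) (\<lambda>r. of_real ((b - r) powr (\<alpha> - 1)) * f r)"
    if "continuous_on {0..T} f" "b \<in> {0<..<T}" for f :: "real \<Rightarrow> complex" and b
  proof -
    have "continuous_on {0..b} (\<lambda>r. of_real ((b - r) powr (\<alpha> - 1)) * f r)"
      by (intro continuous_intros continuous_on_powr' continuous_on_subset[OF that(1)]) (use that \<alpha> in auto)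
    then have "integrable (lebesgue_on {0..b}) (\<lambda>r. of_real ((b - r) powr (\<alpha> - 1)) * f r)"
      by (intro continuous_imp_integrable_real)
    then show ?thesis by (rule integrable_lebesgue_on_subset) auto
  qed
  have "d r = 0" if "r \<in> {0<..<T}" for r
  proof (rule volterra_unique[OF dc _ _ that])
    show "1 \<le> \<alpha>" using \<alpha> by simp
    fix b assume b: "b \<in> {0<..<T}"
    have "frac_int \<alpha> d b = frac_int \<alpha> (\<lambda>t. cinner (v t) (\<phi> n)) b - frac_int \<alpha> (\<lambda>t. cinner (u t) (\<phi> n)) b"
      unfolding frac_int_def d_def right_diff_distrib
      by (intro Bochner_Integration.integral_diff int cont b)
    then show "d b = ?\<kappa> * frac_int \<alpha> d b"
      using weak_solution_mode[OF \<alpha> u1 u b, of n] weak_solution_mode[OF \<alpha> u1 v b, of n]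
      by (simp add: d_def right_diff_distrib)
  qed
  moreover have "closure {0<..<T} = {0..T}" using T by (simp add: closure_greaterThanLessThan)
  ultimately have "d t = 0"
    using continuous_constant_on_closure[of "{0<..<T}" d 0 t] dc t by auto
  then show "cinner (v t) (\<phi> n) = cinner (u t) (\<phi> n)" by (simp add: d_def)
qed

end

subsection \<open>Existence\<close>

text \<open>Up to the factor \<open>l powr ((1 - \<beta>) / \<alpha>)\<close> the modulus depends
  only on \<open>\<tau> = l powr (1 / \<alpha>) * t\<close>. For \<open>\<tau> \<ge> 1\<close> the
  power \<open>\<tau> powr (\<beta> - 1)\<close> cancels the rate of
  \<open>mittag_leffler_ray_bound\<close>. For \<open>\<tau> < 1\<close> the factor \<open>E\<close>
  is bounded, and the power is large only if \<open>\<beta> < 1\<close>, which explains the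
  \<open>min\<close>.\<close>

lemma ml_fun_bound:
  assumes \<alpha>: "1 < \<alpha>" "\<alpha> < 2" and \<beta>: "0 < \<beta>" "\<beta> < \<alpha> + 1"
  shows "\<exists>C\<ge>0. \<forall>l>0. \<forall>t>0. norm (ml_fun \<alpha> \<beta> (ipow (- \<alpha>) * of_real l) t)
     \<le> C * l powr ((1 - \<beta>) / \<alpha>) * (1 + (l powr (1 / \<alpha>) * t) powr min (\<beta> - 1) 0)"
proof -
  obtain C1 where C1: "C1 \<ge> 0" "\<And>\<tau>. \<tau> \<ge> 1 \<Longrightarrow> norm (mittag_leffler \<alpha> \<beta> (ipow (- \<alpha>) * of_real (\<tau> powr \<alpha>))) \<le> C1 * \<tau> powr (1 - \<beta>)"
    using mittag_leffler_ray_bound[OF assms] by auto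
  define C2 where "C2 = (\<Sum>k. 1 ^ k / Gamma (\<alpha> * real k + \<beta>))"
  have C2: "norm (mittag_leffler \<alpha> \<beta> z) \<le> C2" if "norm z \<le> 1" for z
    unfolding C2_def by (rule norm_mittag_leffler_le) (use assms that in auto)
  have C20: "C2 \<ge> 0" by (rule order_trans[OF norm_ge_zero C2[of 0]]) simp
  show ?thesis
  proof (intro exI[of _ "C1 + C2"] conjI allI impI)
    show "0 \<le> C1 + C2" using C1 C20 by simp
    fix l t :: real assume lt: "0 < l" "0 < t"
    define \<tau> where "\<tau> = l powr (1 / \<alpha>) * t"
    have \<tau>: "\<tau> > 0" using lt by (simp add: \<tau>_def)
    let ?z = "ipow (- \<alpha>) * of_real (\<tau> powr \<alpha>)"
    have "\<tau> powr \<alpha> = l * t powr \<alpha>"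
      using lt \<alpha> by (simp add: \<tau>_def powr_mult powr_powr)
    moreover have "t powr (\<beta> - 1) = l powr ((1 - \<beta>) / \<alpha>) * \<tau> powr (\<beta> - 1)"
    proof -
      have "\<tau> powr (\<beta> - 1) = l powr (1 / \<alpha> * (\<beta> - 1)) * t powr (\<beta> - 1)"
        using lt by (simp add: \<tau>_def powr_mult powr_powr)
      moreover have "(1 - \<beta>) / \<alpha> + 1 / \<alpha> * (\<beta> - 1) = 0" by (simp add: diff_divide_distrib)
      ultimately show ?thesis
        using lt by (simp add: mult.assoc[symmetric] powr_add[symmetric])
    qed
    ultimately have eq: "norm (ml_fun \<alpha> \<beta> (ipow (- \<alpha>) * of_real l) t)
        = l powr ((1 - \<beta>) / \<alpha>) * (\<tau> powr (\<beta> - 1) * norm (mittag_leffler \<alpha> \<beta> ?z))"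
      by (simp add: ml_fun_def norm_mult mult.assoc)
    have nz: "norm ?z = \<tau> powr \<alpha>" by (simp add: norm_mult ipow_def)
    have le: "\<tau> powr (\<beta> - 1) * norm (mittag_leffler \<alpha> \<beta> ?z) \<le> (C1 + C2) * (1 + \<tau> powr min (\<beta> - 1) 0)"
    proof (cases "\<tau> \<ge> 1")
      case True
      have "\<tau> powr (\<beta> - 1) * norm (mittag_leffler \<alpha> \<beta> ?z) \<le> \<tau> powr (\<beta> - 1) * (C1 * \<tau> powr (1 - \<beta>))"
        by (intro mult_left_mono C1 True) auto
      also have "\<dots> = C1 * 1" using \<tau> by (simp add: mult.left_commute powr_add[symmetric])
      also have "\<dots> \<le> (C1 + C2) * (1 + \<tau> powr min (\<beta> - 1) 0)"
        using C1 C20 by (intro mult_mono) auto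
      finally show ?thesis .
    next
      case False
      have "norm ?z \<le> 1"
        unfolding nz using False \<tau> \<alpha> powr_le1[of \<alpha> \<tau>] by simp
      then have "\<tau> powr (\<beta> - 1) * norm (mittag_leffler \<alpha> \<beta> ?z) \<le> \<tau> powr min (\<beta> - 1) 0 * C2"
        using False \<tau> by (intro mult_mono powr_mono' C2) auto
      also have "\<dots> \<le> (1 + \<tau> powr min (\<beta> - 1) 0) * (C1 + C2)"
        using C1 C20 by (intro mult_mono) auto
      finally show ?thesis by (simp add: mult.commute)
    qed
    show "norm (ml_fun \<alpha> \<beta> (ipow (- \<alpha>) * of_real l) t)
     \<le> (C1 + C2) * l powr ((1 - \<beta>) / \<alpha>) * (1 + (l powr (1 / \<alpha>) * t) powr min (\<beta> - 1) 0)"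
      unfolding eq \<tau>_def[symmetric] using mult_left_mono[OF le, of "l powr ((1 - \<beta>) / \<alpha>)"]
      by (simp add: mult_ac)
  qed
qed

lemma tendsto_suminf_dominated:
  fixes f :: "'a \<Rightarrow> nat \<Rightarrow> real"
  assumes "\<And>k. ((\<lambda>s. f s k) \<longlongrightarrow> g k) F" "\<forall>\<^sub>F s in F. \<forall>k. norm (f s k) \<le> M k" "summable M"
  shows "((\<lambda>s. \<Sum>k. f s k) \<longlongrightarrow> (\<Sum>k. g k)) F"
proof (cases "F = bot")
  case False
  have "\<forall>\<^sub>F (k, s) in at_top \<times>\<^sub>F F. norm (f s k) \<le> M k"
  proof -
    have "\<forall>\<^sub>F (k::nat, s) in at_top \<times>\<^sub>F F. \<forall>k. norm (f s k) \<le> M k"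
      using eventually_prod2[of "at_top :: nat filter" "\<lambda>s. \<forall>k. norm (f s k) \<le> M k" F] assms(2) by simp
    then show ?thesis by eventually_elim auto
  qed
  with tannerys_theorem[of "\<lambda>k s. f s k" g F M] assms(1,3) False show ?thesis by auto
qed simp

lemma has_bochner_integral_FTC:
  fixes F f :: "real \<Rightarrow> complex"
  assumes "a \<le> b" "\<And>t. t \<in> {a..b} \<Longrightarrow> (F has_vector_derivative f t) (at t)" "continuous_on {a..b} f"
  shows "has_bochner_integral (lebesgue_on {a..b}) f (F b - F a)"
proof -
  have i: "integrable (lebesgue_on {a..b}) f"
    using assms(3) by (rule continuous_imp_integrable_real)
  have "(f has_integral F b - F a) {a..b}"
    by (rule fundamental_theorem_of_calculus[OF assms(1)]) (use assms(2) has_vector_derivative_at_within in blast)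
  with lebesgue_integral_eq_integral[OF i] i show ?thesis
    by (simp add: has_bochner_integral_iff integral_unique)
qed

context spectral_scale
begin

lemma hdual_scale:
  assumes "f \<in> hdual lam \<phi> \<sigma>"
  shows "(\<lambda>v. c * f v) \<in> hdual lam \<phi> \<sigma>"
proof -
  obtain K where K: "\<And>x. x \<in> hspace lam \<phi> \<sigma> \<Longrightarrow> cmod (f x) \<le> K * hnorm lam \<phi> \<sigma> (cinner x)"
    using assms unfolding hdual_def by blast
  have "cmod (c * f x) \<le> (cmod c * K) * hnorm lam \<phi> \<sigma> (cinner x)" if "x \<in> hspace lam \<phi> \<sigma>" for x
    using mult_left_mono[OF K[OF that], of "cmod c"] by (simp add: norm_mult mult.assoc)
  then show ?thesis using assms unfolding hdual_def by (auto simp: distrib_left mult.left_commute)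
qed

lemma hdual_diff:
  assumes "f \<in> hdual lam \<phi> \<sigma>" "g \<in> hdual lam \<phi> \<sigma>"
  shows "(\<lambda>v. f v - g v) \<in> hdual lam \<phi> \<sigma>"
proof -
  obtain K where K: "\<And>x. x \<in> hspace lam \<phi> \<sigma> \<Longrightarrow> cmod (f x) \<le> K * hnorm lam \<phi> \<sigma> (cinner x)"
    using assms(1) unfolding hdual_def by blast
  obtain L where L: "\<And>x. x \<in> hspace lam \<phi> \<sigma> \<Longrightarrow> cmod (g x) \<le> L * hnorm lam \<phi> \<sigma> (cinner x)"
    using assms(2) unfolding hdual_def by blast
  have "cmod (f x - g x) \<le> (K + L) * hnorm lam \<phi> \<sigma> (cinner x)" if "x \<in> hspace lam \<phi> \<sigma>" for x
    using K[OF that] L[OF that] norm_triangle_ineq4[of "f x" "g x"] by (simp add: distrib_right)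
  then show ?thesis using assms unfolding hdual_def by (auto simp: right_diff_distrib)
qed

lemma coeff_fun_mult:
  assumes "wsum lam (- \<sigma>) a" "v \<in> hspace lam \<phi> \<sigma>"
  shows "coeff_fun (\<lambda>n. c * a n) v = c * coeff_fun a v"
  unfolding coeff_fun_def mult.assoc
  by (rule suminf_mult[OF summable_norm_cancel[OF weighted_cauchy_schwarz(1)[OF assms]]])

text \<open>\<open>ml_fun \<alpha> 1\<close> has the junk value \<open>0\<close> at \<open>t = 0\<close>, because \<open>0 powr 0 = 0\<close>. Hence \<open>mode\<close> uses the
  Mittag-Leffler functions directly, whereas its derivatives are only considered for \<open>t > 0\<close>.\<close>

definition mode :: "real \<Rightarrow> complex \<Rightarrow> complex \<Rightarrow> nat \<Rightarrow> real \<Rightarrow> complex" where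
  "mode \<alpha> x y n t = x * mittag_leffler \<alpha> 1 (ipow (- \<alpha>) * of_real (lam n * t powr \<alpha>))
     + y * of_real t * mittag_leffler \<alpha> 2 (ipow (- \<alpha>) * of_real (lam n * t powr \<alpha>))"

definition mode' :: "real \<Rightarrow> complex \<Rightarrow> complex \<Rightarrow> nat \<Rightarrow> real \<Rightarrow> complex" where
  "mode' \<alpha> x y n t = (let c = ipow (- \<alpha>) * of_real (lam n) in
     x * (c * ml_fun \<alpha> \<alpha> c t) + y * ml_fun \<alpha> 1 c t)"

definition mode'' :: "real \<Rightarrow> complex \<Rightarrow> complex \<Rightarrow> nat \<Rightarrow> real \<Rightarrow> complex" where
  "mode'' \<alpha> x y n t = (let c = ipow (- \<alpha>) * of_real (lam n) in
     x * (c * ml_fun \<alpha> (\<alpha> - 1) c t) + y * (c * ml_fun \<alpha> \<alpha> c t))"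

lemma mode_ml_fun:
  assumes "t > 0"
  shows "mode \<alpha> x y n t = x * ml_fun \<alpha> 1 (ipow (- \<alpha>) * of_real (lam n)) t + y * ml_fun \<alpha> 2 (ipow (- \<alpha>) * of_real (lam n)) t"
  using assms by (simp add: mode_def ml_fun_def mult_ac)

lemma mode_0: "mode \<alpha> x y n 0 = x"
  by (simp add: mode_def mittag_leffler_0)

lemma mode_derivative:
  assumes "1 < \<alpha>" "t > 0"
  shows "(mode \<alpha> x y n has_vector_derivative mode' \<alpha> x y n t) (at t)"
proof -
  let ?c = "ipow (- \<alpha>) * of_real (lam n)"
  have "((\<lambda>t. x * ml_fun \<alpha> 1 ?c t + y * ml_fun \<alpha> 2 ?c t) has_vector_derivative mode' \<alpha> x y n t) (at t)"
    unfolding mode'_def Let_def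
    using ml_fun_1_derivative[of \<alpha> t ?c] ml_fun_derivative[of \<alpha> 1 t ?c] assms
    by (intro has_vector_derivative_add has_vector_derivative_mult_right) auto
  then show ?thesis
    by (rule has_vector_derivative_transform_within_open[of _ _ _ "{0<..}"]) (use assms in \<open>auto simp: mode_ml_fun\<close>)
qed

lemma mode'_derivative:
  assumes "1 < \<alpha>" "t > 0"
  shows "(mode' \<alpha> x y n has_vector_derivative mode'' \<alpha> x y n t) (at t)"
  unfolding mode'_def[abs_def] mode''_def Let_def
  using ml_fun_1_derivative[of \<alpha> t "ipow (- \<alpha>) * of_real (lam n)"] ml_fun_derivative[of \<alpha> "\<alpha> - 1" t "ipow (- \<alpha>) * of_real (lam n)"] assms
  by (intro has_vector_derivative_add has_vector_derivative_mult_right) auto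

lemma continuous_on_mode' :
  assumes "1 < \<alpha>" "S \<subseteq> {0<..}"
  shows "continuous_on S (mode' \<alpha> x y n)" "continuous_on S (mode'' \<alpha> x y n)"
  unfolding mode'_def[abs_def] mode''_def[abs_def] Let_def
  by (intro continuous_intros continuous_on_subset[OF continuous_on_ml_fun assms(2)]; use assms in auto)+

lemma continuous_on_mode:
  assumes "1 < \<alpha>" "S \<subseteq> {0..}"
  shows "continuous_on S (mode \<alpha> x y n)"
proof -
  have "continuous_on S (\<lambda>t. mittag_leffler \<alpha> \<beta> (ipow (- \<alpha>) * of_real (lam n * t powr \<alpha>)))" if "\<beta> > 0" for \<beta>
    by (rule continuous_on_compose2[OF continuous_on_mittag_leffler[of \<alpha> \<beta> UNIV]])
       (use assms that in \<open>auto intro!: continuous_intros continuous_on_powr'\<close>)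
  then show ?thesis
    unfolding mode_def[abs_def] by (intro continuous_intros) auto
qed

text \<open>The position part carries \<open>t powr (\<alpha> - 1)\<close>, which vanishes because
  \<open>\<alpha> > 1\<close>; the velocity part starts with the value \<open>1\<close> of
  \<open>E\<close> at \<open>0\<close>.\<close>

lemma mode'_at_0:
  assumes "1 < \<alpha>"
  shows "(mode' \<alpha> x y n \<longlongrightarrow> y) (at_right 0)"
proof -
  let ?c = "ipow (- \<alpha>) * of_real (lam n)"
  let ?g = "\<lambda>t. x * (?c * (of_real (t powr (\<alpha> - 1)) * mittag_leffler \<alpha> \<alpha> (?c * of_real (t powr \<alpha>))))
     + y * mittag_leffler \<alpha> 1 (?c * of_real (t powr \<alpha>))"
  have p: "((\<lambda>t::real. t powr r) \<longlongrightarrow> 0) (at_right 0)" if "r > 0" for r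
    using that by real_asymp
  have E: "((\<lambda>t. mittag_leffler \<alpha> \<beta> (?c * of_real (t powr \<alpha>))) \<longlongrightarrow> mittag_leffler \<alpha> \<beta> 0) (at_right 0)" if "\<beta> > 0" for \<beta>
  proof (rule isCont_tendsto_compose[of 0 "mittag_leffler \<alpha> \<beta>"])
    show "isCont (mittag_leffler \<alpha> \<beta>) 0"
      using continuous_on_mittag_leffler[of \<alpha> \<beta> UNIV] assms that by (simp add: continuous_on_eq_continuous_at)
    have "((\<lambda>t. ?c * of_real (t powr \<alpha>)) \<longlongrightarrow> ?c * of_real 0) (at_right 0)"
      by (intro tendsto_intros p) (use assms in auto)
    then show "((\<lambda>t. ?c * of_real (t powr \<alpha>)) \<longlongrightarrow> 0) (at_right 0)" by simp
  qed
  have "(?g \<longlongrightarrow> x * (?c * (of_real 0 * mittag_leffler \<alpha> \<alpha> 0)) + y * mittag_leffler \<alpha> 1 0) (at_right 0)"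
    by (intro tendsto_intros p E) (use assms in auto)
  moreover have "\<forall>\<^sub>F t in at_right 0. ?g t = mode' \<alpha> x y n t"
    using eventually_at_right_less[of 0] by eventually_elim (simp add: mode'_def ml_fun_def Let_def)
  ultimately show ?thesis
    by (simp add: mittag_leffler_0 tendsto_cong)
qed

text \<open>The second parameters that occur are \<open>1\<close>, \<open>2\<close>,
  \<open>\<alpha>\<close> and \<open>\<alpha> - 1\<close>. A factor \<open>lam n\<close> from the
  rate together with the power from \<open>ml_fun_bound\<close> leaves
  \<open>lam n powr (1 / \<alpha>)\<close> per derivative. Only \<open>\<alpha> - 1\<close> is below
  \<open>1\<close>; it is the source of the integrable singularity
  \<open>t powr (\<alpha> - 2)\<close>.\<close>

lemma mode_bounds:
  assumes \<alpha>: "1 < \<alpha>" "\<alpha> < 2"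
  obtains C where "C \<ge> 1"
    "\<And>x y n t. t \<ge> 0 \<Longrightarrow> cmod (mode \<alpha> x y n t) \<le> C * (cmod x + lam n powr (- (1 / \<alpha>)) * cmod y)"
    "\<And>x y n t. t > 0 \<Longrightarrow> cmod (mode' \<alpha> x y n t) \<le> C * lam n powr (1 / \<alpha>) * (cmod x + lam n powr (- (1 / \<alpha>)) * cmod y)"
    "\<And>x y n t. t > 0 \<Longrightarrow> cmod (mode'' \<alpha> x y n t) \<le> C * (1 + t powr (\<alpha> - 2)) * lam n powr (2 / \<alpha>) * (cmod x + lam n powr (- (1 / \<alpha>)) * cmod y)"
proof -
  let ?f = "\<lambda>\<beta> n t. norm (ml_fun \<alpha> \<beta> (ipow (- \<alpha>) * of_real (lam n)) t)"
  have ge1: "\<exists>C\<ge>0. \<forall>n. \<forall>t>0. ?f \<beta> n t \<le> C * lam n powr ((1 - \<beta>) / \<alpha>)" if \<beta>: "1 \<le> \<beta>" "\<beta> < \<alpha> + 1" for \<beta>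
  proof -
    obtain C where C: "C \<ge> 0" "\<forall>l>0. \<forall>t>0. norm (ml_fun \<alpha> \<beta> (ipow (- \<alpha>) * of_real l) t)
       \<le> C * l powr ((1 - \<beta>) / \<alpha>) * (1 + (l powr (1 / \<alpha>) * t) powr min (\<beta> - 1) 0)"
      using ml_fun_bound[OF \<alpha> less_le_trans[OF zero_less_one \<beta>(1)] \<beta>(2)] by (elim exE conjE)
    have "min (\<beta> - 1) 0 = 0" using \<beta> by simp
    then have "?f \<beta> n t \<le> (2 * C) * lam n powr ((1 - \<beta>) / \<alpha>)" if "t > 0" for n t
      using C(2)[rule_format, OF lam_pos[of n] that] that lam_pos[of n] by (auto simp: mult_ac)
    then show ?thesis using C(1) by (intro exI[of _ "2 * C"]) auto
  qed
  have le: "1 \<le> (1::real)" "1 < \<alpha> + 1" "1 \<le> (2::real)" "2 < \<alpha> + 1" "1 \<le> \<alpha>" "\<alpha> < \<alpha> + 1" "0 < \<alpha> - 1" "\<alpha> - 1 < \<alpha> + 1"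
    using \<alpha> by auto
  obtain C1 where C1: "C1 \<ge> 0" "\<forall>n. \<forall>t>0. ?f 1 n t \<le> C1 * lam n powr ((1 - 1) / \<alpha>)"
    using ge1[OF le(1,2)] by (elim exE conjE)
  obtain C2 where C2: "C2 \<ge> 0" "\<forall>n. \<forall>t>0. ?f 2 n t \<le> C2 * lam n powr ((1 - 2) / \<alpha>)"
    using ge1[OF le(3,4)] by (elim exE conjE)
  obtain C3 where C3: "C3 \<ge> 0" "\<forall>n. \<forall>t>0. ?f \<alpha> n t \<le> C3 * lam n powr ((1 - \<alpha>) / \<alpha>)"
    using ge1[OF le(5,6)] by (elim exE conjE)
  obtain C4 where C4: "C4 \<ge> 0" "\<forall>l>0. \<forall>t>0. norm (ml_fun \<alpha> (\<alpha> - 1) (ipow (- \<alpha>) * of_real l) t)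
       \<le> C4 * l powr ((1 - (\<alpha> - 1)) / \<alpha>) * (1 + (l powr (1 / \<alpha>) * t) powr min (\<alpha> - 1 - 1) 0)"
    using ml_fun_bound[OF \<alpha> le(7,8)] by (elim exE conjE)
  \<comment> \<open>The exponent is negative, so in the singular factor every eigenvalue may be
    replaced by the smallest one.\<close>
  define k where "k = 1 + lam 0 powr ((\<alpha> - 2) / \<alpha>)"
  have k: "k \<ge> 1" by (simp add: k_def)
  have f4: "?f (\<alpha> - 1) n t \<le> C4 * k * (1 + t powr (\<alpha> - 2)) * lam n powr ((2 - \<alpha>) / \<alpha>)" if t: "t > 0" for n t
  proof -
    have "(lam n powr (1 / \<alpha>) * t) powr (\<alpha> - 2) = lam n powr ((\<alpha> - 2) / \<alpha>) * t powr (\<alpha> - 2)"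
      using t lam_pos[of n] by (simp add: powr_mult powr_powr)
    also have "\<dots> \<le> lam 0 powr ((\<alpha> - 2) / \<alpha>) * t powr (\<alpha> - 2)"
      using \<alpha> lam_0 lam_ge by (intro mult_right_mono powr_mono2') (auto intro: divide_nonpos_pos)
    finally have "1 + (lam n powr (1 / \<alpha>) * t) powr (\<alpha> - 2) \<le> k * (1 + t powr (\<alpha> - 2))"
      using powr_ge_zero[of t "\<alpha> - 2"] powr_ge_zero[of "lam 0" "(\<alpha> - 2) / \<alpha>"]
      unfolding k_def distrib_left distrib_right by linarith
    then have "C4 * lam n powr ((2 - \<alpha>) / \<alpha>) * (1 + (lam n powr (1 / \<alpha>) * t) powr (\<alpha> - 2)) \<le> C4 * lam n powr ((2 - \<alpha>) / \<alpha>) * (k * (1 + t powr (\<alpha> - 2)))"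
      using C4(1) by (intro mult_left_mono) auto
    moreover have "min (\<alpha> - 1 - 1) 0 = \<alpha> - 2" "1 - (\<alpha> - 1) = 2 - \<alpha>" using \<alpha> by auto
    ultimately show ?thesis
      using C4(2)[rule_format, OF lam_pos[of n] t] by (simp add: mult_ac)
  qed
  \<comment> \<open>The summand \<open>1\<close> takes care of \<open>t = 0\<close>, where
    \<open>mode\<close> equals \<open>x\<close> and the bounds on \<open>ml_fun\<close> do not
    apply.\<close>
  define C where "C = 1 + C1 + C2 + C3 + C4 * k"
  have Cge: "C \<ge> 1" "C1 \<le> C" "C2 \<le> C" "C3 \<le> C" "C4 * k \<le> C"
    using C1(1) C2(1) C3(1) C4(1) k mult_nonneg_nonneg[of C4 k] by (auto simp: C_def)
  have c: "norm (ipow (- \<alpha>) * of_real (lam n)) = lam n" for n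
    using lam_pos[of n] by (simp add: norm_mult ipow_def)
  have pw: "lam n * lam n powr ((1 - \<alpha>) / \<alpha>) = lam n powr (1 / \<alpha>)" "lam n * lam n powr ((2 - \<alpha>) / \<alpha>) = lam n powr (2 / \<alpha>)"
    "lam n powr (1 / \<alpha>) * lam n powr (- (1 / \<alpha>)) = 1" "lam n powr (2 / \<alpha>) * lam n powr (- (1 / \<alpha>)) = lam n powr (1 / \<alpha>)" for n
  proof -
    have *: "lam n * lam n powr r = lam n powr (1 + r)" for r using lam_pos[of n] by (simp add: powr_add)
    have e: "1 + (1 - \<alpha>) / \<alpha> = 1 / \<alpha>" "1 + (2 - \<alpha>) / \<alpha> = 2 / \<alpha>" "2 / \<alpha> + - (1 / \<alpha>) = 1 / \<alpha>"
      using \<alpha> by (auto simp: field_simps)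
    show "lam n * lam n powr ((1 - \<alpha>) / \<alpha>) = lam n powr (1 / \<alpha>)" "lam n * lam n powr ((2 - \<alpha>) / \<alpha>) = lam n powr (2 / \<alpha>)"
      unfolding * e by (rule refl)+
    show "lam n powr (1 / \<alpha>) * lam n powr (- (1 / \<alpha>)) = 1"
      unfolding powr_add[symmetric] using lam_pos[of n] by simp
    show "lam n powr (2 / \<alpha>) * lam n powr (- (1 / \<alpha>)) = lam n powr (1 / \<alpha>)"
      unfolding powr_add[symmetric] e by (rule refl)
  qed
  show ?thesis
  proof (rule that[OF Cge(1)])
    fix x y n and t :: real assume "t \<ge> 0"
    show "cmod (mode \<alpha> x y n t) \<le> C * (cmod x + lam n powr (- (1 / \<alpha>)) * cmod y)"
    proof (cases "t = 0")
      case True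
      have "1 * cmod x \<le> C * (cmod x + lam n powr (- (1 / \<alpha>)) * cmod y)"
        using Cge by (intro mult_mono) auto
      then show ?thesis using True by (simp add: mode_0)
    next
      case False
      then have t: "t > 0" using \<open>t \<ge> 0\<close> by simp
      have "cmod (mode \<alpha> x y n t) \<le> cmod x * ?f 1 n t + cmod y * ?f 2 n t"
        unfolding mode_ml_fun[OF t] by (rule order_trans[OF norm_triangle_ineq]) (simp add: norm_mult)
      also have "\<dots> \<le> cmod x * C + cmod y * (C * lam n powr (- (1 / \<alpha>)))"
      proof (intro add_mono mult_left_mono)
        show "?f 1 n t \<le> C" using C1(2)[rule_format, OF t, of n] lam_pos[of n] Cge by simp
        show "?f 2 n t \<le> C * lam n powr (- (1 / \<alpha>))"
          by (rule order_trans[OF C2(2)[rule_format, OF t]]) (use Cge in \<open>auto intro!: mult_right_mono\<close>)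
      qed auto
      finally show ?thesis by (simp add: algebra_simps)
    qed
  next
    fix x y n and t :: real assume t: "t > 0"
    have "cmod (mode' \<alpha> x y n t) \<le> cmod x * (lam n * ?f \<alpha> n t) + cmod y * ?f 1 n t"
      unfolding mode'_def Let_def using c[of n]
      by (intro order_trans[OF norm_triangle_ineq]) (simp add: norm_mult[of x] norm_mult[of y] norm_mult[of "_ * _" "ml_fun _ _ _ _"])
    also have "\<dots> \<le> cmod x * (lam n * (C * lam n powr ((1 - \<alpha>) / \<alpha>))) + cmod y * C"
    proof (intro add_mono mult_left_mono)
      show "?f 1 n t \<le> C" using C1(2)[rule_format, OF t, of n] lam_pos[of n] Cge by simp
      show "?f \<alpha> n t \<le> C * lam n powr ((1 - \<alpha>) / \<alpha>)"
        by (rule order_trans[OF C3(2)[rule_format, OF t]]) (use Cge in \<open>auto intro!: mult_right_mono\<close>)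
    qed (use lam_pos[of n] in auto)
    also have "\<dots> = C * (lam n * lam n powr ((1 - \<alpha>) / \<alpha>)) * cmod x + C * (lam n powr (1 / \<alpha>) * lam n powr (- (1 / \<alpha>))) * cmod y"
      unfolding pw(3) by (simp add: mult_ac)
    also have "\<dots> = C * lam n powr (1 / \<alpha>) * (cmod x + lam n powr (- (1 / \<alpha>)) * cmod y)"
      unfolding pw(1) by (simp add: algebra_simps)
    finally show "cmod (mode' \<alpha> x y n t) \<le> C * lam n powr (1 / \<alpha>) * (cmod x + lam n powr (- (1 / \<alpha>)) * cmod y)" .
    let ?h = "1 + t powr (\<alpha> - 2)"
    have "cmod (mode'' \<alpha> x y n t) \<le> cmod x * (lam n * ?f (\<alpha> - 1) n t) + cmod y * (lam n * ?f \<alpha> n t)"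
      unfolding mode''_def Let_def using c[of n]
      by (intro order_trans[OF norm_triangle_ineq]) (simp add: norm_mult[of x] norm_mult[of y] norm_mult[of "_ * _" "ml_fun _ _ _ _"])
    also have "\<dots> \<le> cmod x * (lam n * (C * ?h * lam n powr ((2 - \<alpha>) / \<alpha>))) + cmod y * (lam n * (C * ?h * lam n powr ((1 - \<alpha>) / \<alpha>)))"
    proof (intro add_mono mult_left_mono)
      show "?f (\<alpha> - 1) n t \<le> C * ?h * lam n powr ((2 - \<alpha>) / \<alpha>)"
        by (rule order_trans[OF f4[OF t]]) (use Cge in \<open>auto intro!: mult_right_mono\<close>)
      have "C3 * 1 \<le> C * ?h" using Cge by (intro mult_mono) auto
      then show "?f \<alpha> n t \<le> C * ?h * lam n powr ((1 - \<alpha>) / \<alpha>)"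
        by (intro order_trans[OF C3(2)[rule_format, OF t]]) (auto intro!: mult_right_mono)
    qed (use lam_pos[of n] in auto)
    also have "\<dots> = C * ?h * (lam n * lam n powr ((2 - \<alpha>) / \<alpha>)) * cmod x + C * ?h * (lam n * lam n powr ((1 - \<alpha>) / \<alpha>)) * cmod y"
      by (simp only: mult_ac)
    also have "\<dots> = C * ?h * lam n powr (2 / \<alpha>) * (cmod x + lam n powr (- (1 / \<alpha>)) * cmod y)"
      unfolding pw(1,2) pw(4)[symmetric] by (simp only: distrib_left mult_ac)
    finally show "cmod (mode'' \<alpha> x y n t) \<le> C * ?h * lam n powr (2 / \<alpha>) * (cmod x + lam n powr (- (1 / \<alpha>)) * cmod y)" .
  qed
qed

end

text \<open>Fixes \<open>C\<close> before any data are chosen, which is what makes the constant of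
  the theorem independent of \<open>u0\<close> and \<open>u1\<close>.\<close>

locale mode_bounded = spectral_scale +
  fixes \<alpha> C :: real
  assumes alpha: "1 < \<alpha>" "\<alpha> < 2" and C_ge: "C \<ge> 1"
    and mode_le: "\<And>x y n t. t \<ge> 0 \<Longrightarrow> cmod (mode \<alpha> x y n t) \<le> C * (cmod x + lam n powr (- (1 / \<alpha>)) * cmod y)"
    and mode'_le: "\<And>x y n t. t > 0 \<Longrightarrow> cmod (mode' \<alpha> x y n t) \<le> C * lam n powr (1 / \<alpha>) * (cmod x + lam n powr (- (1 / \<alpha>)) * cmod y)"
    and mode''_le: "\<And>x y n t. t > 0 \<Longrightarrow> cmod (mode'' \<alpha> x y n t) \<le> C * (1 + t powr (\<alpha> - 2)) * lam n powr (2 / \<alpha>) * (cmod x + lam n powr (- (1 / \<alpha>)) * cmod y)"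
begin

text \<open>The joint size of the data in one mode. The weight of \<open>y\<close> reflects that a
  velocity lies \<open>1 / \<alpha>\<close> lower in the scale than a position. All majorants over
  the modes are multiples of this sequence.\<close>

definition amp :: "(nat \<Rightarrow> complex) \<Rightarrow> (nat \<Rightarrow> complex) \<Rightarrow> nat \<Rightarrow> real" where
  "amp x y n = cmod (x n) + lam n powr (- (1 / \<alpha>)) * cmod (y n)"

definition sol :: "(nat \<Rightarrow> complex) \<Rightarrow> (nat \<Rightarrow> complex) \<Rightarrow> real \<Rightarrow> 'a" where
  "sol x y t = (\<Sum>n. mode \<alpha> (x n) (y n) n t *\<^sub>C \<phi> n)"

lemma amp_nonneg: "0 \<le> amp x y n"
  by (simp add: amp_def)

lemma wsum_shift: "wsum lam r (\<lambda>n. of_real (lam n powr (- q)) * y n) \<longleftrightarrow> wsum lam (r - q) y"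
proof -
  have "lam n powr (2 * r) * (cmod (of_real (lam n powr (- q)) * y n))\<^sup>2 = lam n powr (2 * (r - q)) * (cmod (y n))\<^sup>2" for n
  proof -
    have "lam n powr (2 * r) * (lam n powr (- q))\<^sup>2 = lam n powr (2 * (r - q))"
      unfolding powr_double[symmetric] powr_add[symmetric] by (simp add: algebra_simps)
    then show ?thesis by (simp add: norm_mult power_mult_distrib mult.assoc[symmetric])
  qed
  then show ?thesis by (simp add: wsum_def)
qed

lemma wsum_amp:
  assumes "wsum lam r x" "wsum lam (r - 1 / \<alpha>) y"
  shows "wsum lam r (\<lambda>n. of_real (amp x y n))"
proof (rule wsum_mono[where K = 1])
  show "wsum lam r (\<lambda>n. of_real (cmod (x n)) + of_real (cmod (of_real (lam n powr (- (1 / \<alpha>))) * y n)))"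
    by (intro wsum_add wsum_mono[OF assms(1), of _ 1] wsum_mono[OF assms(2)[folded wsum_shift], of _ 1]) auto
  fix n
  have "of_real (cmod (x n)) + of_real (cmod (of_real (lam n powr (- (1 / \<alpha>))) * y n)) = complex_of_real (amp x y n)"
    by (simp add: amp_def norm_mult)
  then show "cmod (of_real (amp x y n)) \<le> 1 * cmod (of_real (cmod (x n)) + of_real (cmod (of_real (lam n powr (- (1 / \<alpha>))) * y n)))"
    by simp
qed

text \<open>Expanding the square in each mode costs a factor \<open>2\<close> under the root; the
  resulting \<open>sqrt 2\<close> is rounded up to \<open>2\<close>.\<close>

lemma hnorm_amp_le:
  assumes "wsum lam r (\<lambda>n. f (\<phi> n))" "wsum lam (r - 1 / \<alpha>) (\<lambda>n. g (\<phi> n))"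
  shows "sqrt (\<Sum>n. lam n powr (2 * r) * (amp (\<lambda>n. f (\<phi> n)) (\<lambda>n. g (\<phi> n)) n)\<^sup>2)
    \<le> 2 * (hnorm lam \<phi> r f + hnorm lam \<phi> (r - 1 / \<alpha>) g)"
proof -
  let ?X = "\<lambda>n. lam n powr (2 * r) * (cmod (f (\<phi> n)))\<^sup>2"
  let ?Y = "\<lambda>n. lam n powr (2 * (r - 1 / \<alpha>)) * (cmod (g (\<phi> n)))\<^sup>2"
  let ?A = "\<lambda>n. lam n powr (2 * r) * (amp (\<lambda>n. f (\<phi> n)) (\<lambda>n. g (\<phi> n)) n)\<^sup>2"
  have X: "summable ?X" and Y: "summable ?Y" using assms by (auto simp: wsum_def)
  have A: "summable ?A" using wsum_amp[OF assms] by (simp add: wsum_def amp_nonneg)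
  have le: "?A n \<le> 2 * ?X n + 2 * ?Y n" for n
  proof -
    have "lam n powr (2 * r) * (lam n powr (- (1 / \<alpha>)))\<^sup>2 = lam n powr (2 * (r - 1 / \<alpha>))"
      unfolding powr_double[symmetric] powr_add[symmetric] by (simp add: algebra_simps)
    then have Y': "?Y n = lam n powr (2 * r) * (lam n powr (- (1 / \<alpha>)) * cmod (g (\<phi> n)))\<^sup>2"
      by (simp add: power_mult_distrib mult.assoc[symmetric])
    show ?thesis
      unfolding Y' amp_def
      using mult_left_mono[OF power2_norm_add_le[of "cmod (f (\<phi> n))" "lam n powr (- (1 / \<alpha>)) * cmod (g (\<phi> n))"], of "lam n powr (2 * r)"]
      by (simp add: algebra_simps)
  qed
  have "sqrt (\<Sum>n. ?A n) \<le> sqrt (\<Sum>n. 2 * ?X n + 2 * ?Y n)"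
    by (intro real_sqrt_le_mono suminf_le le A summable_add summable_mult X Y)
  also have "(\<Sum>n. 2 * ?X n + 2 * ?Y n) = 2 * (\<Sum>n. ?X n) + 2 * (\<Sum>n. ?Y n)"
    using suminf_add[OF summable_mult[OF X, of 2] summable_mult[OF Y, of 2]]
    unfolding suminf_mult[OF X] suminf_mult[OF Y] by (rule sym)
  also have "sqrt \<dots> \<le> sqrt (2 * (\<Sum>n. ?X n)) + sqrt (2 * (\<Sum>n. ?Y n))"
    by (intro sqrt_add_le_add_sqrt mult_nonneg_nonneg suminf_nonneg X Y) auto
  also have "\<dots> = sqrt 2 * (hnorm lam \<phi> r f + hnorm lam \<phi> (r - 1 / \<alpha>) g)"
    by (simp add: hnorm_def real_sqrt_mult distrib_left)
  also have "\<dots> \<le> 2 * (hnorm lam \<phi> r f + hnorm lam \<phi> (r - 1 / \<alpha>) g)"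
    using assms hnorm_nonneg[of lam r f \<phi>] hnorm_nonneg[of lam "r - 1 / \<alpha>" g \<phi>] sqrt2_less_2
    by (intro mult_right_mono) auto
  finally show ?thesis .
qed

lemma wsum_mode:
  assumes "wsum lam r (\<lambda>n. of_real (amp x y n))" "t \<ge> 0"
  shows "wsum lam r (\<lambda>n. mode \<alpha> (x n) (y n) n t)"
proof (rule wsum_mono[OF assms(1), of _ C])
  fix n
  have "cmod (mode \<alpha> (x n) (y n) n t) \<le> C * amp x y n"
    unfolding amp_def by (rule mode_le[OF assms(2)])
  then show "cmod (mode \<alpha> (x n) (y n) n t) \<le> C * cmod (of_real (amp x y n))"
    by (simp add: amp_nonneg)
qed

lemma wsum_mode':
  assumes "wsum lam 0 (\<lambda>n. of_real (amp x y n))" "t > 0"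
  shows "wsum lam (- (1 / \<alpha>)) (\<lambda>n. mode' \<alpha> (x n) (y n) n t)"
proof -
  have "wsum lam 0 (\<lambda>n. of_real (lam n powr (- (1 / \<alpha>))) * mode' \<alpha> (x n) (y n) n t)"
  proof (rule wsum_mono[OF assms(1), of _ C])
    fix n
    have "lam n powr (- (1 / \<alpha>)) * cmod (mode' \<alpha> (x n) (y n) n t) \<le> lam n powr (- (1 / \<alpha>)) * (C * lam n powr (1 / \<alpha>) * amp x y n)"
      using mode'_le[OF assms(2)] by (intro mult_left_mono) (auto simp: amp_def)
    also have "\<dots> = (lam n powr (- (1 / \<alpha>)) * lam n powr (1 / \<alpha>)) * (C * amp x y n)" by (simp only: mult_ac)
    also have "lam n powr (- (1 / \<alpha>)) * lam n powr (1 / \<alpha>) = 1" using lam_pos[of n] by (simp flip: powr_add)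
    finally show "cmod (of_real (lam n powr (- (1 / \<alpha>))) * mode' \<alpha> (x n) (y n) n t) \<le> C * cmod (of_real (amp x y n))"
      by (simp add: norm_mult amp_nonneg)
  qed
  then show ?thesis unfolding wsum_shift by simp
qed

lemma scaled_mode''_le:
  assumes "t > 0"
  shows "lam n powr (- (2 / \<alpha>)) * cmod (mode'' \<alpha> (x n) (y n) n t) \<le> C * amp x y n * (1 + t powr (\<alpha> - 2))"
proof -
  have "lam n powr (- (2 / \<alpha>)) * cmod (mode'' \<alpha> (x n) (y n) n t)
      \<le> lam n powr (- (2 / \<alpha>)) * (C * (1 + t powr (\<alpha> - 2)) * lam n powr (2 / \<alpha>) * amp x y n)"
    using mode''_le[OF assms] by (intro mult_left_mono) (auto simp: amp_def)
  also have "\<dots> = (lam n powr (- (2 / \<alpha>)) * lam n powr (2 / \<alpha>)) * (C * amp x y n * (1 + t powr (\<alpha> - 2)))"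
    by (simp only: mult_ac)
  also have "lam n powr (- (2 / \<alpha>)) * lam n powr (2 / \<alpha>) = 1" using lam_pos[of n] by (simp flip: powr_add)
  finally show ?thesis by simp
qed

lemma wsum_mode'':
  assumes "wsum lam 0 (\<lambda>n. of_real (amp x y n))" "t > 0"
  shows "wsum lam (- (2 / \<alpha>)) (\<lambda>n. mode'' \<alpha> (x n) (y n) n t)"
proof -
  have "wsum lam 0 (\<lambda>n. of_real (lam n powr (- (2 / \<alpha>))) * mode'' \<alpha> (x n) (y n) n t)"
  proof (rule wsum_mono[OF assms(1), of _ "C * (1 + t powr (\<alpha> - 2))"])
    fix n
    show "cmod (of_real (lam n powr (- (2 / \<alpha>))) * mode'' \<alpha> (x n) (y n) n t) \<le> C * (1 + t powr (\<alpha> - 2)) * cmod (of_real (amp x y n))"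
      using scaled_mode''_le[OF assms(2), of n x y] by (simp add: norm_mult amp_nonneg mult_ac)
  qed
  then show ?thesis unfolding wsum_shift by simp
qed

text \<open>The operator lowers the order by exactly one, and \<open>\<alpha> < 2\<close> gives
  \<open>1 \<le> 2 / \<alpha>\<close>.\<close>

lemma wsum_lam_mult:
  assumes "wsum lam 0 z"
  shows "wsum lam (- (2 / \<alpha>)) (\<lambda>n. of_real (lam n) * z n)"
proof -
  have "wsum lam (- 1) (\<lambda>n. of_real (lam n powr (- (- 1))) * z n) \<longleftrightarrow> wsum lam (- 1 - - 1) z"
    by (rule wsum_shift)
  then have "wsum lam (- 1) (\<lambda>n. of_real (lam n) * z n)"
    using assms lam_pos by (simp add: less_imp_le)
  then show ?thesis by (rule wsum_weaken[rotated]) (use alpha in simp)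
qed

section \<open>The candidate solution for fixed data\<close>

context
  fixes x y :: "nat \<Rightarrow> complex"
  assumes amp0: "wsum lam 0 (\<lambda>n. of_real (amp x y n))"
begin

abbreviation "m n t \<equiv> mode \<alpha> (x n) (y n) n t"
abbreviation "m' n t \<equiv> mode' \<alpha> (x n) (y n) n t"
abbreviation "m'' n t \<equiv> mode'' \<alpha> (x n) (y n) n t"
abbreviation "U' t \<equiv> coeff_fun (\<lambda>n. m' n t)"
abbreviation "U'' t \<equiv> coeff_fun (\<lambda>n. m'' n t)"

lemma cinner_sol: "t \<ge> 0 \<Longrightarrow> cinner (sol x y t) (\<phi> n) = m n t"
  unfolding sol_def by (rule riesz_fischer(2)) (rule wsum_mode[OF amp0])

text \<open>Dominated convergence over the modes: each mode is continuous, and its increments are at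
  most \<open>2 * C\<close> times the amplitude. The order \<open>r\<close> is left free because it
  is taken as \<open>0\<close> for weak solutions and as \<open>s\<close> in the theorem.\<close>

lemma sol_continuous:
  assumes amp: "wsum lam r (\<lambda>n. of_real (amp x y n))" and t: "t \<in> {0..T}"
  shows "((\<lambda>s. hnorm lam \<phi> r (cinner (sol x y s - sol x y t))) \<longlongrightarrow> 0) (at t within {0..T})"
proof -
    let ?f = "\<lambda>s n. lam n powr (2 * r) * (cmod (cinner (sol x y s - sol x y t) (\<phi> n)))\<^sup>2"
  have ev: "\<forall>\<^sub>F s in at t within {0..T}. s \<in> {0..T}"
    by (simp add: eventually_at_filter)
  have diff: "cinner (sol x y s - sol x y t) (\<phi> n) = m n s - m n t" if "s \<in> {0..T}" for s n
    using that t by (simp add: cinner_diff_left cinner_sol)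
  have "((\<lambda>s. \<Sum>n. ?f s n) \<longlongrightarrow> (\<Sum>n. 0)) (at t within {0..T})"
  proof (rule tendsto_suminf_dominated)
    fix n
    have "(m n \<longlongrightarrow> m n t) (at t within {0..T})"
      using continuous_on_mode[OF alpha(1), of "{0..T}" "x n" "y n" n] t by (auto simp: continuous_on_def)
    then have "((\<lambda>s. lam n powr (2 * r) * (cmod (m n s - m n t))\<^sup>2) \<longlongrightarrow> lam n powr (2 * r) * (cmod (m n t - m n t))\<^sup>2) (at t within {0..T})"
      by (intro tendsto_intros)
    then have "((\<lambda>s. lam n powr (2 * r) * (cmod (m n s - m n t))\<^sup>2) \<longlongrightarrow> 0) (at t within {0..T})" by simp
    then show "((\<lambda>s. ?f s n) \<longlongrightarrow> 0) (at t within {0..T})"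
    proof (rule Lim_transform_eventually)
      show "\<forall>\<^sub>F s in at t within {0..T}. lam n powr (2 * r) * (cmod (m n s - m n t))\<^sup>2 = ?f s n"
        using ev by eventually_elim (simp only: diff)
    qed
  next
    show "\<forall>\<^sub>F s in at t within {0..T}. \<forall>n. norm (?f s n) \<le> (2 * C)\<^sup>2 * (lam n powr (2 * r) * (cmod (of_real (amp x y n)))\<^sup>2)"
      using ev
    proof eventually_elim
      case (elim s)
      show ?case
      proof
        fix n
        have "cmod (m n s - m n t) \<le> C * amp x y n + C * amp x y n"
          using mode_le[of s "x n" "y n" n] mode_le[of t "x n" "y n" n] elim t norm_triangle_ineq4[of "m n s" "m n t"]
          by (auto simp: amp_def)
        then have "(cmod (m n s - m n t))\<^sup>2 \<le> (2 * C * amp x y n)\<^sup>2" by (intro power_mono) auto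
        then have "lam n powr (2 * r) * (cmod (m n s - m n t))\<^sup>2 \<le> lam n powr (2 * r) * (2 * C * amp x y n)\<^sup>2"
          by (intro mult_left_mono) auto
        then show "norm (?f s n) \<le> (2 * C)\<^sup>2 * (lam n powr (2 * r) * (cmod (of_real (amp x y n)))\<^sup>2)"
          using diff[OF elim] by (simp add: power_mult_distrib amp_nonneg mult_ac)
      qed
    qed
  next
    show "summable (\<lambda>n. (2 * C)\<^sup>2 * (lam n powr (2 * r) * (cmod (of_real (amp x y n)))\<^sup>2))"
      using amp unfolding wsum_def by (rule summable_mult)
  qed
  from tendsto_real_sqrt[OF this] show ?thesis by (simp add: hnorm_def)
qed

lemma sol_hnorm_le:
  assumes "wsum lam r (\<lambda>n. of_real (amp x y n))" "t \<ge> 0"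
  shows "hnorm lam \<phi> r (cinner (sol x y t)) \<le> C * sqrt (\<Sum>n. lam n powr (2 * r) * (amp x y n)\<^sup>2)"
proof -
  have A: "summable (\<lambda>n. lam n powr (2 * r) * (amp x y n)\<^sup>2)"
    using assms(1) by (simp add: wsum_def amp_nonneg)
  have "(\<Sum>n. lam n powr (2 * r) * (cmod (cinner (sol x y t) (\<phi> n)))\<^sup>2) \<le> (\<Sum>n. C\<^sup>2 * (lam n powr (2 * r) * (amp x y n)\<^sup>2))"
  proof (rule suminf_le)
    fix n
    have "(cmod (m n t))\<^sup>2 \<le> (C * amp x y n)\<^sup>2"
      using mode_le[OF assms(2)] by (intro power_mono) (auto simp: amp_def)
    then have "lam n powr (2 * r) * (cmod (m n t))\<^sup>2 \<le> lam n powr (2 * r) * (C * amp x y n)\<^sup>2"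
      by (intro mult_left_mono) auto
    then show "lam n powr (2 * r) * (cmod (cinner (sol x y t) (\<phi> n)))\<^sup>2 \<le> C\<^sup>2 * (lam n powr (2 * r) * (amp x y n)\<^sup>2)"
      using assms(2) by (simp add: cinner_sol power_mult_distrib mult_ac)
  next
    show "summable (\<lambda>n. lam n powr (2 * r) * (cmod (cinner (sol x y t) (\<phi> n)))\<^sup>2)"
      using wsum_mode[OF assms] assms(2) by (simp add: wsum_def cinner_sol)
  qed (use A in \<open>rule summable_mult\<close>)
  then have "sqrt (\<Sum>n. lam n powr (2 * r) * (cmod (cinner (sol x y t) (\<phi> n)))\<^sup>2) \<le> sqrt (C\<^sup>2 * (\<Sum>n. lam n powr (2 * r) * (amp x y n)\<^sup>2))"
    unfolding suminf_mult[OF A] by (rule real_sqrt_le_mono)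
  then show ?thesis using C_ge by (simp add: hnorm_def real_sqrt_mult)
qed

lemma sol_time_deriv:
  "has_time_deriv lam \<phi> (2 / \<alpha>) T (\<lambda>t. cinner (sol x y t)) (\<lambda>t. U' t)"
  unfolding has_time_deriv_def
proof (intro conjI ballI allI impI)
  have dual: "cinner (sol x y t) \<in> hdual lam \<phi> (2 / \<alpha>)" for t
    by (rule cinner_hdual) (use alpha in simp)
  have dual': "U' t \<in> hdual lam \<phi> (2 / \<alpha>)" if "t > 0" for t
    by (rule coeff_fun_hdual, rule wsum_weaken[OF _ wsum_mode'[OF amp0 that]]) (use alpha in \<open>simp add: divide_right_mono\<close>)
  {
    fix t assume "t \<in> {0<..<T}"
    then show "cinner (sol x y t) \<in> hdual lam \<phi> (2 / \<alpha>)" "U' t \<in> hdual lam \<phi> (2 / \<alpha>)"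
      using dual dual' by auto
  next
    fix a b assume ab: "0 < a \<and> a \<le> b \<and> b < T"
    \<comment> \<open>The velocity is controlled at order \<open>- (1 / \<alpha>)\<close> already;
      the surplus weight \<open>lam n powr (- (1 / \<alpha>))\<close> is largest at the smallest
      eigenvalue.\<close>
    define K where "K = C * lam 0 powr (- (1 / \<alpha>))"
    have K0: "K \<ge> 0" using C_ge by (simp add: K_def)
    show "has_bochner_hdual lam \<phi> (2 / \<alpha>) {a..b} (\<lambda>t. U' t) (\<lambda>v. cinner (sol x y b) v - cinner (sol x y a) v)"
    proof (rule has_bochner_hdualI[where a = "\<lambda>n. K * amp x y n" and h = "\<lambda>_. 1"])
      show "U' t \<in> hdual lam \<phi> (2 / \<alpha>)" if "t \<in> {a..b}" for t
        by (rule dual') (use that ab in auto)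
      show "(\<lambda>v. cinner (sol x y b) v - cinner (sol x y a) v) \<in> hdual lam \<phi> (2 / \<alpha>)"
        by (intro hdual_diff dual)
      show "has_bochner_integral (lebesgue_on {a..b}) (\<lambda>t. U' t (\<phi> n)) (cinner (sol x y b) (\<phi> n) - cinner (sol x y a) (\<phi> n))" for n
        unfolding coeff_fun_basis using ab
        by (simp add: cinner_sol) (intro has_bochner_integral_FTC mode_derivative[OF alpha(1)] continuous_on_mode'(1)[OF alpha(1)]; auto)
      show "summable (\<lambda>n. (K * amp x y n)\<^sup>2)"
        using summable_mult[OF amp0[unfolded wsum_def], of "K\<^sup>2"] lam_pos
        by (simp add: power_mult_distrib amp_nonneg less_imp_neq[symmetric])
      show "integrable (lebesgue_on {a..b}) (\<lambda>_. 1 :: real)" by (rule continuous_imp_integrable_real) (intro continuous_intros)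
    next
      fix t n assume "t \<in> {a..b}"
      then have t: "t > 0" using ab by simp
      have "lam n powr (- (2 / \<alpha>)) * cmod (m' n t) \<le> lam n powr (- (2 / \<alpha>)) * (C * lam n powr (1 / \<alpha>) * amp x y n)"
        using mode'_le[OF t] by (intro mult_left_mono) (auto simp: amp_def)
      also have "\<dots> = C * (lam n powr (- (2 / \<alpha>)) * lam n powr (1 / \<alpha>)) * amp x y n" by (simp only: mult_ac)
      also have "lam n powr (- (2 / \<alpha>)) * lam n powr (1 / \<alpha>) = lam n powr (- (1 / \<alpha>))"
        unfolding powr_add[symmetric] by (simp add: field_simps)
      also have "\<dots> \<le> lam 0 powr (- (1 / \<alpha>))"
        using lam_0 lam_ge alpha by (intro powr_mono2') auto
      then have "C * lam n powr (- (1 / \<alpha>)) * amp x y n \<le> C * lam 0 powr (- (1 / \<alpha>)) * amp x y n"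
        using C_ge amp_nonneg by (intro mult_right_mono mult_left_mono) auto
      finally show "lam n powr - (2 / \<alpha>) * cmod (U' t (\<phi> n)) \<le> K * amp x y n * 1"
        by (simp add: K_def)
    qed (use K0 amp_nonneg in auto)
  }
qed

lemma sol_time_deriv':
  "has_time_deriv lam \<phi> (2 / \<alpha>) T (\<lambda>t. U' t) (\<lambda>t. U'' t)"
  unfolding has_time_deriv_def
proof (intro conjI ballI allI impI)
  have dual': "U' t \<in> hdual lam \<phi> (2 / \<alpha>)" if "t > 0" for t
    by (rule coeff_fun_hdual, rule wsum_weaken[OF _ wsum_mode'[OF amp0 that]]) (use alpha in \<open>simp add: divide_right_mono\<close>)
  have dual'': "U'' t \<in> hdual lam \<phi> (2 / \<alpha>)" if "t > 0" for t
    by (rule coeff_fun_hdual, rule wsum_mode''[OF amp0 that])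
  {
    fix t assume "t \<in> {0<..<T}"
    then show "U' t \<in> hdual lam \<phi> (2 / \<alpha>)" "U'' t \<in> hdual lam \<phi> (2 / \<alpha>)"
      using dual' dual'' by auto
  next
    fix a b assume ab: "0 < a \<and> a \<le> b \<and> b < T"
    show "has_bochner_hdual lam \<phi> (2 / \<alpha>) {a..b} (\<lambda>t. U'' t)
       (\<lambda>v. U' b v - U' a v)"
    proof (rule has_bochner_hdualI[where a = "\<lambda>n. C * amp x y n" and h = "\<lambda>t. 1 + t powr (\<alpha> - 2)"])
      show "U'' t \<in> hdual lam \<phi> (2 / \<alpha>)" if "t \<in> {a..b}" for t
        by (rule dual'') (use that ab in auto)
      show "(\<lambda>v. U' b v - U' a v) \<in> hdual lam \<phi> (2 / \<alpha>)"
        by (intro hdual_diff dual') (use ab in auto)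
      show "has_bochner_integral (lebesgue_on {a..b}) (\<lambda>t. U'' t (\<phi> n))
          (U' b (\<phi> n) - U' a (\<phi> n))" for n
        unfolding coeff_fun_basis using ab
        by (intro has_bochner_integral_FTC mode'_derivative[OF alpha(1)] continuous_on_mode'(2)[OF alpha(1)]) auto
      show "summable (\<lambda>n. (C * amp x y n)\<^sup>2)"
        using summable_mult[OF amp0[unfolded wsum_def], of "C\<^sup>2"] lam_pos
        by (simp add: power_mult_distrib amp_nonneg less_imp_neq[symmetric])
      show "integrable (lebesgue_on {a..b}) (\<lambda>t. 1 + t powr (\<alpha> - 2))"
        by (rule continuous_imp_integrable_real) (use ab in \<open>auto intro!: continuous_intros\<close>)
    qed (use ab C_ge amp_nonneg scaled_mode''_le in auto)
  }
qed

text \<open>Fractional integration of order \<open>2 - \<alpha>\<close> raises the parameters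
  \<open>\<alpha> - 1\<close> and \<open>\<alpha>\<close> of \<open>mode''\<close> to the parameters
  \<open>1\<close> and \<open>2\<close> of \<open>mode\<close>. The majorant in time is singular at
  both ends, with exponents \<open>1 - \<alpha>\<close> and \<open>\<alpha> - 2\<close>, and both
  exceed \<open>- 1\<close>.\<close>

lemma sol_caputo:
  assumes t: "0 < t"
  shows "has_caputo_deriv lam \<phi> (2 / \<alpha>) \<alpha> (\<lambda>t. U'' t) t
    (\<lambda>v. complex_of_real (1 / Gamma (2 - \<alpha>)) * coeff_fun (\<lambda>n. of_real (Gamma (2 - \<alpha>)) * (ipow (- \<alpha>) * (of_real (lam n) * m n t))) v)"
  unfolding has_caputo_deriv_def
proof (intro exI conjI refl)
  let ?k = "\<lambda>r. (t - r) powr (1 - \<alpha>)"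
  have m0: "wsum lam 0 (\<lambda>n. m n t)" by (rule wsum_mode[OF amp0]) (use t in simp)
  show "has_bochner_hdual lam \<phi> (2 / \<alpha>) {0<..<t} (\<lambda>r v. complex_of_real (?k r) * U'' r v)
     (coeff_fun (\<lambda>n. of_real (Gamma (2 - \<alpha>)) * (ipow (- \<alpha>) * (of_real (lam n) * m n t))))"
  proof (rule has_bochner_hdualI[where a = "\<lambda>n. C * amp x y n" and h = "\<lambda>r. ?k r * (1 + r powr (\<alpha> - 2))"])
    show "(\<lambda>v. complex_of_real (?k r) * U'' r v) \<in> hdual lam \<phi> (2 / \<alpha>)" if "r \<in> {0<..<t}" for r
      by (rule hdual_scale, rule coeff_fun_hdual, rule wsum_mode''[OF amp0]) (use that in simp)
    show "coeff_fun (\<lambda>n. of_real (Gamma (2 - \<alpha>)) * (ipow (- \<alpha>) * (of_real (lam n) * m n t))) \<in> hdual lam \<phi> (2 / \<alpha>)"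
      by (intro coeff_fun_hdual wsum_mult wsum_lam_mult m0)
    show "has_bochner_integral (lebesgue_on {0<..<t}) (\<lambda>r. complex_of_real (?k r) * U'' r (\<phi> n))
       (coeff_fun (\<lambda>n. of_real (Gamma (2 - \<alpha>)) * (ipow (- \<alpha>) * (of_real (lam n) * m n t))) (\<phi> n))" for n
    proof -
      let ?c = "ipow (- \<alpha>) * of_real (lam n)"
      have "has_bochner_integral (lebesgue_on {0<..<t}) (\<lambda>r. of_real ((t - r) powr (2 - \<alpha> - 1)) * ml_fun \<alpha> (\<alpha> - 1) ?c r) (of_real (Gamma (2 - \<alpha>)) * ml_fun \<alpha> (2 - \<alpha> + (\<alpha> - 1)) ?c t)"
        "has_bochner_integral (lebesgue_on {0<..<t}) (\<lambda>r. of_real ((t - r) powr (2 - \<alpha> - 1)) * ml_fun \<alpha> \<alpha> ?c r) (of_real (Gamma (2 - \<alpha>)) * ml_fun \<alpha> (2 - \<alpha> + \<alpha>) ?c t)"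
        by (rule has_bochner_integral_ml_fun; use alpha t in simp)+
      then have "has_bochner_integral (lebesgue_on {0<..<t})
          (\<lambda>r. x n * ?c * (of_real ((t - r) powr (2 - \<alpha> - 1)) * ml_fun \<alpha> (\<alpha> - 1) ?c r) + y n * ?c * (of_real ((t - r) powr (2 - \<alpha> - 1)) * ml_fun \<alpha> \<alpha> ?c r))
          (x n * ?c * (of_real (Gamma (2 - \<alpha>)) * ml_fun \<alpha> (2 - \<alpha> + (\<alpha> - 1)) ?c t) + y n * ?c * (of_real (Gamma (2 - \<alpha>)) * ml_fun \<alpha> (2 - \<alpha> + \<alpha>) ?c t))"
        by (intro has_bochner_integral_add has_bochner_integral_mult_right)
      moreover have "2 - \<alpha> - 1 = 1 - \<alpha>" "2 - \<alpha> + (\<alpha> - 1) = 1" "2 - \<alpha> + \<alpha> = 2" by auto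
      ultimately show ?thesis
        unfolding coeff_fun_basis mode''_def mode_ml_fun[OF t] Let_def
        by (simp add: algebra_simps)
    qed
    show "summable (\<lambda>n. (C * amp x y n)\<^sup>2)"
      using summable_mult[OF amp0[unfolded wsum_def], of "C\<^sup>2"] lam_pos
      by (simp add: power_mult_distrib amp_nonneg less_imp_neq[symmetric])
    show "integrable (lebesgue_on {0<..<t}) (\<lambda>r. ?k r * (1 + r powr (\<alpha> - 2)))"
    proof -
      \<comment> \<open>The two summands of \<open>1 + r powr (\<alpha> - 2)\<close> give one Beta
        integrand each, the first with \<open>1\<close> written as a zeroth power.\<close>
      have "has_bochner_integral (lebesgue_on {0<..<t}) (\<lambda>r. (t - r) powr (2 - \<alpha> - 1) * (r - 0) powr (1 - 1)) (Beta (2 - \<alpha>) 1 * (t - 0) powr (2 - \<alpha> + 1 - 1))"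
        by (rule has_bochner_integral_Beta_interval) (use alpha t in auto)
      then have 1: "integrable (lebesgue_on {0<..<t}) (\<lambda>r. (t - r) powr (2 - \<alpha> - 1) * (r - 0) powr (1 - 1))"
        by (simp only: has_bochner_integral_iff)
      have "has_bochner_integral (lebesgue_on {0<..<t}) (\<lambda>r. (t - r) powr (2 - \<alpha> - 1) * (r - 0) powr (\<alpha> - 1 - 1)) (Beta (2 - \<alpha>) (\<alpha> - 1) * (t - 0) powr (2 - \<alpha> + (\<alpha> - 1) - 1))"
        by (rule has_bochner_integral_Beta_interval) (use alpha t in auto)
      then have 2: "integrable (lebesgue_on {0<..<t}) (\<lambda>r. (t - r) powr (2 - \<alpha> - 1) * (r - 0) powr (\<alpha> - 1 - 1))"
        by (simp only: has_bochner_integral_iff)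
      show ?thesis
        by (rule Bochner_Integration.integrable_cong[THEN iffD1, OF refl _ Bochner_Integration.integrable_add[OF 1 2]])
           (auto simp: algebra_simps)
    qed
  next
    fix r n assume r: "r \<in> {0<..<t}"
    then have "r > 0" by simp
    from mult_left_mono[OF scaled_mode''_le[OF this, of n x y], of "?k r"]
    show "lam n powr (- (2 / \<alpha>)) * cmod (complex_of_real (?k r) * U'' r (\<phi> n)) \<le> C * amp x y n * (?k r * (1 + r powr (\<alpha> - 2)))"
      by (simp add: norm_mult mult_ac)
  qed (use C_ge amp_nonneg in auto)
qed (rule refl)

text \<open>At order \<open>- (1 / \<alpha>)\<close> the weight cancels the factor
  \<open>lam n powr (1 / \<alpha>)\<close> of the velocity bound, so the amplitude dominates
  uniformly in \<open>t\<close> and the limit may be taken mode by mode. Only the brackets of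
  \<open>g\<close> with the basis enter the norm.\<close>

lemma sol_initial_velocity:
  assumes g: "\<And>n. g (\<phi> n) = y n" and y: "wsum lam (- (1 / \<alpha>)) y"
  shows "((\<lambda>t. hnorm lam \<phi> (- (1 / \<alpha>)) (\<lambda>v. U' t v - g v)) \<longlongrightarrow> 0) (at_right 0)"
proof -
    let ?w = "\<lambda>n. lam n powr (2 * - (1 / \<alpha>))"
  have "((\<lambda>t. \<Sum>n. ?w n * (cmod (m' n t - y n))\<^sup>2) \<longlongrightarrow> (\<Sum>n. 0)) (at_right 0)"
  proof (rule tendsto_suminf_dominated)
    fix n
    have "((\<lambda>t. ?w n * (cmod (m' n t - y n))\<^sup>2) \<longlongrightarrow> ?w n * (cmod (y n - y n))\<^sup>2) (at_right 0)"
      by (intro tendsto_intros mode'_at_0 alpha)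
    then show "((\<lambda>t. ?w n * (cmod (m' n t - y n))\<^sup>2) \<longlongrightarrow> 0) (at_right 0)" by simp
  next
    show "\<forall>\<^sub>F t in at_right 0. \<forall>n. norm (?w n * (cmod (m' n t - y n))\<^sup>2) \<le> (C + 1)\<^sup>2 * (amp x y n)\<^sup>2"
      using eventually_at_right_less[of 0]
    proof eventually_elim
      case (elim t)
      show ?case
      proof
        fix n
        let ?p = "lam n powr (- (1 / \<alpha>))"
        have "?p * cmod (m' n t) \<le> ?p * (C * lam n powr (1 / \<alpha>) * amp x y n)"
          using mode'_le[OF elim] by (intro mult_left_mono) (auto simp: amp_def)
        also have "\<dots> = (?p * lam n powr (1 / \<alpha>)) * (C * amp x y n)" by (simp only: mult_ac)
        also have "?p * lam n powr (1 / \<alpha>) = 1" using lam_pos[of n] by (simp flip: powr_add)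
        finally have "?p * cmod (m' n t) \<le> C * amp x y n" by simp
        moreover have "?p * cmod (y n) \<le> amp x y n" by (simp add: amp_def)
        moreover have "?p * cmod (m' n t - y n) \<le> ?p * (cmod (m' n t) + cmod (y n))"
          by (intro mult_left_mono norm_triangle_ineq4) auto
        ultimately have "?p * cmod (m' n t - y n) \<le> (C + 1) * amp x y n" by (simp add: algebra_simps)
        then have "(?p * cmod (m' n t - y n))\<^sup>2 \<le> ((C + 1) * amp x y n)\<^sup>2" by (intro power_mono) auto
        then show "norm (?w n * (cmod (m' n t - y n))\<^sup>2) \<le> (C + 1)\<^sup>2 * (amp x y n)\<^sup>2"
          unfolding powr_double by (simp add: power_mult_distrib)
      qed
    qed
  next
    show "summable (\<lambda>n. (C + 1)\<^sup>2 * (amp x y n)\<^sup>2)"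
      using amp0 lam_pos unfolding wsum_def by (intro summable_mult) (simp add: amp_nonneg less_imp_neq[symmetric])
  qed
  from tendsto_real_sqrt[OF this] show ?thesis by (simp add: hnorm_def g)
qed

lemma sol_weak:
  assumes T: "0 < T" and f: "\<And>n. cinner u0 (\<phi> n) = x n" and g: "\<And>n. g (\<phi> n) = y n" and y: "wsum lam (- (1 / \<alpha>)) y"
  shows "weak_solution lam \<phi> \<alpha> T u0 g (sol x y)"
  unfolding weak_solution_def
proof (intro conjI exI)
  have cont: "((\<lambda>s. norm (sol x y s - sol x y t)) \<longlongrightarrow> 0) (at t within {0..T})" if "t \<in> {0..T}" for t
    using sol_continuous[OF amp0 that] by (simp add: hnorm_0_cinner)
  then show "continuous_on {0..T} (sol x y)"
    unfolding continuous_on_def by (blast intro: LIM_zero_cancel[OF tendsto_norm_zero_cancel])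
  show "has_time_deriv lam \<phi> (2 / \<alpha>) T (\<lambda>t. cinner (sol x y t)) (\<lambda>t. U' t)"
    by (rule sol_time_deriv)
  show "has_time_deriv lam \<phi> (2 / \<alpha>) T (\<lambda>t. U' t) (\<lambda>t. U'' t)"
    by (rule sol_time_deriv')
  have "sol x y 0 = u0"
    by (rule coeff_eqI) (simp add: cinner_sol mode_0 f)
  then show "((\<lambda>t. norm (sol x y t - u0)) \<longlongrightarrow> 0) (at_right 0)"
    using cont[of 0] T by (simp add: at_within_Icc_at_right)
  show "\<forall>\<^sub>F t in at_right 0. U' t \<in> hdual lam \<phi> (1 / \<alpha>)"
    using eventually_at_right_less[of 0] by eventually_elim (intro coeff_fun_hdual wsum_mode'[OF amp0])
  show "((\<lambda>t. hnorm lam \<phi> (- (1 / \<alpha>)) (\<lambda>v. U' t v - g v)) \<longlongrightarrow> 0) (at_right 0)"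
    by (rule sol_initial_velocity[OF g y])
  show "AE t in lebesgue_on {0<..<T}. \<exists>w.
           has_caputo_deriv lam \<phi> (2 / \<alpha>) \<alpha> (\<lambda>t. U'' t) t w \<and>
           w \<in> hdual lam \<phi> (2 / \<alpha>) \<and> op_ext lam \<phi> (sol x y t) \<in> hdual lam \<phi> (2 / \<alpha>) \<and>
           (\<forall>v\<in>hspace lam \<phi> (2 / \<alpha>). ipow \<alpha> * w v + op_ext lam \<phi> (sol x y t) v = 0)"
  proof (rule AE_I2, intro exI conjI ballI)
    fix t assume "t \<in> space (lebesgue_on {0<..<T})"
    then have t: "0 < t" by simp
    let ?z = "\<lambda>n. of_real (lam n) * m n t"
    let ?y = "coeff_fun (\<lambda>n. of_real (Gamma (2 - \<alpha>)) * (ipow (- \<alpha>) * ?z n))"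
    let ?w = "\<lambda>v. complex_of_real (1 / Gamma (2 - \<alpha>)) * ?y v"
    have z: "wsum lam (- (2 / \<alpha>)) ?z"
      using wsum_mode[OF amp0] t by (intro wsum_lam_mult) auto
    have op: "op_ext lam \<phi> (sol x y t) = (\<lambda>v. (- 1) * coeff_fun ?z v)"
      using t by (simp add: fun_eq_iff op_ext_def coeff_fun_def cinner_sol)
    show "has_caputo_deriv lam \<phi> (2 / \<alpha>) \<alpha> (\<lambda>t. U'' t) t ?w"
      by (rule sol_caputo[OF t])
    show "?w \<in> hdual lam \<phi> (2 / \<alpha>)"
      by (intro hdual_scale coeff_fun_hdual wsum_mult z)
    show "op_ext lam \<phi> (sol x y t) \<in> hdual lam \<phi> (2 / \<alpha>)"
      unfolding op by (intro hdual_scale coeff_fun_hdual z)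
    fix v assume v: "v \<in> hspace lam \<phi> (2 / \<alpha>)"
    have G: "Gamma (2 - \<alpha>) > 0" using alpha by (intro Gamma_real_pos) auto
    have i: "ipow \<alpha> * ipow (- \<alpha>) = 1" by (simp add: ipow_def exp_add[symmetric])
    have "?y v = of_real (Gamma (2 - \<alpha>)) * (ipow (- \<alpha>) * coeff_fun ?z v)"
      by (subst coeff_fun_mult[OF wsum_mult[OF z] v], subst coeff_fun_mult[OF z v]) simp
    then have "ipow \<alpha> * ?w v = (ipow \<alpha> * ipow (- \<alpha>)) * coeff_fun ?z v"
      using G by (simp add: field_simps)
    then show "ipow \<alpha> * ?w v + op_ext lam \<phi> (sol x y t) v = 0"
      unfolding op i by simp
  qed
qed

end

end

theorem theorem4p6:
  fixes A :: "'h::complex_hilbert_space \<Rightarrow> 'h" and D :: "'h set"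
    and lam :: "nat \<Rightarrow> real" and \<phi> :: "nat \<Rightarrow> 'h"
    and \<alpha> T s :: real
  assumes "self_adjoint D A" and "negative_definite D A" and "compact_resolvent D A"
    and "eigenbasis D A lam \<phi>"
    and "1 < \<alpha>" and "\<alpha> < 2" and "0 < T" and "0 \<le> s"
  shows "\<exists>C>0. \<forall>u0\<in>hspace lam \<phi> s. \<forall>u1\<in>hscale lam \<phi> (s - 1 / \<alpha>).
    \<exists>u. weak_solution lam \<phi> \<alpha> T u0 u1 u \<and> continuous_hspace lam \<phi> s T u \<and>
      (\<forall>v. weak_solution lam \<phi> \<alpha> T u0 u1 v \<longrightarrow> (\<forall>t\<in>{0..T}. v t = u t)) \<and>
      sup_hnorm lam \<phi> s T u
        \<le> C * (hnorm lam \<phi> s (cinner u0) + hnorm lam \<phi> (s - 1 / \<alpha>) u1) \<and>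
      (\<forall>t\<in>{0..T}.
        summable (\<lambda>n. (cinner u0 (\<phi> n) *
          mittag_leffler \<alpha> 1 (ipow (- \<alpha>) * complex_of_real (lam n * t powr \<alpha>))) *\<^sub>C \<phi> n) \<and>
        summable (\<lambda>n. (u1 (\<phi> n) * complex_of_real t *
          mittag_leffler \<alpha> 2 (ipow (- \<alpha>) * complex_of_real (lam n * t powr \<alpha>))) *\<^sub>C \<phi> n) \<and>
        u t =
          (\<Sum>n. (cinner u0 (\<phi> n) *
            mittag_leffler \<alpha> 1 (ipow (- \<alpha>) * complex_of_real (lam n * t powr \<alpha>))) *\<^sub>C \<phi> n) +
          (\<Sum>n. (u1 (\<phi> n) * complex_of_real t *
            mittag_leffler \<alpha> 2 (ipow (- \<alpha>) * complex_of_real (lam n * t powr \<alpha>))) *\<^sub>C \<phi> n))"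
proof -
  interpret spectral_scale lam \<phi>
    using assms(4) unfolding eigenbasis_def by unfold_locales auto
  obtain C where "C \<ge> 1"
    "\<And>x y n t. t \<ge> 0 \<Longrightarrow> cmod (mode \<alpha> x y n t) \<le> C * (cmod x + lam n powr (- (1 / \<alpha>)) * cmod y)"
    "\<And>x y n t. t > 0 \<Longrightarrow> cmod (mode' \<alpha> x y n t) \<le> C * lam n powr (1 / \<alpha>) * (cmod x + lam n powr (- (1 / \<alpha>)) * cmod y)"
    "\<And>x y n t. t > 0 \<Longrightarrow> cmod (mode'' \<alpha> x y n t) \<le> C * (1 + t powr (\<alpha> - 2)) * lam n powr (2 / \<alpha>) * (cmod x + lam n powr (- (1 / \<alpha>)) * cmod y)"
    by (rule mode_bounds[OF assms(5,6)]) (rule that)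
  then interpret mode_bounded lam \<phi> \<alpha> C
    using assms(5,6) by unfold_locales
  show ?thesis
  \<comment> \<open>\<open>C\<close> bounds the modes by the amplitude, and \<open>2\<close> passes
    from the amplitude to the two norms of the data.\<close>
  proof (rule exI[of _ "2 * C"], rule conjI, use C_ge in simp, intro ballI)
    fix u0 u1 assume u0: "u0 \<in> hspace lam \<phi> s" and u1: "u1 \<in> hscale lam \<phi> (s - 1 / \<alpha>)"
    define x where "x = (\<lambda>n. cinner u0 (\<phi> n))"
    define y where "y = (\<lambda>n. u1 (\<phi> n))"
    have wx: "wsum lam s x" using u0 by (simp add: hspace_iff x_def)
    have wy: "wsum lam (s - 1 / \<alpha>) y" using hscale_wsum[OF u1] by (simp add: y_def)
    have x0: "wsum lam 0 x" by (rule wsum_weaken[OF assms(8) wx])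
    have y0: "wsum lam (- (1 / \<alpha>)) y" "wsum lam (0 - 1 / \<alpha>) y"
      by (rule wsum_weaken[OF _ wy]; use assms(8) in simp)+
    have amp_s: "wsum lam s (\<lambda>n. of_real (amp x y n))" by (rule wsum_amp[OF wx wy])
    have amp_0: "wsum lam 0 (\<lambda>n. of_real (amp x y n))" by (rule wsum_amp[OF x0 y0(2)])
    let ?u = "sol x y"
    have weak: "weak_solution lam \<phi> \<alpha> T u0 u1 ?u"
      by (rule sol_weak[OF amp_0 assms(7) _ _ y0(1)]) (simp_all add: x_def y_def)
    have cont: "continuous_hspace lam \<phi> s T ?u"
      unfolding continuous_hspace_def
    proof (intro conjI ballI)
      fix t assume t: "t \<in> {0..T}"
      then show "?u t \<in> hspace lam \<phi> s"
        using wsum_mode[OF amp_s, of t] by (simp add: hspace_iff cinner_sol[OF amp_0])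
      show "((\<lambda>r. hnorm lam \<phi> s (cinner (?u r - ?u t))) \<longlongrightarrow> 0) (at t within {0..T})"
        by (rule sol_continuous[OF amp_0 amp_s t])
    qed
    have unique: "v t = ?u t" if "weak_solution lam \<phi> \<alpha> T u0 u1 v" "t \<in> {0..T}" for v t
      by (rule weak_solution_unique[OF assms(5-7) y0(1)[unfolded y_def] weak that])
    have bound: "sup_hnorm lam \<phi> s T ?u \<le> 2 * C * (hnorm lam \<phi> s (cinner u0) + hnorm lam \<phi> (s - 1 / \<alpha>) u1)"
      unfolding sup_hnorm_def
    proof (rule cSUP_least)
      show "{0..T} \<noteq> {}" using assms(7) by simp
      fix t assume "t \<in> {0..T}"
      then have "hnorm lam \<phi> s (cinner (?u t)) \<le> C * sqrt (\<Sum>n. lam n powr (2 * s) * (amp x y n)\<^sup>2)"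
        by (intro sol_hnorm_le[OF amp_0 amp_s]) simp
      also have "\<dots> \<le> C * (2 * (hnorm lam \<phi> s (cinner u0) + hnorm lam \<phi> (s - 1 / \<alpha>) u1))"
        using hnorm_amp_le[of s "cinner u0" u1] wx wy C_ge
        unfolding x_def y_def by (intro mult_left_mono) auto
      finally show "hnorm lam \<phi> s (cinner (?u t)) \<le> 2 * C * (hnorm lam \<phi> s (cinner u0) + hnorm lam \<phi> (s - 1 / \<alpha>) u1)"
        by (simp add: mult_ac)
    qed
    let ?E = "\<lambda>\<beta> n t. mittag_leffler \<alpha> \<beta> (ipow (- \<alpha>) * complex_of_real (lam n * t powr \<alpha>))"
    have series: "summable (\<lambda>n. (cinner u0 (\<phi> n) * ?E 1 n t) *\<^sub>C \<phi> n) \<and>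
        summable (\<lambda>n. (u1 (\<phi> n) * complex_of_real t * ?E 2 n t) *\<^sub>C \<phi> n) \<and>
        ?u t = (\<Sum>n. (cinner u0 (\<phi> n) * ?E 1 n t) *\<^sub>C \<phi> n) + (\<Sum>n. (u1 (\<phi> n) * complex_of_real t * ?E 2 n t) *\<^sub>C \<phi> n)"
      if "t \<in> {0..T}" for t
    proof -
      have t: "0 \<le> t" using that by simp
      \<comment> \<open>A mode with one datum set to zero is a single summand of the formula, so
        each series converges separately as the solution for partial data.\<close>
      have "summable (\<lambda>n. mode \<alpha> (x n) 0 n t *\<^sub>C \<phi> n)"
        by (rule riesz_fischer(1)[OF wsum_mode[OF wsum_amp[OF x0 wsum_zero] t]])
      then have 1: "summable (\<lambda>n. (cinner u0 (\<phi> n) * ?E 1 n t) *\<^sub>C \<phi> n)"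
        by (simp add: mode_def x_def)
      have "summable (\<lambda>n. mode \<alpha> 0 (y n) n t *\<^sub>C \<phi> n)"
        by (rule riesz_fischer(1)[OF wsum_mode[OF wsum_amp[OF wsum_zero y0(2)] t]])
      then have 2: "summable (\<lambda>n. (u1 (\<phi> n) * complex_of_real t * ?E 2 n t) *\<^sub>C \<phi> n)"
        by (simp add: mode_def y_def)
      show ?thesis
        using 1 2 suminf_add[OF 1 2] by (simp add: sol_def mode_def x_def y_def scaleC_add_left)
    qed
    show "\<exists>u. weak_solution lam \<phi> \<alpha> T u0 u1 u \<and> continuous_hspace lam \<phi> s T u \<and>
      (\<forall>v. weak_solution lam \<phi> \<alpha> T u0 u1 v \<longrightarrow> (\<forall>t\<in>{0..T}. v t = u t)) \<and>
      sup_hnorm lam \<phi> s T u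
        \<le> 2 * C * (hnorm lam \<phi> s (cinner u0) + hnorm lam \<phi> (s - 1 / \<alpha>) u1) \<and>
      (\<forall>t\<in>{0..T}.
        summable (\<lambda>n. (cinner u0 (\<phi> n) *
          mittag_leffler \<alpha> 1 (ipow (- \<alpha>) * complex_of_real (lam n * t powr \<alpha>))) *\<^sub>C \<phi> n) \<and>
        summable (\<lambda>n. (u1 (\<phi> n) * complex_of_real t *
          mittag_leffler \<alpha> 2 (ipow (- \<alpha>) * complex_of_real (lam n * t powr \<alpha>))) *\<^sub>C \<phi> n) \<and>
        u t =
          (\<Sum>n. (cinner u0 (\<phi> n) *
            mittag_leffler \<alpha> 1 (ipow (- \<alpha>) * complex_of_real (lam n * t powr \<alpha>))) *\<^sub>C \<phi> n) +
          (\<Sum>n. (u1 (\<phi> n) * complex_of_real t *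
            mittag_leffler \<alpha> 2 (ipow (- \<alpha>) * complex_of_real (lam n * t powr \<alpha>))) *\<^sub>C \<phi> n))"
      by (rule exI[of _ ?u], intro conjI, rule weak, rule cont, intro allI impI ballI, erule (1) unique, rule bound, rule ballI, erule series)
  qed
qed

end
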